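(* Let $K$ be a field, $n\le r$ integers, and $(A_1,A_2,A_3)$ a triple of matrices in $M_n(K)$ such that (i) $\operatorname{Im}[A_1,A_2]$, $\operatorname{Im}[A_1,A_3]$, $\operatorname{Im}[A_2,A_3]$ all have dimension $2(r-n)$, and (ii) $\operatorname{Im}[A_1,A_2]+\operatorname{Im}[A_1,A_3]$, $\operatorname{Im}[A_2,A_1]+\operatorname{Im}[A_2,A_3]$, $\operatorname{Im}[A_3,A_1]+\operatorname{Im}[A_3,A_2]$ all have dimension $3(r-n)$. Then the algorithm described in the context runs in polynomial time (the number of arithmetic operations and equality tests on elements of $K$ is polynomially bounded in $n$), and it outputs a commuting extension of size $r$ of $(A_1,A_2,A_3)$ if such an extension exists; otherwise it rejects.
   Context: $[A,B]=AB-BA$; $\operatorname{Im} A$ is the column space; $M_{a,b}(K)$ are $a\times b$ matrices. A tuple $(Z_1,\ldots,Z_p)$ of $r\times r$ matrices is a commuting extension of size $r$ of $(A_1,\ldots,A_p)$ ($n\times n$) if the $Z_i$ pairwise commute and $Z_i=\begin{pmatrix} A_i & B_i\\ C_i & D_i\end{pmatrix}$ with $B_i\in M_{n,r-n}(K)$, $C_i\in M_{r-n,n}(K)$, $D_i\in M_{r-n}(K)$. The algorithm, on input $(A_1,A_2,A_3)$: Step 1: compute an arbitrary basis of $\operatorname{Im}[A_1,A_2]\cap\operatorname{Im}[A_1,A_3]$ and let $B_1\in M_{n,r-n}(K)$ be the matrix whose columns are this basis. Step 2: let $V_2=\operatorname{Im}[A_2,A_1]\cap\operatorname{Im}[A_2,A_3]$;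 compute a basis of $V_2$ and use it to write $[A_1,A_2]=M_1-M_2$ with $\operatorname{Im}M_1\subseteq\operatorname{Im}B_1$, $\operatorname{Im}M_2\subseteq V_2$; then compute $C_2$ with $B_1C_2=M_2$. Step 3: let $V_3=\operatorname{Im}[A_3,A_1]\cap\operatorname{Im}[A_3,A_2]$; compute a basis and write $[A_2,A_3]=N_3-N_2$ with $\operatorname{Im}N_3\subseteq V_3$, $\operatorname{Im}N_2\subseteq V_2$; compute $B_3$ with $B_3C_2=N_3$. Step 4: write $[A_1,A_3]=P_3-P_1$ with $\operatorname{Im}P_3\subseteq V_3$, $\operatorname{Im}P_1\subseteq\operatorname{Im}B_1$; compute $C_1$ with $P_3=B_3C_1$. Step 5: compute $C_3$ with $P_1=B_1C_3$. Step 6: compute $B_2$ with $N_2=B_2C_3$. Step 7: solve $B_3X-B_2Y=A_2B_3-A_3B_2$ and set $D_2=X$, $D_3=Y$. Step 8: compute $D_1$ with $B_2D_1-B_1D_2=A_1B_2-A_2B_1$. Step 9: form $Z_i=\begin{pmatrix} A_i & B_i\\ C_i & D_i\end{pmatrix}$, $i=1,2,3$; if they pairwise commute output $(Z_1,Z_2,Z_3)$, otherwise reject. If at any step a linear system has no solution the algorithm rejects; if in Steps 2–8 the solution found for one of the blocks $B_i,C_i,D_i$ (or the required decomposition) is not unique, it rejects.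
   Formalization: In Step 2 the two inclusions are exchanged: [A1,A2]=M1−M2 with Im M1 ⊆ V2 and Im M2 ⊆ Im B1 (then B1C2=M2), because with the printed inclusions the algorithm rejects every input with r>n that has a commuting extension. *)

theory Defs
  imports "Jordan_Normal_Form.DL_Rank" "HOL-Library.Monad_Syntax"
    "HOL-Computational_Algebra.Polynomial"
begin

section \<open>Commuting extensions\<close>

definition commutator :: "'a::ring mat \<Rightarrow> 'a mat \<Rightarrow> 'a mat" where
  "commutator A B = A * B - B * A"

abbreviation mat_image :: "'a::field mat \<Rightarrow> 'a vec set" where
  "mat_image A \<equiv> vec_space.col_space (dim_row A) A"

abbreviation vec_subspace ::
  "nat \<Rightarrow> 'a::field vec set \<Rightarrow> ('a, 'a vec) module" where
  "vec_subspace n W \<equiv> (module_vec TYPE('a) n)\<lparr>carrier := W\<rparr>"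

abbreviation subspace_dim :: "nat \<Rightarrow> 'a::field vec set \<Rightarrow> nat" where
  "subspace_dim n W \<equiv> vectorspace.dim class_ring (vec_subspace n W)"

abbreviation subspace_sum :: "nat \<Rightarrow> 'a::field vec set \<Rightarrow> 'a vec set \<Rightarrow> 'a vec set" where
  "subspace_sum n \<equiv> LinearCombinations.module.submodule_sum (module_vec TYPE('a) n)"

definition commuting_extension ::
  "nat \<Rightarrow> nat \<Rightarrow> 'a::field mat list \<Rightarrow> 'a mat list \<Rightarrow> bool" where
  "commuting_extension n r As Zs \<longleftrightarrow>
     length Zs = length As \<and>
     (\<forall>Z\<in>set Zs. \<forall>Z'\<in>set Zs. Z * Z' = Z' * Z) \<and>
     (\<forall>i<length As. \<exists>B\<in>carrier_mat n (r - n). \<exists>C\<in>carrier_mat (r - n) n.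
        \<exists>D\<in>carrier_mat (r - n) (r - n). Zs ! i = four_block_mat (As ! i) B C D)"

section \<open>The algorithm on matrices\<close>

definition columns_basis_of :: "'a::field mat \<Rightarrow> 'a vec set \<Rightarrow> bool" where
  "columns_basis_of B W \<longleftrightarrow> distinct (cols B) \<and>
     vectorspace.basis class_ring (vec_subspace (dim_row B) W) (set (cols B))"

definition unique_solution :: "('b \<Rightarrow> bool) \<Rightarrow> 'b option" where
  "unique_solution P = (if \<exists>!x. P x then Some (THE x. P x) else None)"

text \<open>
  The algorithm after the choice of the basis \<open>B1\<close> of the first intersection; the value \<open>None\<close> means
  that it rejects. If \<open>(Z1, Z2, Z3)\<close> is a commuting extension then
  \<open>[A1, A2] = B2 * C1 - B1 * C2\<close>, so the part \<open>M2\<close> of \<open>[A1, A2] = M1 - M2\<close> from which \<open>C2\<close> is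
  obtained has its columns in the image of \<open>B1\<close>, and \<open>M1\<close> has its columns in \<open>V2\<close>.
\<close>

definition commext_from_basis ::
  "'a::field mat \<Rightarrow> 'a mat \<Rightarrow> 'a mat \<Rightarrow> 'a mat \<Rightarrow> ('a mat \<times> 'a mat \<times> 'a mat) option" where
  "commext_from_basis A1 A2 A3 B1 = (
     let n = dim_row A1;
         d = dim_col B1;
         V2 = mat_image (commutator A2 A1) \<inter> mat_image (commutator A2 A3);
         V3 = mat_image (commutator A3 A1) \<inter> mat_image (commutator A3 A2)
     in do {
       (M1, M2) \<leftarrow> unique_solution (\<lambda>(M1, M2).
          M1 \<in> carrier_mat n n \<and> M2 \<in> carrier_mat n n \<and> commutator A1 A2 = M1 - M2 \<and>
          mat_image M1 \<subseteq> V2 \<and> mat_image M2 \<subseteq> mat_image B1);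
       C2 \<leftarrow> unique_solution (\<lambda>C2. C2 \<in> carrier_mat d n \<and> B1 * C2 = M2);
       (N3, N2) \<leftarrow> unique_solution (\<lambda>(N3, N2).
          N3 \<in> carrier_mat n n \<and> N2 \<in> carrier_mat n n \<and> commutator A2 A3 = N3 - N2 \<and>
          mat_image N3 \<subseteq> V3 \<and> mat_image N2 \<subseteq> V2);
       B3 \<leftarrow> unique_solution (\<lambda>B3. B3 \<in> carrier_mat n d \<and> B3 * C2 = N3);
       (P3, P1) \<leftarrow> unique_solution (\<lambda>(P3, P1).
          P3 \<in> carrier_mat n n \<and> P1 \<in> carrier_mat n n \<and> commutator A1 A3 = P3 - P1 \<and>
          mat_image P3 \<subseteq> V3 \<and> mat_image P1 \<subseteq> mat_image B1);
       C1 \<leftarrow> unique_solution (\<lambda>C1. C1 \<in> carrier_mat d n \<and> P3 = B3 * C1);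
       C3 \<leftarrow> unique_solution (\<lambda>C3. C3 \<in> carrier_mat d n \<and> P1 = B1 * C3);
       B2 \<leftarrow> unique_solution (\<lambda>B2. B2 \<in> carrier_mat n d \<and> N2 = B2 * C3);
       (D2, D3) \<leftarrow> unique_solution (\<lambda>(X, Y).
          X \<in> carrier_mat d d \<and> Y \<in> carrier_mat d d \<and>
          B3 * X - B2 * Y = A2 * B3 - A3 * B2);
       D1 \<leftarrow> unique_solution (\<lambda>D1.
          D1 \<in> carrier_mat d d \<and> B2 * D1 - B1 * D2 = A1 * B2 - A2 * B1);
       let Z1 = four_block_mat A1 B1 C1 D1;
           Z2 = four_block_mat A2 B2 C2 D2;
           Z3 = four_block_mat A3 B3 C3 D3
       in if Z1 * Z2 = Z2 * Z1 \<and> Z1 * Z3 = Z3 * Z1 \<and> Z2 * Z3 = Z3 * Z2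
          then Some (Z1, Z2, Z3) else None
     })"

definition commext_result ::
  "'a::field mat \<Rightarrow> 'a mat \<Rightarrow> 'a mat \<Rightarrow> ('a mat \<times> 'a mat \<times> 'a mat) option \<Rightarrow> bool" where
  "commext_result A1 A2 A3 res \<longleftrightarrow>
     (\<exists>B1. dim_row B1 = dim_row A1 \<and>
        columns_basis_of B1 (mat_image (commutator A1 A2) \<inter> mat_image (commutator A1 A3)) \<and>
        res = commext_from_basis A1 A2 A3 B1)"

section \<open>Programs over a field\<close>

text \<open>
  Programs see field elements only as indices (registers) into a growing memory, so a program is
  the same object for all fields and can only inspect a field element by an equality test.
  \<open>Arith\<close> stores its result in the next free register and passes the index of that
  register on.
\<close>

type_synonym reg = nat

datatype arith = Plus | Minus | Times | Divide

primrec arith_op :: "arith \<Rightarrow> 'k::field \<Rightarrow> 'k \<Rightarrow> 'k" where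
  "arith_op Plus x y = x + y"
| "arith_op Minus x y = x - y"
| "arith_op Times x y = x * y"
| "arith_op Divide x y = x / y"

datatype 'a prog =
    Return 'a
  | Reject
  | Arith arith reg reg "reg \<Rightarrow> 'a prog"
  | Test reg reg "bool \<Rightarrow> 'a prog"

primrec exec :: "'a prog \<Rightarrow> 'k::field list \<Rightarrow> ('a \<times> 'k list) option" where
  "exec (Return x) mem = Some (x, mem)"
| "exec Reject mem = None"
| "exec (Arith f i j k) mem = exec (k (length mem)) (mem @ [arith_op f (mem ! i) (mem ! j)])"
| "exec (Test i j k) mem = exec (k (mem ! i = mem ! j)) mem"

primrec num_ops :: "'a prog \<Rightarrow> 'k::field list \<Rightarrow> nat" where
  "num_ops (Return x) mem = 0"
| "num_ops Reject mem = 0"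
| "num_ops (Arith f i j k) mem =
     Suc (num_ops (k (length mem)) (mem @ [arith_op f (mem ! i) (mem ! j)]))"
| "num_ops (Test i j k) mem = Suc (num_ops (k (mem ! i = mem ! j)) mem)"

text \<open>
  The largest number of arithmetic operations and equality tests on any execution path that starts
  with \<open>m\<close> registers in use.
\<close>

primrec max_ops :: "'a prog \<Rightarrow> nat \<Rightarrow> nat" where
  "max_ops (Return x) m = 0"
| "max_ops Reject m = 0"
| "max_ops (Arith f i j k) m = Suc (max_ops (k m) (Suc m))"
| "max_ops (Test i j k) m = Suc (max (max_ops (k True) m) (max_ops (k False) m))"

lemma num_ops_le_max_ops: "num_ops p mem \<le> max_ops p (length mem)"
proof (induction p arbitrary: mem)
  case (Arith f i j k)
  have "num_ops (k (length mem)) (mem @ [arith_op f (mem ! i) (mem ! j)])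
      \<le> max_ops (k (length mem)) (length (mem @ [arith_op f (mem ! i) (mem ! j)]))"
    by (rule Arith.IH) simp
  then show ?case by simp
next
  case (Test i j k)
  have "num_ops (k b) mem \<le> max_ops (k b) (length mem)" for b
    by (rule Test.IH) simp
  then show ?case
    by (cases "mem ! i = mem ! j") (simp_all add: max.coboundedI1 max.coboundedI2)
qed simp_all

primrec prog_bind :: "'a prog \<Rightarrow> ('a \<Rightarrow> 'b prog) \<Rightarrow> 'b prog" where
  "prog_bind (Return x) f = f x"
| "prog_bind Reject f = Reject"
| "prog_bind (Arith g i j k) f = Arith g i j (\<lambda>h. prog_bind (k h) f)"
| "prog_bind (Test i j k) f = Test i j (\<lambda>b. prog_bind (k b) f)"

adhoc_overloading Monad_Syntax.bind \<rightleftharpoons> prog_bind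

definition arith :: "arith \<Rightarrow> reg \<Rightarrow> reg \<Rightarrow> reg prog" where
  "arith f i j = Arith f i j Return"

definition test_eq :: "reg \<Rightarrow> reg \<Rightarrow> bool prog" where
  "test_eq i j = Test i j Return"

primrec map_prog :: "('a \<Rightarrow> 'b prog) \<Rightarrow> 'a list \<Rightarrow> 'b list prog" where
  "map_prog f [] = Return []"
| "map_prog f (x # xs) = do { y \<leftarrow> f x; ys \<leftarrow> map_prog f xs; Return (y # ys) }"

text \<open>The constants 0 and 1 are preloaded into the first two registers.\<close>

definition zero_reg :: reg where "zero_reg = 0"
definition one_reg :: reg where "one_reg = 1"

section \<open>Linear algebra programs\<close>

text \<open>In this section, vectors and matrices have registers as entries.\<close>

definition build_mat :: "nat \<Rightarrow> nat \<Rightarrow> (nat \<Rightarrow> nat \<Rightarrow> reg prog) \<Rightarrow> reg mat prog" where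
  "build_mat nr nc f = do {
     rs \<leftarrow> map_prog (\<lambda>i. map_prog (\<lambda>j. f i j) [0..<nc]) [0..<nr];
     Return (mat_of_rows_list nc rs) }"

fun dot_prog :: "reg list \<Rightarrow> reg list \<Rightarrow> reg prog" where
  "dot_prog (x # xs) (y # ys) = do {
     p \<leftarrow> arith Times x y;
     s \<leftarrow> dot_prog xs ys;
     arith Plus p s }"
| "dot_prog _ _ = Return zero_reg"

definition mult_prog :: "reg mat \<Rightarrow> reg mat \<Rightarrow> reg mat prog" where
  "mult_prog A B = build_mat (dim_row A) (dim_col B)
     (\<lambda>i j. dot_prog (list_of_vec (row A i)) (list_of_vec (col B j)))"

definition add_prog :: "reg mat \<Rightarrow> reg mat \<Rightarrow> reg mat prog" where
  "add_prog A B = build_mat (dim_row A) (dim_col A)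
     (\<lambda>i j. arith Plus (A $$ (i, j)) (B $$ (i, j)))"

definition sub_prog :: "reg mat \<Rightarrow> reg mat \<Rightarrow> reg mat prog" where
  "sub_prog A B = build_mat (dim_row A) (dim_col A)
     (\<lambda>i j. arith Minus (A $$ (i, j)) (B $$ (i, j)))"

definition neg_prog :: "reg mat \<Rightarrow> reg mat prog" where
  "neg_prog A = build_mat (dim_row A) (dim_col A)
     (\<lambda>i j. arith Minus zero_reg (A $$ (i, j)))"

definition commutator_prog :: "reg mat \<Rightarrow> reg mat \<Rightarrow> reg mat prog" where
  "commutator_prog A B = do {
     P \<leftarrow> mult_prog A B;
     Q \<leftarrow> mult_prog B A;
     sub_prog P Q }"

definition require_eq :: "reg mat \<Rightarrow> reg mat \<Rightarrow> unit prog" where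
  "require_eq A B = do {
     map_prog (\<lambda>i. map_prog (\<lambda>j. do {
         b \<leftarrow> test_eq (A $$ (i, j)) (B $$ (i, j));
         if b then Return () else Reject }) [0..<dim_col A]) [0..<dim_row A];
     Return () }"

definition hcat :: "'a mat \<Rightarrow> 'a mat \<Rightarrow> 'a mat" where
  "hcat A B = mat (dim_row A) (dim_col A + dim_col B)
     (\<lambda>(i, j). if j < dim_col A then A $$ (i, j) else B $$ (i, j - dim_col A))"

definition upper_rows :: "nat \<Rightarrow> 'a mat \<Rightarrow> 'a mat" where
  "upper_rows k S = mat k (dim_col S) (\<lambda>(i, j). S $$ (i, j))"

definition lower_rows :: "nat \<Rightarrow> 'a mat \<Rightarrow> 'a mat" where
  "lower_rows k S = mat (dim_row S - k) (dim_col S) (\<lambda>(i, j). S $$ (k + i, j))"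

text \<open>
  Each vector \<open>v\<close> is paired with the value \<open>s\<close> of a linear form on it. From a basis of
  a space, \<open>eliminate\<close> computes a basis of the subspace on which the form vanishes: the first vector
  on which the form is nonzero serves as pivot and is dropped.
\<close>

fun eliminate :: "(reg list \<times> reg) list \<Rightarrow> reg list list prog" where
  "eliminate [] = Return []"
| "eliminate ((v, s) # ps) = do {
     z \<leftarrow> test_eq s zero_reg;
     if z then do { vs \<leftarrow> eliminate ps; Return (v # vs) }
     else map_prog (\<lambda>(w, t). do {
         c \<leftarrow> arith Divide t s;
         map_prog (\<lambda>(x, y). do { u \<leftarrow> arith Times c y; arith Minus x u }) (zip w v) }) ps }"

primrec kernel_rows :: "reg list list \<Rightarrow> reg list list \<Rightarrow> reg list list prog" where
  "kernel_rows [] vs = Return vs"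
| "kernel_rows (a # as) vs = do {
     ss \<leftarrow> map_prog (dot_prog a) vs;
     vs' \<leftarrow> eliminate (zip vs ss);
     kernel_rows as vs' }"

definition kernel_prog :: "reg mat \<Rightarrow> reg list list prog" where
  "kernel_prog M = kernel_rows (map list_of_vec (rows M))
     (map (\<lambda>i. map (\<lambda>j. if i = j then one_reg else zero_reg) [0..<dim_col M]) [0..<dim_col M])"

definition kernel_mat_prog :: "reg mat \<Rightarrow> reg mat prog" where
  "kernel_mat_prog M = do {
     vs \<leftarrow> kernel_prog M;
     Return (mat_of_cols_list (dim_col M) vs) }"

text \<open>
  The image of a matrix consists of the vectors annihilated by its left kernel, so the intersection
  of two images is the space annihilated by both left kernels.
\<close>

definition image_inter_prog :: "reg mat \<Rightarrow> reg mat \<Rightarrow> reg mat prog" where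
  "image_inter_prog M N = do {
     L \<leftarrow> kernel_mat_prog (transpose_mat M);
     L' \<leftarrow> kernel_mat_prog (transpose_mat N);
     kernel_mat_prog (transpose_mat (hcat L L')) }"

text \<open>
  For a column \<open>b\<close>, the system \<open>A x = b\<close> has exactly one solution iff the kernel of \<open>(A | b)\<close> is
  spanned by one vector \<open>(y, t)\<close> with \<open>t \<noteq> 0\<close>; the solution is then \<open>- y / t\<close>.
\<close>

definition solve_prog :: "reg mat \<Rightarrow> reg mat \<Rightarrow> reg mat prog" where
  "solve_prog A B = do {
     cs \<leftarrow> map_prog (\<lambda>j. do {
         vs \<leftarrow> kernel_prog (hcat A (mat_of_cols (dim_row A) [col B j]));
         case vs of
           [v] \<Rightarrow> do {
             z \<leftarrow> test_eq (last v) zero_reg;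
             if z then Reject
             else map_prog (\<lambda>y. do { q \<leftarrow> arith Divide y (last v); arith Minus zero_reg q })
                    (butlast v) }
         | _ \<Rightarrow> Reject }) [0..<dim_col B];
     Return (mat_of_cols_list (dim_col A) cs) }"

definition solve_left_prog :: "reg mat \<Rightarrow> reg mat \<Rightarrow> reg mat prog" where
  "solve_left_prog C N = do {
     X \<leftarrow> solve_prog (transpose_mat C) (transpose_mat N);
     Return (transpose_mat X) }"

text \<open>
  Write \<open>M = P - Q\<close> with the columns of \<open>P\<close> and \<open>Q\<close> in the images of \<open>U\<close> and \<open>W\<close>; here
  \<open>U\<close> and \<open>W\<close> have linearly independent columns.
\<close>

definition decompose_prog :: "reg mat \<Rightarrow> reg mat \<Rightarrow> reg mat \<Rightarrow> (reg mat \<times> reg mat) prog" where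
  "decompose_prog U W M = do {
     S \<leftarrow> solve_prog (hcat U W) M;
     P \<leftarrow> mult_prog U (upper_rows (dim_col U) S);
     T \<leftarrow> mult_prog W (lower_rows (dim_col U) S);
     Q \<leftarrow> neg_prog T;
     Return (P, Q) }"

section \<open>The algorithm as a program\<close>

definition input_reg_mat :: "nat \<Rightarrow> nat \<Rightarrow> reg mat" where
  "input_reg_mat n k = mat n n (\<lambda>(i, j). 2 + k * (n * n) + i * n + j)"

definition commext_prog :: "nat \<Rightarrow> (reg mat \<times> reg mat \<times> reg mat) prog" where
  "commext_prog n = (
     let A1 = input_reg_mat n 0; A2 = input_reg_mat n 1; A3 = input_reg_mat n 2
     in do {
       A12 \<leftarrow> commutator_prog A1 A2;
       A13 \<leftarrow> commutator_prog A1 A3;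
       A21 \<leftarrow> commutator_prog A2 A1;
       A23 \<leftarrow> commutator_prog A2 A3;
       A31 \<leftarrow> commutator_prog A3 A1;
       A32 \<leftarrow> commutator_prog A3 A2;
       B1 \<leftarrow> image_inter_prog A12 A13;
       V2 \<leftarrow> image_inter_prog A21 A23;
       (M1, M2) \<leftarrow> decompose_prog V2 B1 A12;
       C2 \<leftarrow> solve_prog B1 M2;
       V3 \<leftarrow> image_inter_prog A31 A32;
       (N3, N2) \<leftarrow> decompose_prog V3 V2 A23;
       B3 \<leftarrow> solve_left_prog C2 N3;
       (P3, P1) \<leftarrow> decompose_prog V3 B1 A13;
       C1 \<leftarrow> solve_prog B3 P3;
       C3 \<leftarrow> solve_prog B1 P1;
       B2 \<leftarrow> solve_left_prog C3 N2;
       A2B3 \<leftarrow> mult_prog A2 B3;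
       A3B2 \<leftarrow> mult_prog A3 B2;
       R \<leftarrow> sub_prog A2B3 A3B2;
       B2' \<leftarrow> neg_prog B2;
       S \<leftarrow> solve_prog (hcat B3 B2') R;
       let D2 = upper_rows (dim_col B1) S;
       let D3 = lower_rows (dim_col B1) S;
       A1B2 \<leftarrow> mult_prog A1 B2;
       A2B1 \<leftarrow> mult_prog A2 B1;
       T \<leftarrow> sub_prog A1B2 A2B1;
       B1D2 \<leftarrow> mult_prog B1 D2;
       T' \<leftarrow> add_prog T B1D2;
       D1 \<leftarrow> solve_prog B2 T';
       let Z1 = four_block_mat A1 B1 C1 D1;
       let Z2 = four_block_mat A2 B2 C2 D2;
       let Z3 = four_block_mat A3 B3 C3 D3;
       Z12 \<leftarrow> mult_prog Z1 Z2;
       Z21 \<leftarrow> mult_prog Z2 Z1;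
       require_eq Z12 Z21;
       Z13 \<leftarrow> mult_prog Z1 Z3;
       Z31 \<leftarrow> mult_prog Z3 Z1;
       require_eq Z13 Z31;
       Z23 \<leftarrow> mult_prog Z2 Z3;
       Z32 \<leftarrow> mult_prog Z3 Z2;
       require_eq Z23 Z32;
       Return (Z1, Z2, Z3) })"

definition mat_entries :: "'a mat \<Rightarrow> 'a list" where
  "mat_entries A = concat (map list_of_vec (rows A))"

definition commext_input :: "'k::field mat \<Rightarrow> 'k mat \<Rightarrow> 'k mat \<Rightarrow> 'k list" where
  "commext_input A1 A2 A3 = [0, 1] @ mat_entries A1 @ mat_entries A2 @ mat_entries A3"

definition commext_run ::
  "nat \<Rightarrow> 'k::field mat \<Rightarrow> 'k mat \<Rightarrow> 'k mat \<Rightarrow> ('k mat \<times> 'k mat \<times> 'k mat) option" where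
  "commext_run n A1 A2 A3 =
     (case exec (commext_prog n) (commext_input A1 A2 A3) of
        None \<Rightarrow> None
      | Some ((Z1, Z2, Z3), mem) \<Rightarrow>
          Some (map_mat ((!) mem) Z1, map_mat ((!) mem) Z2, map_mat ((!) mem) Z3))"

end

theory Submission
  imports Defs "HOL-Library.Sublist"
begin

text \<open>
  Suppose that a commuting extension with blocks \<open>Bi\<close>, \<open>Ci\<close>, \<open>Di\<close> exists. The upper left block of
  \<open>Zi * Zj = Zj * Zi\<close> reads \<open>[Ai, Aj] = Bj * Ci - Bi * Cj\<close>, so the image of \<open>[Ai, Aj]\<close> lies in
  \<open>Im Bi + Im Bj\<close>. The dimension hypotheses force equality, make the sum \<open>Im B1 + Im B2 + Im B3\<close>
  direct, the \<open>Bi\<close> injective and the \<open>Ci\<close> surjective. Hence the intersections computed by the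
  algorithm are exactly the spaces \<open>Im Bi\<close>. Conjugating the extension with a block diagonal matrix
  \<open>diag(1, G)\<close> turns \<open>B1\<close> into the basis chosen by the algorithm, and then in every step the blocks
  of the extension are the only solution. Conversely, whatever the algorithm outputs is a commuting
  extension, and its size is \<open>r\<close> because the first intersection has dimension
  \<open>2 (r - n) + 2 (r - n) - 3 (r - n) = r - n\<close>.

  That the register program computes a result of the algorithm needs no dimension hypothesis: each
  linear algebra routine succeeds iff the corresponding system has exactly one solution.
\<close>

section \<open>Refinement of partial functions by programs\<close>

text \<open>Rejection on non-uniqueness is part of the specification, so one-sided correctness of
  the routines would not suffice: \<open>implements\<close> relates a run to a result of type
  \<open>option\<close>, and every routine is shown to reject exactly when the abstract side is
  \<open>None\<close>. Registers are written once and memory only grows; facts about registers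
  therefore persist, and program proofs reduce to chaining rules.

  Injectivity comes from one counting argument: if the image of a matrix with \<open>m\<close>
  columns contains an \<open>m\<close>-dimensional image, its columns are independent and both
  images agree. It is applied to \<open>(Bj | Bi)\<close> with \<open>2 (r - n)\<close> columns and
  to \<open>(B1 | B2 | B3)\<close> with \<open>3 (r - n)\<close> columns. Surjectivity of the
  \<open>Ci\<close> enters as right cancellation, obtained from the same equations.

  The cost is estimated apart from correctness. \<open>max_ops\<close> ranges over all paths of the
  decision tree, including those that no input over a field can follow, so the estimate rests only
  on the shapes of register matrices; its unit is the price of one linear solve.\<close>

abbreviation sub_multiple_prog :: "reg \<Rightarrow> reg list \<Rightarrow> reg list \<Rightarrow> reg list prog" where
  "sub_multiple_prog c w v \<equiv> map_prog (\<lambda>(x, y). prog_bind (arith Times c y) (arith Minus x)) (zip w v)"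

abbreviation reduce_prog :: "reg \<Rightarrow> reg list \<Rightarrow> reg list \<times> reg \<Rightarrow> reg list prog" where
  "reduce_prog s v \<equiv> \<lambda>(w, t). prog_bind (arith Divide t s) (\<lambda>c. sub_multiple_prog c w v)"

abbreviation require_entry_prog :: "reg mat \<Rightarrow> reg mat \<Rightarrow> nat \<Rightarrow> nat \<Rightarrow> unit prog" where
  "require_entry_prog A B i j \<equiv>
     prog_bind (test_eq (A $$ (i, j)) (B $$ (i, j))) (\<lambda>b. if b then Return () else Reject)"

abbreviation normalize_prog :: "reg list \<Rightarrow> reg list prog" where
  "normalize_prog v \<equiv> map_prog (\<lambda>y. prog_bind (arith Divide y (last v)) (arith Minus zero_reg)) (butlast v)"

abbreviation normalize_test_prog :: "reg list \<Rightarrow> reg list prog" where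
  "normalize_test_prog v \<equiv>
     prog_bind (test_eq (last v) zero_reg) (\<lambda>z. if z then Reject else normalize_prog v)"

abbreviation unique_kernel_prog :: "reg list list \<Rightarrow> reg list prog" where
  "unique_kernel_prog vs \<equiv> (case vs of [v] \<Rightarrow> normalize_test_prog v | _ \<Rightarrow> Reject)"

text \<open>Total refinement of a partial function: a failing run is tied to \<open>None\<close> and
  a returning one to \<open>Some\<close>, so rejection is specified as strictly as success. The
  condition \<open>prefix mem mem'\<close> records that earlier registers keep their
  contents.\<close>

definition implements ::
  "('k::field list \<Rightarrow> 'a \<Rightarrow> 'b \<Rightarrow> bool) \<Rightarrow> 'a prog \<Rightarrow> 'k list \<Rightarrow> 'b option \<Rightarrow> bool" where
  "implements R p mem r \<longleftrightarrow>
     (case exec p mem of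
        None \<Rightarrow> r = None
      | Some (x, mem') \<Rightarrow> prefix mem mem' \<and> (\<exists>y. r = Some y \<and> R mem' x y))"

definition persistent :: "('k list \<Rightarrow> 'a \<Rightarrow> 'b \<Rightarrow> bool) \<Rightarrow> bool" where
  "persistent R \<longleftrightarrow> (\<forall>mem mem' x y. prefix mem mem' \<longrightarrow> R mem x y \<longrightarrow> R mem' x y)"

lemma persistentD: "persistent R \<Longrightarrow> R mem x y \<Longrightarrow> prefix mem mem' \<Longrightarrow> R mem' x y"
  by (auto simp: persistent_def)

lemma exec_bind:
  "exec (prog_bind p f) mem =
     (case exec p mem of None \<Rightarrow> None | Some (x, mem') \<Rightarrow> exec (f x) mem')"
  by (induction p arbitrary: mem) simp_all

lemma implements_Return: "R mem x y \<Longrightarrow> implements R (Return x) mem (Some y)"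
  by (simp add: implements_def)

lemma implements_Reject: "implements R Reject mem None"
  by (simp add: implements_def)

lemma implements_bind:
  assumes "implements R p mem r"
    and "\<And>x y mem'. prefix mem mem' \<Longrightarrow> R mem' x y \<Longrightarrow> implements S (f x) mem' (g y)"
  shows "implements S (prog_bind p f) mem (Option.bind r g)"
proof (cases "exec p mem")
  case None
  with assms(1) show ?thesis by (simp add: implements_def exec_bind)
next
  case (Some q)
  obtain x mem1 where q: "q = (x, mem1)" by force
  with Some assms(1) obtain y where y: "prefix mem mem1" "r = Some y" "R mem1 x y"
    by (auto simp: implements_def)
  from assms(2)[OF y(1,3)] show ?thesis
    using Some q y by (auto simp: implements_def exec_bind split: option.splits)
qed

text \<open>For a program step that cannot fail, the specification has no corresponding bind. The
  known value \<open>y\<close> is fixed inside the relation, so the continuation is compared with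
  \<open>r\<close> directly.\<close>

lemma implements_bind_Some:
  assumes "implements R p mem (Some y)"
    and "\<And>x mem'. prefix mem mem' \<Longrightarrow> R mem' x y \<Longrightarrow> implements S (f x) mem' r"
  shows "implements S (prog_bind p f) mem r"
proof -
  have "implements (\<lambda>m x y'. R m x y' \<and> y' = y) p mem (Some y)"
    using assms(1) by (auto simp: implements_def split: option.splits)
  from implements_bind[OF this, of S f "\<lambda>_. r"] assms(2) show ?thesis by auto
qed

text \<open>The bound \<open>i < length mem\<close> is what lets the value survive appended
  registers; reading beyond the end of a list is unspecified.\<close>

definition val :: "'k list \<Rightarrow> reg \<Rightarrow> 'k \<Rightarrow> bool" where
  "val mem i x \<longleftrightarrow> i < length mem \<and> mem ! i = x"

definition vval :: "'k list \<Rightarrow> reg list \<Rightarrow> 'k vec \<Rightarrow> bool" where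
  "vval mem l v \<longleftrightarrow> list_all2 (val mem) l (list_of_vec v)"

definition mval :: "'k list \<Rightarrow> reg mat \<Rightarrow> 'k mat \<Rightarrow> bool" where
  "mval mem M A \<longleftrightarrow> dim_row M = dim_row A \<and> dim_col M = dim_col A \<and>
     (\<forall>i<dim_row A. \<forall>j<dim_col A. val mem (M $$ (i, j)) (A $$ (i, j)))"

definition consts_loaded :: "'k::field list \<Rightarrow> bool" where
  "consts_loaded mem \<longleftrightarrow> val mem zero_reg 0 \<and> val mem one_reg 1"

lemma persistent_val: "persistent val"
  by (auto simp: persistent_def val_def prefix_def nth_append)

lemma persistent_list_all2: "persistent R \<Longrightarrow> persistent (\<lambda>mem. list_all2 (R mem))"
  by (auto simp: persistent_def elim!: list_all2_mono)

lemma persistent_vval: "persistent vval"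
  using persistent_list_all2[OF persistent_val] by (auto simp: persistent_def vval_def)

lemma persistent_mval: "persistent mval"
  using persistent_val by (simp add: persistent_def mval_def) blast

lemma persistent_const: "persistent (\<lambda>_. Q)"
  by (simp add: persistent_def)

lemmas mval_prefix = persistentD[OF persistent_mval]
lemmas val_prefix = persistentD[OF persistent_val]
lemmas vval_prefix = persistentD[OF persistent_vval]

lemma consts_loaded_prefix:
  "consts_loaded mem \<Longrightarrow> prefix mem mem' \<Longrightarrow> consts_loaded mem'"
  using val_prefix by (auto simp: consts_loaded_def)

lemma implements_arith:
  "val mem i x \<Longrightarrow> val mem j y \<Longrightarrow> implements val (arith f i j) mem (Some (arith_op f x y))"
  by (auto simp: implements_def arith_def val_def nth_append)

lemma implements_test_eq:
  "val mem i x \<Longrightarrow> val mem j y \<Longrightarrow> implements (\<lambda>_. (=)) (test_eq i j) mem (Some (x = y))"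
  by (auto simp: implements_def test_eq_def val_def)

primrec map_opt :: "('a \<Rightarrow> 'b option) \<Rightarrow> 'a list \<Rightarrow> 'b list option" where
  "map_opt g [] = Some []"
| "map_opt g (x # xs) =
     Option.bind (g x) (\<lambda>y. Option.bind (map_opt g xs) (\<lambda>ys. Some (y # ys)))"

lemma map_opt_Some: "map_opt (\<lambda>x. Some (g x)) xs = Some (map g xs)"
  by (induction xs) simp_all

lemma map_opt_eq:
  "map_opt g xs =
     (if \<forall>x\<in>set xs. g x \<noteq> None then Some (map (\<lambda>x. the (g x)) xs) else None)"
  by (induction xs) (auto split: option.splits bind_split)

text \<open>Both relations have to be persistent: inputs late in the list are read only after memory
  has grown, and outputs produced early must still be valid at the end.\<close>

lemma implements_map_prog:
  assumes "list_all2 (Q mem) xs ys" and "persistent Q" and "persistent R"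
    and "\<And>x y mem'. prefix mem mem' \<Longrightarrow> Q mem' x y \<Longrightarrow> implements R (f x) mem' (g y)"
  shows "implements (\<lambda>m. list_all2 (R m)) (map_prog f xs) mem (map_opt g ys)"
  using assms(1,4)
proof (induction xs arbitrary: ys mem)
  case Nil
  then show ?case by (auto intro: implements_Return)
next
  case (Cons x xs)
  from Cons.prems(1) obtain y zs where ys: "ys = y # zs" "Q mem x y" "list_all2 (Q mem) xs zs"
    by (auto simp: list_all2_Cons1)
  show ?case unfolding ys map_prog.simps map_opt.simps
  proof (rule implements_bind[OF Cons.prems(2)[OF _ ys(2)]])
    fix a b m1 assume m1: "prefix mem m1" "R m1 a b"
    have "list_all2 (Q m1) xs zs"
      using persistentD[OF persistent_list_all2[OF assms(2)] ys(3) m1(1)] .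
    then show "implements (\<lambda>m. list_all2 (R m)) (prog_bind (map_prog f xs) (\<lambda>ys. Return (a # ys))) m1
        (Option.bind (map_opt g zs) (\<lambda>ys. Some (b # ys)))"
    proof (rule implements_bind[OF Cons.IH])
      fix x' y' m2 assume "prefix m1 m2" "Q m2 x' y'"
      then show "implements R (f x') m2 (g y')" using Cons.prems(2) m1 by (metis prefix_order.trans)
    next
      fix as bs m2 assume "prefix m1 m2" "list_all2 (R m2) as bs"
      then show "implements (\<lambda>m. list_all2 (R m)) (Return (a # as)) m2 (Some (b # bs))"
        using persistentD[OF assms(3) m1(2)] by (auto intro: implements_Return)
    qed
  qed simp
qed

lemma implements_map_prog_total:
  assumes "list_all2 (Q mem) xs ys" and "persistent Q" and "persistent R"
    and "\<And>x y mem'. prefix mem mem' \<Longrightarrow> Q mem' x y \<Longrightarrow> implements R (f x) mem' (Some (g y))"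
  shows "implements (\<lambda>m. list_all2 (R m)) (map_prog f xs) mem (Some (map g ys))"
  using implements_map_prog[OF assms] by (simp add: map_opt_Some)

lemma implements_map_prog_upt:
  assumes "persistent R"
    and "\<And>i mem'. i < n \<Longrightarrow> prefix mem mem' \<Longrightarrow> implements R (f i) mem' (g i)"
  shows "implements (\<lambda>m. list_all2 (R m)) (map_prog f [0..<n]) mem (map_opt g [0..<n])"
  by (rule implements_map_prog[of "\<lambda>_ i j. i = j \<and> j < n"])
    (use assms in \<open>auto simp: list_all2_conv_all_nth persistent_const\<close>)

lemma implements_build_mat:
  assumes "\<And>i j mem'. i < nr \<Longrightarrow> j < nc \<Longrightarrow> prefix mem mem' \<Longrightarrow>
    implements val (f i j) mem' (Some (g i j))"
  shows "implements mval (build_mat nr nc f) mem (Some (mat nr nc (\<lambda>(i, j). g i j)))"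
  unfolding build_mat_def
proof (rule implements_bind_Some)
  have row: "implements (\<lambda>m. list_all2 (val m)) (map_prog (\<lambda>j. f i j) [0..<nc]) mem'
      (Some (map (g i) [0..<nc]))" if "i < nr" "prefix mem mem'" for i mem'
    using implements_map_prog_upt[OF persistent_val, of nc mem' "f i" "\<lambda>j. Some (g i j)"] assms that
    by (metis map_opt_Some prefix_order.trans)
  show "implements (\<lambda>m. list_all2 (list_all2 (val m))) (map_prog (\<lambda>i. map_prog (\<lambda>j. f i j) [0..<nc]) [0..<nr])
     mem (Some (map (\<lambda>i. map (g i) [0..<nc]) [0..<nr]))"
    using implements_map_prog_upt[OF persistent_list_all2[OF persistent_val], of nr mem _
        "\<lambda>i. Some (map (g i) [0..<nc])"] row
    by (simp add: map_opt_Some)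
next
  fix rs mem'
  assume rs: "list_all2 (list_all2 (val mem')) rs (map (\<lambda>i. map (g i) [0..<nc]) [0..<nr])"
  then have "length rs = nr" by (auto dest: list_all2_lengthD)
  moreover have "list_all2 (val mem') (rs ! i) (map (g i) [0..<nc])" if "i < nr" for i
    using list_all2_nthD2[OF rs, of i] that by simp
  then have "val mem' (rs ! i ! j) (g i j)" if "i < nr" "j < nc" for i j
    using list_all2_nthD2[of "val mem'" "rs ! i" "map (g i) [0..<nc]" j] that by simp
  ultimately show "implements mval (Return (mat_of_rows_list nc rs)) mem'
      (Some (mat nr nc (\<lambda>(i, j). g i j)))"
    by (intro implements_Return) (auto simp: mval_def mat_of_rows_list_def)
qed

lemma implements_dot_prog:
  assumes "consts_loaded mem" and "list_all2 (val mem) xs us" and "list_all2 (val mem) ys ws"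
  shows "implements val (dot_prog xs ys) mem (Some (\<Sum>(x, y)\<leftarrow>zip us ws. x * y))"
  using assms
proof (induction xs ys arbitrary: us ws mem rule: dot_prog.induct)
  case (1 x xs y ys)
  obtain u us' w ws' where us: "us = u # us'" "ws = w # ws'" "val mem x u" "val mem y w"
    "list_all2 (val mem) xs us'" "list_all2 (val mem) ys ws'"
    using "1.prems" by (auto simp: list_all2_Cons1)
  show ?case unfolding dot_prog.simps
  proof (rule implements_bind_Some[OF implements_arith[OF us(3,4)]])
    fix p m1 assume m1: "prefix mem m1" "val m1 p (arith_op Times u w)"
    note lift = persistentD[OF persistent_list_all2[OF persistent_val] _ m1(1)]
    show "implements val (prog_bind (dot_prog xs ys) (arith Plus p)) m1
        (Some (\<Sum>(x, y)\<leftarrow>zip us ws. x * y))"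
    proof (rule implements_bind_Some[OF "1.IH"])
      show "consts_loaded m1" using consts_loaded_prefix "1.prems"(1) m1(1) .
      show "list_all2 (val m1) xs us'" "list_all2 (val m1) ys ws'" using lift us by auto
      fix s m2 assume m2: "prefix m1 m2" "val m2 s (\<Sum>(x, y)\<leftarrow>zip us' ws'. x * y)"
      show "implements val (arith Plus p s) m2 (Some (\<Sum>(x, y)\<leftarrow>zip us ws. x * y))"
        using implements_arith[OF val_prefix[OF m1(2) m2(1)] m2(2), of Plus] us by simp
    qed
  qed
qed (auto simp: consts_loaded_def intro!: implements_Return)

lemma implements_scalar_prod:
  assumes "consts_loaded mem" and "vval mem xs u" and "vval mem ys w" and "dim_vec u = dim_vec w"
  shows "implements val (dot_prog xs ys) mem (Some (u \<bullet> w))"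
proof -
  have "(\<Sum>(x, y)\<leftarrow>zip (list_of_vec u) (list_of_vec w). x * y) = u \<bullet> w"
    using assms(4) by (auto simp: scalar_prod_def sum_list_sum_nth list_of_vec_index)
  then show ?thesis
    using implements_dot_prog[OF assms(1), of xs "list_of_vec u" ys "list_of_vec w"] assms(2,3)
    by (simp add: vval_def)
qed

section \<open>Matrix arithmetic on registers\<close>

lemma mval_entry:
  "mval mem M A \<Longrightarrow> i < dim_row A \<Longrightarrow> j < dim_col A \<Longrightarrow> val mem (M $$ (i, j)) (A $$ (i, j))"
  by (auto simp: mval_def)

lemma vval_row: "mval mem M A \<Longrightarrow> i < dim_row A \<Longrightarrow> vval mem (list_of_vec (row M i)) (row A i)"
  by (auto simp: mval_def vval_def list_all2_conv_all_nth list_of_vec_index)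

lemma vval_col: "mval mem M A \<Longrightarrow> j < dim_col A \<Longrightarrow> vval mem (list_of_vec (col M j)) (col A j)"
  by (auto simp: mval_def vval_def list_all2_conv_all_nth list_of_vec_index)

lemma mval_transpose: "mval mem M A \<Longrightarrow> mval mem (transpose_mat M) (transpose_mat A)"
  by (auto simp: mval_def)

lemma mval_hcat:
  "mval mem M A \<Longrightarrow> mval mem N B \<Longrightarrow> dim_row A = dim_row B \<Longrightarrow> mval mem (hcat M N) (hcat A B)"
  by (auto simp: mval_def hcat_def)

lemma mval_upper_rows: "mval mem M A \<Longrightarrow> k \<le> dim_row A \<Longrightarrow> mval mem (upper_rows k M) (upper_rows k A)"
  by (auto simp: mval_def upper_rows_def)

lemma mval_lower_rows: "mval mem M A \<Longrightarrow> mval mem (lower_rows k M) (lower_rows k A)"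
  by (auto simp: mval_def lower_rows_def)

lemma mval_four_block:
  assumes "mval mem M1 A1" "mval mem M2 A2" "mval mem M3 A3" "mval mem M4 A4"
    and "A1 \<in> carrier_mat n m" "A2 \<in> carrier_mat n k" "A3 \<in> carrier_mat l m" "A4 \<in> carrier_mat l k"
  shows "mval mem (four_block_mat M1 M2 M3 M4) (four_block_mat A1 A2 A3 A4)"
  using assms by (auto simp: mval_def)

lemma implements_mult:
  assumes "consts_loaded mem" and "mval mem M A" and "mval mem N B"
    and "A \<in> carrier_mat n k" and "B \<in> carrier_mat k l"
  shows "implements mval (mult_prog M N) mem (Some (A * B))"
proof -
  have AB: "A * B = mat (dim_row A) (dim_col B) (\<lambda>(i, j). row A i \<bullet> col B j)"
    by (rule eq_matI) auto
  have dims: "dim_row M = dim_row A" "dim_col N = dim_col B" using assms by (auto simp: mval_def)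
  show ?thesis unfolding mult_prog_def AB dims
    by (rule implements_build_mat, rule implements_scalar_prod)
      (use assms in \<open>auto intro: consts_loaded_prefix vval_prefix vval_row vval_col\<close>)
qed

text \<open>The operands are arbitrary register functions because negation is computed as
  \<open>0 - x\<close>, with the constant register as left operand.\<close>

lemma implements_entrywise:
  assumes "mval mem M A" and "A \<in> carrier_mat n m"
    and "\<And>i j mem'. i < n \<Longrightarrow> j < m \<Longrightarrow> prefix mem mem' \<Longrightarrow>
      val mem' (p i j) (X i j) \<and> val mem' (q i j) (Y i j)"
    and "E = mat n m (\<lambda>(i, j). arith_op f (X i j) (Y i j))"
  shows "implements mval (build_mat (dim_row M) (dim_col M) (\<lambda>i j. arith f (p i j) (q i j))) mem (Some E)"
proof -
  have dims: "dim_row M = n" "dim_col M = m" using assms(1,2) by (auto simp: mval_def)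
  show ?thesis unfolding dims assms(4)
    by (rule implements_build_mat, rule implements_arith) (use assms(3) in auto)
qed

lemma implements_add_sub:
  assumes "mval mem M A" and "mval mem N B" and "A \<in> carrier_mat n m" and "B \<in> carrier_mat n m"
  shows implements_add: "implements mval (add_prog M N) mem (Some (A + B))"
    and implements_sub: "implements mval (sub_prog M N) mem (Some (A - B))"
proof -
  have "val mem' (M $$ (i, j)) (A $$ (i, j)) \<and> val mem' (N $$ (i, j)) (B $$ (i, j))"
    if "i < n" "j < m" "prefix mem mem'" for i j mem'
    using assms that by (auto intro: mval_entry mval_prefix)
  then show "implements mval (add_prog M N) mem (Some (A + B))"
    "implements mval (sub_prog M N) mem (Some (A - B))"
    unfolding add_prog_def sub_prog_def
    by (rule implements_entrywise[OF assms(1,3)]; use assms(3,4) in \<open>auto intro!: eq_matI\<close>)+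
qed

lemma implements_neg:
  assumes "consts_loaded mem" and "mval mem M A"
  shows "implements mval (neg_prog M) mem (Some (- A))"
  unfolding neg_prog_def
proof (rule implements_entrywise[OF assms(2) carrier_matI[OF refl refl]])
  fix i j mem' assume "i < dim_row A" "j < dim_col A" "prefix mem mem'"
  then show "val mem' zero_reg 0 \<and> val mem' (M $$ (i, j)) (A $$ (i, j))"
    using assms consts_loaded_prefix
    by (auto simp: consts_loaded_def intro: mval_entry mval_prefix val_prefix)
qed (auto intro!: eq_matI)

lemma implements_commutator:
  assumes "consts_loaded mem" and "mval mem M A" and "mval mem N B"
    and "A \<in> carrier_mat n n" and "B \<in> carrier_mat n n"
  shows "implements mval (commutator_prog M N) mem (Some (commutator A B))"
  unfolding commutator_prog_def commutator_def
  using assms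
  \<comment> \<open>Rotation puts the \<open>prefix\<close> premise first, so that
    \<open>assumption\<close> selects an earlier memory, and the fact about the register is then
    looked up there.\<close>
  by - (rule implements_bind_Some implements_mult implements_sub mult_carrier_mat
      | assumption | (rule mval_prefix[rotated] consts_loaded_prefix[rotated], assumption))+

lemma implements_require_eq:
  assumes "mval mem M A" and "mval mem N B" and "A \<in> carrier_mat n m" and "B \<in> carrier_mat n m"
  shows "implements (\<lambda>_ _ _. True) (require_eq M N) mem (if A = B then Some () else None)"
proof -
  let ?t = "\<lambda>i j. if A $$ (i, j) = B $$ (i, j) then Some () else None"
  have entry: "implements (\<lambda>_ _ _. True) (require_entry_prog M N i j) mem' (?t i j)"
    if "i < n" "j < m" "prefix mem mem'" for i j mem'
  proof (rule implements_bind_Some[OF implements_test_eq])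
    show "val mem' (M $$ (i, j)) (A $$ (i, j))" "val mem' (N $$ (i, j)) (B $$ (i, j))"
      using assms that by (auto intro: mval_entry mval_prefix)
  qed (auto intro: implements_Return implements_Reject)
  have st: "persistent (\<lambda>(_:: 'a list) (_:: 'x) (_:: 'y). True)" by (simp add: persistent_def)
  have row: "implements (\<lambda>m. list_all2 (\<lambda>_ _. True)) (map_prog (require_entry_prog M N i) [0..<m]) mem' (map_opt (?t i) [0..<m])"
    if "i < n" "prefix mem mem'" for i mem'
    by (rule implements_map_prog_upt[OF st], rule entry) (use that in \<open>auto intro: prefix_order.trans\<close>)
  have dims: "dim_row M = n" "dim_col M = m" using assms by (auto simp: mval_def)
  have "implements (\<lambda>_ _ _. True) (require_eq M N) mem
    (Option.bind (map_opt (\<lambda>i. map_opt (?t i) [0..<m]) [0..<n]) (\<lambda>_. Some ()))"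
    unfolding require_eq_def dims
    by (rule implements_bind[OF implements_map_prog_upt[OF persistent_list_all2[OF st]]])
      (auto intro!: implements_Return row)
  moreover have "A = B \<longleftrightarrow> (\<forall>i<n. \<forall>j<m. A $$ (i, j) = B $$ (i, j))"
    using assms(3,4) by auto
  ultimately show ?thesis by (auto simp: map_opt_eq split: if_splits)
qed

section \<open>Spans and independence of lists of vectors\<close>

text \<open>Span and independence are defined by recursion on lists to match the elimination, which
  recurses on lists and keeps repetitions visible. \<open>lspan_eq_span\<close> and
  \<open>indep_imp_lin_indpt\<close> connect them with the set-based notions.\<close>

primrec lspan :: "nat \<Rightarrow> 'a::field vec list \<Rightarrow> 'a vec set" where
  "lspan m [] = {0\<^sub>v m}"
| "lspan m (v # vs) = {c \<cdot>\<^sub>v v + y | c y. y \<in> lspan m vs}"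

primrec indep :: "nat \<Rightarrow> 'a::field vec list \<Rightarrow> bool" where
  "indep m [] \<longleftrightarrow> True"
| "indep m (v # vs) \<longleftrightarrow> v \<notin> lspan m vs \<and> indep m vs"

lemma lspan_carrier: "set vs \<subseteq> carrier_vec m \<Longrightarrow> x \<in> lspan m vs \<Longrightarrow> x \<in> carrier_vec m"
  by (induction vs arbitrary: x) auto

lemma lspan_zero: "set vs \<subseteq> carrier_vec m \<Longrightarrow> 0\<^sub>v m \<in> lspan m vs"
  by (induction vs) (auto intro!: exI[of _ 0] exI[of _ "0\<^sub>v m"])

lemma lspan_smult: "set vs \<subseteq> carrier_vec m \<Longrightarrow> x \<in> lspan m vs \<Longrightarrow> c \<cdot>\<^sub>v x \<in> lspan m vs"
proof (induction vs arbitrary: x)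
  case (Cons v vs)
  then obtain d y where x: "x = d \<cdot>\<^sub>v v + y" "y \<in> lspan m vs" by auto
  have "c \<cdot>\<^sub>v x = (c * d) \<cdot>\<^sub>v v + c \<cdot>\<^sub>v y"
    using Cons.prems x lspan_carrier[of vs m y] by (auto simp: smult_add_distrib_vec[of _ m])
  then show ?case using Cons x by auto
qed auto

lemma lspan_add:
  "set vs \<subseteq> carrier_vec m \<Longrightarrow> x \<in> lspan m vs \<Longrightarrow> y \<in> lspan m vs \<Longrightarrow> x + y \<in> lspan m vs"
proof (induction vs arbitrary: x y)
  case (Cons v vs)
  then obtain c d x' y' where x: "x = c \<cdot>\<^sub>v v + x'" "x' \<in> lspan m vs"
    and y: "y = d \<cdot>\<^sub>v v + y'" "y' \<in> lspan m vs" by auto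
  have "v \<in> carrier_vec m" "x' \<in> carrier_vec m" "y' \<in> carrier_vec m"
    using Cons.prems x y lspan_carrier[of vs m] by auto
  then have "x + y = (c + d) \<cdot>\<^sub>v v + (x' + y')"
    using x y by (intro eq_vecI) (auto simp: algebra_simps)
  then show ?case using Cons x y by auto
qed auto

lemma lspan_Cons_mono: "set vs \<subseteq> carrier_vec m \<Longrightarrow> v \<in> carrier_vec m \<Longrightarrow> lspan m vs \<subseteq> lspan m (v # vs)"
proof
  fix x assume "set vs \<subseteq> carrier_vec m" "v \<in> carrier_vec m" "x \<in> lspan m vs"
  moreover from this have "x = 0 \<cdot>\<^sub>v v + x" using lspan_carrier[of vs m x] by (intro eq_vecI) auto
  ultimately show "x \<in> lspan m (v # vs)" unfolding lspan.simps by blast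
qed

lemma lspan_mem: "set vs \<subseteq> carrier_vec m \<Longrightarrow> v \<in> set vs \<Longrightarrow> v \<in> lspan m vs"
proof (induction vs)
  case (Cons w vs)
  show ?case
  proof (cases "v = w")
    case True
    then show ?thesis using Cons.prems lspan_zero[of vs m]
      by (auto intro!: exI[of _ 1] exI[of _ "0\<^sub>v m"])
  next
    case False
    then show ?thesis using Cons lspan_Cons_mono[of vs m w] by auto
  qed
qed auto

lemma lspan_append:
  assumes "set us \<subseteq> carrier_vec m" "set vs \<subseteq> carrier_vec m"
  shows "lspan m (us @ vs) = {x + y | x y. x \<in> lspan m us \<and> y \<in> lspan m vs}"
  using assms
proof (induction us)
  case Nil
  then show ?case using lspan_carrier[of vs m] by auto (metis left_zero_vec)
next
  case (Cons u us)
  have assoc: "c \<cdot>\<^sub>v u + (x + y) = c \<cdot>\<^sub>v u + x + y" if "x \<in> lspan m us" "y \<in> lspan m vs" for c x y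
    using that Cons.prems lspan_carrier[of us m] lspan_carrier[of vs m]
    by (auto intro!: assoc_add_vec[symmetric, of _ m])
  show ?case
  proof (intro equalityI subsetI)
    fix z assume "z \<in> lspan m ((u # us) @ vs)"
    then obtain c x y where "z = c \<cdot>\<^sub>v u + (x + y)" "x \<in> lspan m us" "y \<in> lspan m vs"
      using Cons by auto
    then show "z \<in> {x + y | x y. x \<in> lspan m (u # us) \<and> y \<in> lspan m vs}"
      using assoc by fastforce
  next
    fix z assume "z \<in> {x + y | x y. x \<in> lspan m (u # us) \<and> y \<in> lspan m vs}"
    then obtain c x y where "z = c \<cdot>\<^sub>v u + x + y" "x \<in> lspan m us" "y \<in> lspan m vs" by auto
    then have "z = c \<cdot>\<^sub>v u + (x + y)" "x + y \<in> lspan m (us @ vs)" using assoc Cons by auto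
    then show "z \<in> lspan m ((u # us) @ vs)" unfolding append_Cons lspan.simps by blast
  qed
qed

lemma lspan_Cons_absorb:
  assumes "set vs \<subseteq> carrier_vec m" "v \<in> lspan m vs"
  shows "lspan m (v # vs) = lspan m vs"
proof
  show "lspan m (v # vs) \<subseteq> lspan m vs"
    using assms by (auto intro!: lspan_add lspan_smult)
  show "lspan m vs \<subseteq> lspan m (v # vs)"
    using assms lspan_Cons_mono lspan_carrier by blast
qed

text \<open>Greedy extension: a vector of \<open>ws\<close> is prepended unless it already lies in
  the span reached so far. The given list \<open>ks\<close> stays at the tail because
  \<open>indep\<close> tests each vector against its successors.\<close>

lemma extend_indep:
  assumes "indep m ks" "set ws \<subseteq> carrier_vec m" "set ks \<subseteq> carrier_vec m"
  shows "\<exists>us. set us \<subseteq> carrier_vec m \<and> indep m (us @ ks) \<and> lspan m (us @ ks) = lspan m (ws @ ks)"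
  using assms(2)
proof (induction ws)
  case Nil
  then show ?case using assms by (intro exI[of _ "[]"]) auto
next
  case (Cons w ws)
  then obtain us where us: "set us \<subseteq> carrier_vec m" "indep m (us @ ks)"
    "lspan m (us @ ks) = lspan m (ws @ ks)" by auto
  show ?case
  proof (cases "w \<in> lspan m (us @ ks)")
    case True
    then show ?thesis using us assms(3) Cons.prems lspan_Cons_absorb[of "ws @ ks" m w]
      by (intro exI[of _ us]) auto
  next
    case False
    then show ?thesis using us Cons.prems by (intro exI[of _ "w # us"]) auto
  qed
qed

text \<open>If u = x + y with x in the span of \<open>us\<close> and y in that of
  \<open>vs @ ks\<close>, then y = u - x lies in both spans, hence in that of \<open>ks\<close>; so
  u would already lie in the span of \<open>us @ ks\<close>. This is the independence half of the
  dimension formula for sums.\<close>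

lemma indep_join:
  assumes "set us \<subseteq> carrier_vec m" "set vs \<subseteq> carrier_vec m" "set ks \<subseteq> carrier_vec m"
    and "indep m (us @ ks)" "indep m (vs @ ks)"
    and int: "lspan m (us @ ks) \<inter> lspan m (vs @ ks) \<subseteq> lspan m ks"
  shows "indep m (us @ vs @ ks)"
  using assms(1,4,6)
proof (induction us)
  case Nil
  then show ?case using assms by simp
next
  case (Cons u us)
  have c: "set us \<subseteq> carrier_vec m" "set (us @ ks) \<subseteq> carrier_vec m" "u \<in> carrier_vec m"
    using Cons.prems assms by auto
  have "lspan m (us @ ks) \<subseteq> lspan m ((u # us) @ ks)"
    using lspan_Cons_mono[OF c(2,3)] by simp
  then have "indep m (us @ vs @ ks)" using Cons by auto
  moreover have "u \<notin> lspan m (us @ vs @ ks)"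
  proof
    assume "u \<in> lspan m (us @ vs @ ks)"
    then obtain x y where xy: "u = x + y" "x \<in> lspan m us" "y \<in> lspan m (vs @ ks)"
      using lspan_append[of us m "vs @ ks"] c assms by auto
    have xyc: "x \<in> carrier_vec m" "y \<in> carrier_vec m"
      using xy c assms lspan_carrier[of us m] lspan_carrier[of "vs @ ks" m] by auto
    have xs: "x \<in> lspan m (us @ ks)"
      using lspan_append[of us m ks] c assms xy xyc lspan_zero[of ks m]
      by simp (metis right_zero_vec)
    have y: "y = 1 \<cdot>\<^sub>v u + (-1) \<cdot>\<^sub>v x" using xy(1) xyc by (intro eq_vecI) auto
    then have "y \<in> lspan m ((u # us) @ ks)"
      using lspan_smult[OF c(2) xs, of "-1"] unfolding append_Cons lspan.simps by blast
    with Cons.prems(3) xy have "y \<in> lspan m ks" by auto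
    then have "u \<in> lspan m (us @ ks)"
      using xy lspan_append[of us m ks] c assms by auto
    then show False using Cons.prems by simp
  qed
  ultimately show ?case by simp
qed

text \<open>Double annihilator in finite dimension. Either \<open>w\<close> imposes no new condition
  on the vectors annihilated by \<open>ws\<close>, or some \<open>y0\<close> among them has
  \<open>w \<bullet> y0 \<noteq> 0\<close>; then \<open>c\<close> is chosen such that b - c w kills
  \<open>y0\<close>, and with it every vector annihilated by \<open>ws\<close>.\<close>

lemma mem_lspan_if_annihilated:
  assumes "set ws \<subseteq> carrier_vec m" "b \<in> carrier_vec m"
    and "\<And>y. y \<in> carrier_vec m \<Longrightarrow> (\<forall>w\<in>set ws. w \<bullet> y = 0) \<Longrightarrow> b \<bullet> y = 0"
  shows "b \<in> lspan m ws"
  using assms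
proof (induction ws arbitrary: b)
  case Nil
  have "b $ i = 0" if "i < m" for i
    using Nil(3)[of "unit_vec m i"] Nil(2) that by simp
  then show ?case using Nil(2) by auto
next
  case (Cons w ws)
  let ?Y = "{y \<in> carrier_vec m. \<forall>w\<in>set ws. w \<bullet> y = 0}"
  have w: "w \<in> carrier_vec m" "set ws \<subseteq> carrier_vec m" using Cons.prems by auto
  show ?case
  proof (cases "\<forall>y\<in>?Y. w \<bullet> y = 0")
    case True
    then have "b \<in> lspan m ws" using Cons.prems by (intro Cons.IH) auto
    then show ?thesis using lspan_Cons_mono[OF w(2,1)] by auto
  next
    case False
    then obtain y0 where y0: "y0 \<in> ?Y" "w \<bullet> y0 \<noteq> 0" by auto
    define c where "c = (b \<bullet> y0) / (w \<bullet> y0)"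
    have "b - c \<cdot>\<^sub>v w \<in> lspan m ws"
    proof (rule Cons.IH[OF w(2)])
      show "b - c \<cdot>\<^sub>v w \<in> carrier_vec m" using Cons.prems w by auto
      fix y assume y: "y \<in> carrier_vec m" "\<forall>w\<in>set ws. w \<bullet> y = 0"
      \<comment> \<open>Chosen so that y - d y0 is annihilated by \<open>w\<close> as well, which
        makes the hypothesis on \<open>b\<close> applicable to it.\<close>
      define d where "d = (w \<bullet> y) / (w \<bullet> y0)"
      have diff: "v \<bullet> (y - d \<cdot>\<^sub>v y0) = v \<bullet> y - d * (v \<bullet> y0)" if "v \<in> carrier_vec m" for v
        using that y y0 by (simp add: scalar_prod_minus_distrib[of _ m])
      have "b \<bullet> (y - d \<cdot>\<^sub>v y0) = 0"
      proof (rule Cons.prems(3))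
        show "\<forall>v\<in>set (w # ws). v \<bullet> (y - d \<cdot>\<^sub>v y0) = 0"
          using y y0 w diff by (auto simp: d_def subset_iff)
      qed (use y y0 in auto)
      then have "b \<bullet> y - d * (b \<bullet> y0) = 0" using diff Cons.prems(2) by simp
      then have "b \<bullet> y = c * (w \<bullet> y)" by (simp add: c_def d_def)
      then show "(b - c \<cdot>\<^sub>v w) \<bullet> y = 0"
        using y w Cons.prems(2) by (simp add: minus_scalar_prod_distrib[of _ m])
    qed
    moreover have "b = c \<cdot>\<^sub>v w + (b - c \<cdot>\<^sub>v w)"
      using Cons.prems(2) w by (intro eq_vecI) auto
    ultimately show ?thesis by auto
  qed
qed

section \<open>Kernels by successive elimination\<close>

fun elim :: "('a::field vec \<times> 'a) list \<Rightarrow> 'a vec list" where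
  "elim [] = []"
| "elim ((v, s) # ps) =
     (if s = 0 then v # elim ps else map (\<lambda>(w, t). w - (t / s) \<cdot>\<^sub>v v) ps)"

text \<open>\<open>f\<close> is the projection along \<open>v\<close> onto the kernel of the form
  given by \<open>a\<close>. It is linear with kernel spanned by \<open>v\<close>, and independence
  of \<open>v # vs\<close> keeps that line away from the span of \<open>vs\<close>, so
  \<open>f\<close> is injective there.\<close>

lemma elim_pivot:
  assumes "set (v # vs) \<subseteq> carrier_vec m" "a \<in> carrier_vec m" "a \<bullet> v \<noteq> 0" "indep m (v # vs)"
  defines "f \<equiv> \<lambda>w. w - ((a \<bullet> w) / (a \<bullet> v)) \<cdot>\<^sub>v v"
  shows "lspan m (map f vs) = f ` lspan m vs \<and> indep m (map f vs)"
  using assms(1,4)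
proof (induction vs)
  case Nil
  have "f (0\<^sub>v m) = 0\<^sub>v m" using Nil assms(2) unfolding f_def by (intro eq_vecI) auto
  then show ?case by simp
next
  case (Cons w vs)
  have c: "v \<in> carrier_vec m" "w \<in> carrier_vec m" "set vs \<subseteq> carrier_vec m" using Cons.prems by auto
  have sub: "lspan m vs \<subseteq> lspan m (w # vs)" using lspan_Cons_mono[OF c(3,2)] .
  then have IH: "lspan m (map f vs) = f ` lspan m vs" "indep m (map f vs)"
    using Cons by auto
  have lin: "f (d \<cdot>\<^sub>v w + y) = d \<cdot>\<^sub>v f w + f y" if "y \<in> carrier_vec m" for d y
  proof -
    have "a \<bullet> (d \<cdot>\<^sub>v w + y) = d * (a \<bullet> w) + a \<bullet> y"
      using c that assms(2) by (simp add: scalar_prod_add_distrib[of _ m])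
    then show ?thesis using c that unfolding f_def
      by (intro eq_vecI) (auto simp: add_divide_distrib algebra_simps)
  qed
  have "lspan m (map f (w # vs)) = f ` lspan m (w # vs)"
    unfolding list.map lspan.simps IH
  proof (intro equalityI subsetI)
    fix x assume "x \<in> {d \<cdot>\<^sub>v f w + y |d y. y \<in> f ` lspan m vs}"
    then obtain d y where "x = d \<cdot>\<^sub>v f w + f y" "y \<in> lspan m vs" by auto
    then have "x = f (d \<cdot>\<^sub>v w + y)" "y \<in> lspan m vs"
      using lin[OF lspan_carrier[OF c(3)]] by simp_all
    then show "x \<in> f ` {d \<cdot>\<^sub>v w + y |d y. y \<in> lspan m vs}" by blast
  next
    fix x assume "x \<in> f ` {d \<cdot>\<^sub>v w + y |d y. y \<in> lspan m vs}"
    then obtain d y where "x = f (d \<cdot>\<^sub>v w + y)" "y \<in> lspan m vs" by blast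
    then have "x = d \<cdot>\<^sub>v f w + f y" "y \<in> lspan m vs"
      using lin[OF lspan_carrier[OF c(3)]] by simp_all
    then show "x \<in> {d \<cdot>\<^sub>v f w + y |d y. y \<in> f ` lspan m vs}" by blast
  qed
  moreover have "f w \<notin> lspan m (map f vs)"
  proof
    assume "f w \<in> lspan m (map f vs)"
    then obtain y where y: "f w = f y" "y \<in> lspan m vs" using IH by auto
    have yc: "y \<in> carrier_vec m" using lspan_carrier[OF c(3) y(2)] .
    \<comment> \<open>\<open>f w = f y\<close> means w = e v + y. For e = 0 the vector w would lie
      in the span of \<open>vs\<close>; otherwise v would lie in the span of
      \<open>w # vs\<close>.\<close>
    define e where "e = (a \<bullet> w) / (a \<bullet> v) - (a \<bullet> y) / (a \<bullet> v)"
    have ew: "w $ i = e * v $ i + y $ i" if "i < m" for i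
      using arg_cong[OF y(1), of "\<lambda>z. z $ i"] that c yc by (simp add: f_def e_def algebra_simps)
    show False
    proof (cases "e = 0")
      case True
      then have "w = y" using ew c yc by auto
      then show False using y Cons.prems by simp
    next
      case False
      then have "v = (1 / e) \<cdot>\<^sub>v w + (- (1 / e)) \<cdot>\<^sub>v y"
        using ew c yc by (intro eq_vecI) (auto simp: distrib_left)
      then have "v \<in> lspan m (w # vs)"
        using lspan_smult[OF c(3) y(2)] unfolding lspan.simps by blast
      then show False using Cons.prems by simp
    qed
  qed
  ultimately show ?case using IH by simp
qed

text \<open>If the form vanishes on \<open>v\<close>, the coefficient of \<open>v\<close> is free
  and \<open>v\<close> is kept. If \<open>v\<close> is a pivot, a vector d v + y in the kernel of
  the form has its d determined by y and therefore equals \<open>f y\<close>.\<close>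

lemma elim_spec:
  assumes "set vs \<subseteq> carrier_vec m" "a \<in> carrier_vec m" "indep m vs"
  defines "ws \<equiv> elim (map (\<lambda>v. (v, a \<bullet> v)) vs)"
  shows "set ws \<subseteq> carrier_vec m \<and> indep m ws \<and> lspan m ws = {x \<in> lspan m vs. a \<bullet> x = 0}"
  using assms(1,3) unfolding ws_def
proof (induction vs)
  case Nil
  then show ?case using assms(2) by auto
next
  case (Cons v vs)
  let ?ws = "elim (map (\<lambda>v. (v, a \<bullet> v)) vs)"
  have c: "v \<in> carrier_vec m" "set vs \<subseteq> carrier_vec m" using Cons.prems by auto
  have IH: "set ?ws \<subseteq> carrier_vec m" "indep m ?ws" "lspan m ?ws = {x \<in> lspan m vs. a \<bullet> x = 0}"
    using Cons by auto
  have lin: "a \<bullet> (d \<cdot>\<^sub>v v + y) = d * (a \<bullet> v) + a \<bullet> y" if "y \<in> lspan m vs" for d y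
    using c assms(2) lspan_carrier[OF c(2) that] by (simp add: scalar_prod_add_distrib[of _ m])
  show ?case
  proof (cases "a \<bullet> v = 0")
    case True
    then have "elim (map (\<lambda>v. (v, a \<bullet> v)) (v # vs)) = v # ?ws" by simp
    moreover have "lspan m (v # ?ws) = {x \<in> lspan m (v # vs). a \<bullet> x = 0}"
      unfolding lspan.simps IH(3) using True lin by force
    ultimately show ?thesis using IH c Cons.prems by simp
  next
    case False
    define f where "f = (\<lambda>w. w - ((a \<bullet> w) / (a \<bullet> v)) \<cdot>\<^sub>v v)"
    have e: "elim (map (\<lambda>v. (v, a \<bullet> v)) (v # vs)) = map f vs"
      using False by (simp add: f_def)
    have sp: "lspan m (map f vs) = f ` lspan m vs" "indep m (map f vs)"
      using elim_pivot[OF Cons.prems(1) assms(2) False Cons.prems(2)] by (auto simp: f_def)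
    have fy: "f y = (- ((a \<bullet> y) / (a \<bullet> v))) \<cdot>\<^sub>v v + y" if "y \<in> lspan m vs" for y
      unfolding f_def using c lspan_carrier[OF c(2) that] by (intro eq_vecI) auto
    have "f ` lspan m vs = {x \<in> lspan m (v # vs). a \<bullet> x = 0}"
    proof (intro equalityI subsetI)
      fix x assume "x \<in> f ` lspan m vs"
      then show "x \<in> {x \<in> lspan m (v # vs). a \<bullet> x = 0}" using fy lin False by auto
    next
      fix x assume "x \<in> {x \<in> lspan m (v # vs). a \<bullet> x = 0}"
      then obtain d y where x: "x = d \<cdot>\<^sub>v v + y" "y \<in> lspan m vs" "d * (a \<bullet> v) + a \<bullet> y = 0"
        using lin by auto
      then have "d = - ((a \<bullet> y) / (a \<bullet> v))"
        using False by (simp add: eq_neg_iff_add_eq_0 field_simps)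
      then show "x \<in> f ` lspan m vs" using x fy by auto
    qed
    moreover have "set (map f vs) \<subseteq> carrier_vec m" using c by (auto simp: f_def)
    ultimately show ?thesis unfolding e using sp by simp
  qed
qed

primrec kern :: "'a::field vec list \<Rightarrow> 'a vec list \<Rightarrow> 'a vec list" where
  "kern [] vs = vs"
| "kern (a # as) vs = kern as (elim (map (\<lambda>v. (v, a \<bullet> v)) vs))"

lemma kern_spec:
  assumes "set vs \<subseteq> carrier_vec m" "set as \<subseteq> carrier_vec m" "indep m vs"
  shows "set (kern as vs) \<subseteq> carrier_vec m \<and> indep m (kern as vs) \<and>
    lspan m (kern as vs) = {x \<in> lspan m vs. \<forall>a\<in>set as. a \<bullet> x = 0}"
  using assms
proof (induction as arbitrary: vs)
  case (Cons a as)
  let ?ws = "elim (map (\<lambda>v. (v, a \<bullet> v)) vs)"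
  have "set ?ws \<subseteq> carrier_vec m" "indep m ?ws" "lspan m ?ws = {x \<in> lspan m vs. a \<bullet> x = 0}"
    using elim_spec[of vs m a] Cons.prems by auto
  with Cons.IH[of ?ws] Cons.prems show ?case by simp
qed simp

section \<open>Images of matrices\<close>

text \<open>Independence of the list of columns: the set-based \<open>lin_dep\<close> alone would
  not notice a repeated column. For concatenations it expresses that a sum of images is
  direct.\<close>

definition inj_mat :: "'a::field mat \<Rightarrow> bool" where
  "inj_mat A \<longleftrightarrow>
     (\<forall>x\<in>carrier_vec (dim_col A). A *\<^sub>v x = 0\<^sub>v (dim_row A) \<longrightarrow> x = 0\<^sub>v (dim_col A))"

lemma mat_image_eq: "mat_image A = {A *\<^sub>v x | x. x \<in> carrier_vec (dim_col A)}"
proof -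
  have "mat_image A = {y \<in> carrier_vec (dim_row A). \<exists>x\<in>carrier_vec (dim_col A). A *\<^sub>v x = y}"
    by (rule vec_space.col_space_eq) auto
  also have "\<dots> = {A *\<^sub>v x | x. x \<in> carrier_vec (dim_col A)}"
    using mult_mat_vec_carrier[of A "dim_row A" "dim_col A"] by fast
  finally show ?thesis .
qed

lemma mat_image_carrier: "A \<in> carrier_mat n m \<Longrightarrow> x \<in> mat_image A \<Longrightarrow> x \<in> carrier_vec n"
  unfolding mat_image_eq by auto

lemma mat_image_eq_span:
  fixes A :: "'a::field mat"
  shows "A \<in> carrier_mat n m \<Longrightarrow>
    mat_image A = LinearCombinations.module.span class_ring (module_vec TYPE('a) n) (set (cols A))"
  by (metis vec_space.col_space_def carrier_matD(1))

lemma hcat_carrier: "A \<in> carrier_mat n a \<Longrightarrow> B \<in> carrier_mat n b \<Longrightarrow> hcat A B \<in> carrier_mat n (a + b)"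
  by (auto simp: hcat_def)

lemma row_hcat:
  "A \<in> carrier_mat n a \<Longrightarrow> B \<in> carrier_mat n b \<Longrightarrow> i < n \<Longrightarrow> row (hcat A B) i = row A i @\<^sub>v row B i"
  by (intro eq_vecI) (auto simp: hcat_def)

lemma col_hcat:
  assumes "A \<in> carrier_mat n a" "B \<in> carrier_mat n b"
  shows "j < a \<Longrightarrow> col (hcat A B) j = col A j" "j < b \<Longrightarrow> col (hcat A B) (a + j) = col B j"
  using assms by (auto simp: hcat_def intro!: eq_vecI)

lemma hcat_mult_vec:
  assumes "A \<in> carrier_mat n a" "B \<in> carrier_mat n b" "x \<in> carrier_vec a" "y \<in> carrier_vec b"
  shows "hcat A B *\<^sub>v (x @\<^sub>v y) = A *\<^sub>v x + B *\<^sub>v y"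
proof (rule eq_vecI)
  fix i assume "i < dim_vec (A *\<^sub>v x + B *\<^sub>v y)"
  then have i: "i < n" using assms by simp
  then show "(hcat A B *\<^sub>v (x @\<^sub>v y)) $ i = (A *\<^sub>v x + B *\<^sub>v y) $ i"
    using assms hcat_carrier[OF assms(1,2)] row_hcat[OF assms(1,2) i]
      scalar_prod_append[of "row A i" a "row B i" b x y] by auto
qed (use assms hcat_carrier[OF assms(1,2)] in auto)

lemma hcat_mult:
  assumes "A \<in> carrier_mat n a" "B \<in> carrier_mat n b" "X \<in> carrier_mat (a + b) k"
  shows "hcat A B * X = A * upper_rows a X + B * lower_rows a X"
proof (rule eq_matI)
  fix i j assume "i < dim_row (A * upper_rows a X + B * lower_rows a X)"
    "j < dim_col (A * upper_rows a X + B * lower_rows a X)"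
  then have ij: "i < n" "j < k" using assms by (auto simp: lower_rows_def)
  have X: "upper_rows a X \<in> carrier_mat a k" "lower_rows a X \<in> carrier_mat b k"
    using assms by (auto simp: upper_rows_def lower_rows_def)
  have "col X j = col (upper_rows a X) j @\<^sub>v col (lower_rows a X) j"
    using assms ij by (intro eq_vecI) (auto simp: upper_rows_def lower_rows_def)
  then have "row (hcat A B) i \<bullet> col X j =
      row A i \<bullet> col (upper_rows a X) j + row B i \<bullet> col (lower_rows a X) j"
    using assms ij X row_hcat[OF assms(1,2) ij(1)]
      scalar_prod_append[of "row A i" a "row B i" b "col (upper_rows a X) j" "col (lower_rows a X) j"]
    by auto
  then show "(hcat A B * X) $$ (i, j) = (A * upper_rows a X + B * lower_rows a X) $$ (i, j)"
    using assms ij X hcat_carrier[OF assms(1,2)] by auto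
qed (use assms hcat_carrier[OF assms(1,2)] in \<open>auto simp: lower_rows_def upper_rows_def\<close>)

lemma mat_image_hcat:
  assumes "A \<in> carrier_mat n a" "B \<in> carrier_mat n b"
  shows "mat_image (hcat A B) = {x + y | x y. x \<in> mat_image A \<and> y \<in> mat_image B}"
proof -
  have c: "dim_col (hcat A B) = a + b" "dim_col A = a" "dim_col B = b"
    using assms by (auto simp: hcat_def)
  have sp: "x \<in> carrier_vec (a + b) \<longleftrightarrow> (\<exists>y z. y \<in> carrier_vec a \<and> z \<in> carrier_vec b \<and> x = y @\<^sub>v z)"
    for x :: "'a vec"
    using vec_first_last_append[of x a b] by (metis append_carrier_vec vec_first_carrier vec_last_carrier)
  show ?thesis
  proof (intro equalityI subsetI)
    fix v assume "v \<in> mat_image (hcat A B)"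
    then obtain y z where "y \<in> carrier_vec a" "z \<in> carrier_vec b" "v = hcat A B *\<^sub>v (y @\<^sub>v z)"
      unfolding mat_image_eq c sp by blast
    then show "v \<in> {x + y | x y. x \<in> mat_image A \<and> y \<in> mat_image B}"
      unfolding mat_image_eq c using hcat_mult_vec[OF assms] by blast
  next
    fix v assume "v \<in> {x + y | x y. x \<in> mat_image A \<and> y \<in> mat_image B}"
    then obtain y z where "y \<in> carrier_vec a" "z \<in> carrier_vec b" "v = A *\<^sub>v y + B *\<^sub>v z"
      unfolding mat_image_eq c by blast
    then show "v \<in> mat_image (hcat A B)"
      unfolding mat_image_eq c sp mem_Collect_eq using hcat_mult_vec[OF assms] by metis
  qed
qed

lemma subspace_sum_mat_image:
  fixes A B :: "'a::field mat"
  assumes "A \<in> carrier_mat n a" "B \<in> carrier_mat n b"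
  shows "subspace_sum n (mat_image A) (mat_image B) = mat_image (hcat A B)"
proof -
  interpret vec_space "TYPE('a)" n .
  have "submodule_sum X Y = {x + y | x y. x \<in> X \<and> y \<in> Y}" for X Y
    unfolding submodule_sum_def module_vec_simps by auto
  then show ?thesis unfolding mat_image_hcat[OF assms] .
qed

text \<open>Column \<open>j\<close> of \<open>G\<close> is a preimage under \<open>P\<close> of
  column \<open>j\<close> of \<open>A\<close>. This turns inclusions of images into matrix
  equations.\<close>

lemma mat_image_subset_iff:
  assumes "A \<in> carrier_mat n m" "P \<in> carrier_mat n k"
  shows "mat_image A \<subseteq> mat_image P \<longleftrightarrow> (\<exists>G\<in>carrier_mat k m. A = P * G)"
proof
  assume sub: "mat_image A \<subseteq> mat_image P"
  have "\<exists>x. x \<in> carrier_vec k \<and> col A j = P *\<^sub>v x" if "j < m" for j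
  proof -
    have "A *\<^sub>v unit_vec m j = col A j" using assms that by (intro eq_vecI) auto
    then have "col A j \<in> mat_image A"
      using assms(1) unfolding mat_image_eq mem_Collect_eq by (metis carrier_matD(2) unit_vec_carrier)
    then have "col A j \<in> mat_image P" using sub by blast
    then show ?thesis using assms(2) unfolding mat_image_eq by auto
  qed
  then obtain x where x: "\<And>j. j < m \<Longrightarrow> x j \<in> carrier_vec k \<and> col A j = P *\<^sub>v x j" by metis
  define G where "G = mat_of_cols k (map x [0..<m])"
  have G: "G \<in> carrier_mat k m"
    using mat_of_cols_carrier(1)[of k "map x [0..<m]"] by (simp add: G_def)
  have col_G: "col G j = x j" if "j < m" for j
    unfolding G_def using x[OF that] that by (subst col_mat_of_cols) auto
  have "A = P * G"
  proof (rule mat_col_eqI)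
    fix j assume "j < dim_col (P * G)"
    then have "j < m" using G by simp
    then show "col A j = col (P * G) j" using x col_G col_mult2[OF assms(2) G] by simp
  qed (use assms G in auto)
  with G show "\<exists>G\<in>carrier_mat k m. A = P * G" by blast
next
  assume "\<exists>G\<in>carrier_mat k m. A = P * G"
  then obtain G where G: "G \<in> carrier_mat k m" "A = P * G" by blast
  show "mat_image A \<subseteq> mat_image P"
  proof
    fix y assume "y \<in> mat_image A"
    then obtain x where "x \<in> carrier_vec m" "y = A *\<^sub>v x" using assms unfolding mat_image_eq by auto
    then have "G *\<^sub>v x \<in> carrier_vec k" "y = P *\<^sub>v (G *\<^sub>v x)" using G assms by auto
    then show "y \<in> mat_image P" using assms(2) unfolding mat_image_eq by auto
  qed
qed

lemma inj_mat_cancel: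
  assumes "inj_mat A" "A \<in> carrier_mat n m" "X \<in> carrier_mat m k" "Y \<in> carrier_mat m k"
    and "A * X = A * Y"
  shows "X = Y"
proof (rule mat_col_eqI)
  fix j assume "j < dim_col Y"
  then have j: "j < k" using assms by simp
  have "A *\<^sub>v (col X j - col Y j) = A *\<^sub>v col X j - A *\<^sub>v col Y j"
    using assms by (intro mult_minus_distrib_mat_vec[of _ n m]) auto
  also have "A *\<^sub>v col X j = A *\<^sub>v col Y j"
    using assms j by (metis col_mult2)
  finally have "A *\<^sub>v (col X j - col Y j) = 0\<^sub>v n" using assms by (auto intro!: eq_vecI)
  then have "col X j - col Y j = 0\<^sub>v m" using assms(1-4) j unfolding inj_mat_def by auto
  then have "(col X j - col Y j) $ i = 0" if "i < m" for i using that by simp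
  then show "col X j = col Y j"
    using assms(3,4) j by (intro eq_vecI) auto
qed (use assms in auto)

lemma inj_mat_hcatD:
  assumes "inj_mat (hcat A B)" "A \<in> carrier_mat n a" "B \<in> carrier_mat n b"
  shows "inj_mat A" "inj_mat B"
    and "x \<in> mat_image A \<Longrightarrow> x \<in> mat_image B \<Longrightarrow> x = 0\<^sub>v n"
proof -
  note h = hcat_carrier[OF assms(2,3)]
  have inj: "x = 0\<^sub>v a \<and> y = 0\<^sub>v b"
    if "x \<in> carrier_vec a" "y \<in> carrier_vec b" "A *\<^sub>v x + B *\<^sub>v y = 0\<^sub>v n" for x y
  proof -
    have "x @\<^sub>v y = 0\<^sub>v (a + b)"
      using assms(1) h hcat_mult_vec[OF assms(2,3) that(1,2)] that unfolding inj_mat_def by auto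
    also have "\<dots> = 0\<^sub>v a @\<^sub>v 0\<^sub>v b" by auto
    finally show ?thesis using that append_vec_eq[of x a "0\<^sub>v a" y "0\<^sub>v b"] by auto
  qed
  have "A *\<^sub>v 0\<^sub>v a = 0\<^sub>v n" "B *\<^sub>v 0\<^sub>v b = 0\<^sub>v n" using assms by (auto intro!: eq_vecI)
  then show "inj_mat A" "inj_mat B"
    unfolding inj_mat_def using inj[of _ "0\<^sub>v b"] inj[of "0\<^sub>v a"] assms by auto
  assume "x \<in> mat_image A" "x \<in> mat_image B"
  then obtain u w where uw: "u \<in> carrier_vec a" "x = A *\<^sub>v u" "w \<in> carrier_vec b" "x = B *\<^sub>v w"
    using assms(2,3) unfolding mat_image_eq by auto
  have "B *\<^sub>v (- w) = - (B *\<^sub>v w)"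
    using assms(3) uw(3) by (intro eq_vecI) auto
  then have "A *\<^sub>v u + B *\<^sub>v (- w) = 0\<^sub>v n"
    using uw assms(2,3) by (metis uminus_r_inv_vec mult_mat_vec_carrier)
  then have "u = 0\<^sub>v a" using inj[of u "- w"] uw by auto
  then show "x = 0\<^sub>v n" using uw assms by auto
qed

section \<open>Bases and dimensions\<close>

lemma lspan_eq_mat_image:
  fixes vs :: "'a::field vec list"
  assumes "set vs \<subseteq> carrier_vec m"
  shows "lspan m vs = mat_image (mat_of_cols m vs)"
  using assms
proof (induction vs)
  case Nil
  have "mat_of_cols m [] *\<^sub>v x = 0\<^sub>v m" if "x \<in> carrier_vec 0" for x :: "'a vec"
    using that by (intro eq_vecI) (auto simp: scalar_prod_def)
  then have "{mat_of_cols m [] *\<^sub>v x | x :: 'a vec. x \<in> carrier_vec 0} = {0\<^sub>v m}"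
    by auto (metis zero_carrier_vec)
  then show ?case unfolding mat_image_eq by simp
next
  case (Cons v vs)
  have c: "v \<in> carrier_vec m" "set vs \<subseteq> carrier_vec m" using Cons.prems by simp_all
  have h: "mat_of_cols m (v # vs) = hcat (mat_of_cols m [v]) (mat_of_cols m vs)"
    by (intro eq_matI) (auto simp: hcat_def mat_of_cols_def nth_Cons')
  have s: "mat_of_cols m [v] *\<^sub>v x = (x $ 0) \<cdot>\<^sub>v v" if "x \<in> carrier_vec 1" for x
    using that c by (intro eq_vecI) (auto simp: scalar_prod_def mat_of_cols_def)
  have im: "mat_image (mat_of_cols m [v]) = {c \<cdot>\<^sub>v v | c. True}"
  proof (intro equalityI subsetI)
    fix y assume "y \<in> mat_image (mat_of_cols m [v])"
    then show "y \<in> {c \<cdot>\<^sub>v v | c. True}" unfolding mat_image_eq using s by auto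
  next
    fix y assume "y \<in> {c \<cdot>\<^sub>v v | c. True}"
    then obtain c where "y = c \<cdot>\<^sub>v v" by blast
    then have "y = mat_of_cols m [v] *\<^sub>v vec 1 (\<lambda>_. c)" using s[of "vec 1 (\<lambda>_. c)"] by simp
    then show "y \<in> mat_image (mat_of_cols m [v])" unfolding mat_image_eq mem_Collect_eq
      by (intro exI[of _ "vec 1 (\<lambda>_. c)"]) simp
  qed
  have carr: "mat_of_cols m [v] \<in> carrier_mat m 1" "mat_of_cols m vs \<in> carrier_mat m (length vs)"
    by (simp_all add: mat_of_cols_def)
  have "lspan m (v # vs) = {x + y | x y. x \<in> mat_image (mat_of_cols m [v]) \<and> y \<in> mat_image (mat_of_cols m vs)}"
    unfolding lspan.simps im Cons.IH[OF c(2)] by blast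
  then show ?case unfolding h mat_image_hcat[OF carr] .
qed

lemma lspan_cols:
  assumes "A \<in> carrier_mat n m"
  shows "lspan n (cols A) = mat_image A"
proof -
  have "set (cols A) \<subseteq> carrier_vec n" using cols_dim[of A] assms by simp
  then have "lspan n (cols A) = mat_image (mat_of_cols n (cols A))" by (rule lspan_eq_mat_image)
  also have "mat_of_cols n (cols A) = A" using assms by auto
  finally show ?thesis .
qed

lemma lspan_eq_span:
  fixes vs :: "'a::field vec list"
  assumes "set vs \<subseteq> carrier_vec m"
  shows "lspan m vs = LinearCombinations.module.span class_ring (module_vec TYPE('a) m) (set vs)"
  unfolding lspan_eq_mat_image[OF assms]
  by (subst mat_image_eq_span[of _ m "length vs"]) (use assms in \<open>simp_all add: mat_of_cols_def cols_mat_of_cols[unfolded mat_of_cols_def]\<close>)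

lemma indep_imp_lin_indpt:
  fixes vs :: "'a::field vec list"
  assumes "set vs \<subseteq> carrier_vec m" "indep m vs"
  shows "distinct vs \<and> \<not> LinearCombinations.module.lin_dep class_ring (module_vec TYPE('a) m) (set vs)"
proof -
  interpret vec_space "TYPE('a)" m .
  show ?thesis using assms
  proof (induction vs)
    case Nil
    then show ?case by (simp add: lin_dep_def)
  next
    case (Cons v vs)
    have c: "v \<in> carrier_vec m" "set vs \<subseteq> carrier_vec m" using Cons.prems by auto
    have "v \<notin> span (set vs)" using Cons.prems lspan_eq_span[OF c(2)] by simp
    moreover have "v \<notin> set vs" using Cons.prems lspan_mem[OF c(2)] by auto
    ultimately show ?case using Cons c lin_dep_iff_in_span[of "set vs" v] by auto
  qed
qed

lemma inj_mat_iff_lin_indpt: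
  fixes B :: "'a::field mat"
  assumes "B \<in> carrier_mat n d"
  shows "inj_mat B \<longleftrightarrow> distinct (cols B) \<and>
    \<not> LinearCombinations.module.lin_dep class_ring (module_vec TYPE('a) n) (set (cols B))"
proof -
  interpret vec_space "TYPE('a)" n .
  have dist: "distinct (cols B)" if inj: "inj_mat B"
    unfolding distinct_conv_nth
  proof (intro allI impI notI)
    fix i j assume ij: "i < length (cols B)" "j < length (cols B)" "i \<noteq> j" "cols B ! i = cols B ! j"
    then have ij': "i < d" "j < d" "col B i = col B j" using assms by auto
    \<comment> \<open>Two equal columns would put the difference of two unit vectors into the
      kernel.\<close>
    have "B *\<^sub>v (unit_vec d i - unit_vec d j) = B *\<^sub>v unit_vec d i - B *\<^sub>v unit_vec d j"
      using assms by (intro mult_minus_distrib_mat_vec[of _ n d]) auto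
    also have "B *\<^sub>v unit_vec d i = col B i" using assms ij'(1) by (intro eq_vecI) auto
    also have "B *\<^sub>v unit_vec d j = col B j" using assms ij'(2) by (intro eq_vecI) auto
    finally have "B *\<^sub>v (unit_vec d i - unit_vec d j) = 0\<^sub>v n" using assms ij' by auto
    then have "unit_vec d i - unit_vec d j = (0\<^sub>v d :: 'a vec)"
      using inj assms unfolding inj_mat_def by auto
    then have "(unit_vec d i - unit_vec d j) $ i = (0::'a)" using ij' by simp
    then show False using ij ij' by simp
  qed
  show ?thesis
  proof
    assume inj: "inj_mat B"
    show "distinct (cols B) \<and> \<not> lin_dep (set (cols B))"
      using lin_depE[OF assms _ dist[OF inj]] inj assms dist[OF inj] unfolding inj_mat_def by auto
  next
    assume "distinct (cols B) \<and> \<not> lin_dep (set (cols B))"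
    then show "inj_mat B" using lin_depI[OF assms] assms unfolding inj_mat_def by auto
  qed
qed

lemma inj_mat_mat_of_cols:
  "set vs \<subseteq> carrier_vec m \<Longrightarrow> indep m vs \<Longrightarrow> inj_mat (mat_of_cols m vs)"
  using indep_imp_lin_indpt[of vs m] inj_mat_iff_lin_indpt[of "mat_of_cols m vs" m "length vs"] by simp

text \<open>Giving the space as \<open>mat_image K\<close> makes it a span and hence a subspace,
  inside which independence and span agree with those of the whole space. The basis condition of the
  algorithm thereby becomes a statement about matrices.\<close>

lemma columns_basis_of_iff:
  fixes B K :: "'a::field mat"
  assumes "B \<in> carrier_mat n d" "K \<in> carrier_mat n k"
  shows "columns_basis_of B (mat_image K) \<longleftrightarrow> inj_mat B \<and> mat_image B = mat_image K"
proof -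
  interpret vec_space "TYPE('a)" n .
  let ?W = "span (set (cols K))"
  have cK: "set (cols K) \<subseteq> carrier_vec n" and cB: "set (cols B) \<subseteq> carrier_vec n"
    using assms cols_dim by blast+
  have sub: "subspace class_ring ?W V" using span_is_subspace cK by auto
  then have smod: "submodule class_ring ?W V" by (simp add: subspace_def)
  interpret W: vectorspace class_ring "vs ?W" using subspace_is_vs[OF sub] .
  have im: "mat_image K = ?W" "mat_image B = span (set (cols B))"
    using mat_image_eq_span[OF assms(2)] mat_image_eq_span[OF assms(1)] by auto
  have in_span: "set (cols B) \<subseteq> span (set (cols B))" using in_own_span cB by auto
  have dep: "set (cols B) \<subseteq> ?W \<Longrightarrow> W.lin_dep (set (cols B)) = lin_dep (set (cols B))"
    "set (cols B) \<subseteq> ?W \<Longrightarrow> W.span (set (cols B)) = span (set (cols B))"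
    using span_li_not_depend[OF _ smod] by auto
  have "columns_basis_of B (mat_image K) \<longleftrightarrow> distinct (cols B) \<and> W.basis (set (cols B))"
    using assms im by (simp add: columns_basis_of_def)
  also have "\<dots> \<longleftrightarrow> distinct (cols B) \<and> \<not> lin_dep (set (cols B)) \<and> span (set (cols B)) = ?W"
    using dep in_span unfolding W.basis_def by auto
  finally show ?thesis using im inj_mat_iff_lin_indpt[OF assms(1)] by auto
qed

lemma subspace_dim_mat_image:
  fixes B :: "'a::field mat"
  assumes "B \<in> carrier_mat n d" "inj_mat B"
  shows "subspace_dim n (mat_image B) = d"
proof -
  interpret vec_space "TYPE('a)" n .
  show ?thesis using lin_indpt_full_rank[OF assms(1)] inj_mat_iff_lin_indpt[OF assms(1)] assms
    mat_image_eq_span[OF assms(1)] by (simp add: rank_def)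
qed

lemma indep_length:
  assumes "set vs \<subseteq> carrier_vec n" "indep n vs" "lspan n vs = mat_image X" "X \<in> carrier_mat n e" "inj_mat X"
  shows "length vs = e"
  using subspace_dim_mat_image[of "mat_of_cols n vs" n "length vs"] assms
    inj_mat_mat_of_cols[of vs n] lspan_eq_mat_image[of vs n] subspace_dim_mat_image[of X n e] by auto

lemma exists_basis_mat:
  assumes "A \<in> carrier_mat n m"
  shows "\<exists>B\<in>carrier_mat n (subspace_dim n (mat_image A)). inj_mat B \<and> mat_image B = mat_image A"
proof -
  obtain us where us: "set us \<subseteq> carrier_vec n" "indep n us" "lspan n us = lspan n (cols A)"
    using extend_indep[of n "[]" "cols A"] cols_dim[of A] assms by auto
  let ?B = "mat_of_cols n us"
  have B: "?B \<in> carrier_mat n (length us)" "inj_mat ?B" "mat_image ?B = mat_image A"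
    using us inj_mat_mat_of_cols lspan_eq_mat_image[of us n] lspan_cols[OF assms] by auto
  then show ?thesis using subspace_dim_mat_image[OF B(1,2)] by (metis)
qed

text \<open>The dimension formula for a sum of two subspaces: a basis \<open>ks\<close> of the
  intersection is extended to bases \<open>us @ ks\<close> and \<open>ws @ ks\<close> of the two
  images, and \<open>us @ ws @ ks\<close> is then a basis of the sum.\<close>

lemma dim_sum_inter:
  assumes A: "A \<in> carrier_mat n a" "inj_mat A" and B: "B \<in> carrier_mat n b" "inj_mat B"
    and K: "K \<in> carrier_mat n d" "inj_mat K" "mat_image K = mat_image A \<inter> mat_image B"
  shows "subspace_dim n (mat_image (hcat A B)) + d = a + b"
proof -
  have cols: "set (cols X) \<subseteq> carrier_vec n" if "X \<in> carrier_mat n e" for X :: "'a mat" and e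
    using cols_dim[of X] that by auto
  obtain ks where ks: "set ks \<subseteq> carrier_vec n" "indep n ks" "lspan n ks = mat_image K"
    using extend_indep[of n "[]" "cols K"] lspan_cols[OF K(1)] cols[OF K(1)] by auto
  have "\<exists>us. set us \<subseteq> carrier_vec n \<and> indep n (us @ ks) \<and> lspan n (us @ ks) = mat_image X"
    if X: "X \<in> carrier_mat n e" and sub: "mat_image K \<subseteq> mat_image X" for X e
  proof -
    have "lspan n (cols X @ ks) = mat_image X"
    proof (intro equalityI subsetI)
      fix x assume "x \<in> lspan n (cols X @ ks)"
      then obtain y z where "x = y + z" "y \<in> lspan n (cols X)" "z \<in> lspan n (cols X)"
        using lspan_append[OF cols[OF X] ks(1)] ks(3) sub lspan_cols[OF X] by auto
      then show "x \<in> mat_image X" using lspan_add[OF cols[OF X]] lspan_cols[OF X] by auto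
    next
      fix x assume x: "x \<in> mat_image X"
      then have "x = x + 0\<^sub>v n" using mat_image_carrier[OF X] by auto
      then show "x \<in> lspan n (cols X @ ks)"
        using lspan_append[OF cols[OF X] ks(1)] lspan_zero[OF ks(1)] x lspan_cols[OF X] by auto
    qed
    then show ?thesis using extend_indep[OF ks(2) cols[OF X] ks(1)] by auto
  qed
  then obtain us ws where
    us: "set us \<subseteq> carrier_vec n" "indep n (us @ ks)" "lspan n (us @ ks) = mat_image A" and
    ws: "set ws \<subseteq> carrier_vec n" "indep n (ws @ ks)" "lspan n (ws @ ks) = mat_image B"
    using A(1) B(1) K(3) by (metis inf_le1 inf_le2)
  have la: "length us + length ks = a" "length ws + length ks = b" "length ks = d"
    using indep_length[OF _ us(2,3) A] indep_length[OF _ ws(2,3) B] indep_length[OF ks K(1,2)] us ws ks by auto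
  have ind: "indep n (us @ ws @ ks)"
    using us ws ks K(3) by (intro indep_join) auto
  have "lspan n (us @ ws @ ks) = mat_image (hcat A B)"
  proof (intro equalityI subsetI)
    fix x assume "x \<in> lspan n (us @ ws @ ks)"
    then obtain y z where x: "x = y + z" "y \<in> lspan n us" "z \<in> mat_image B"
      using lspan_append[of us n "ws @ ks"] us ws ks by auto
    have "y = y + 0\<^sub>v n" using lspan_carrier[OF us(1) x(2)] by auto
    then have "y \<in> mat_image A"
      using lspan_append[of us n ks] us ks x lspan_zero[OF ks(1)] by auto
    then show "x \<in> mat_image (hcat A B)" unfolding mat_image_hcat[OF A(1) B(1)] using x by auto
  next
    fix x assume "x \<in> mat_image (hcat A B)"
    then obtain y z where x: "x = y + z" "y \<in> lspan n (us @ ks)" "z \<in> lspan n (ws @ ks)"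
      unfolding mat_image_hcat[OF A(1) B(1)] us ws by auto
    \<comment> \<open>The part of \<open>y\<close> along the common vectors \<open>ks\<close> is
      moved over to the second summand.\<close>
    then obtain u k where u: "y = u + k" "u \<in> lspan n us" "k \<in> lspan n ks"
      using lspan_append[of us n ks] us ks by auto
    have c: "u \<in> carrier_vec n" "k \<in> carrier_vec n" "z \<in> carrier_vec n"
      using u x lspan_carrier us(1) ks(1) lspan_carrier[of "ws @ ks" n] ws(1) by auto
    have "0\<^sub>v n + k \<in> lspan n (ws @ ks)"
      using lspan_append[OF ws(1) ks(1)] lspan_zero[OF ws(1)] u by blast
    then have "k + z \<in> lspan n (ws @ ks)" using x c ws ks lspan_add[of "ws @ ks" n k z] by auto
    moreover have "x = u + (k + z)" using x u c by auto
    ultimately show "x \<in> lspan n (us @ ws @ ks)"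
      using lspan_append[of us n "ws @ ks"] us ws ks u by auto
  qed
  then have "subspace_dim n (mat_image (hcat A B)) = length (us @ ws @ ks)"
    using subspace_dim_mat_image[of "mat_of_cols n (us @ ws @ ks)" n "length (us @ ws @ ks)"]
      inj_mat_mat_of_cols[OF _ ind] mat_of_cols_carrier(1)[of n "us @ ws @ ks"] lspan_eq_mat_image[of "us @ ws @ ks" n] us ws ks by auto
  then show ?thesis using la by simp
qed

text \<open>A basis matrix \<open>Q\<close> of the image of \<open>M\<close> has as many columns as
  \<open>P\<close>, so Q = P G with \<open>G\<close> square. A kernel vector of \<open>G\<close>
  would be one of \<open>Q\<close>, hence \<open>G\<close> is invertible and P = Q H inherits
  injectivity and image. This lemma converts the dimension hypotheses into injectivity.\<close>

lemma full_dim_factor: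
  assumes "P \<in> carrier_mat n m" "M \<in> carrier_mat n k" "mat_image M \<subseteq> mat_image P"
    and "subspace_dim n (mat_image M) = m"
  shows "inj_mat P" "mat_image M = mat_image P"
proof -
  obtain Q where Q: "Q \<in> carrier_mat n m" "inj_mat Q" "mat_image Q = mat_image M"
    using exists_basis_mat[OF assms(2)] assms(4) by auto
  then obtain G where G: "G \<in> carrier_mat m m" "Q = P * G"
    using mat_image_subset_iff[OF Q(1) assms(1)] assms(3) by auto
  have "det G \<noteq> 0"
  proof
    assume "det G = 0"
    then obtain v where v: "v \<in> carrier_vec m" "v \<noteq> 0\<^sub>v m" "G *\<^sub>v v = 0\<^sub>v m"
      using det_0_iff_vec_prod_zero_field[OF G(1)] by auto
    have "Q *\<^sub>v v = P *\<^sub>v (G *\<^sub>v v)" using G v assms(1) by simp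
    also have "\<dots> = 0\<^sub>v n" using v assms(1) by (auto intro!: eq_vecI)
    finally show False using Q v unfolding inj_mat_def by auto
  qed
  then obtain H where H: "H \<in> carrier_mat m m" "G * H = 1\<^sub>m m" "H * G = 1\<^sub>m m"
    using det_non_zero_imp_unit[OF G(1), of m] by (auto simp: Units_def ring_mat_simps)
  have P: "P = Q * H" using G H assms(1) by simp
  then show eq: "mat_image M = mat_image P"
    using mat_image_subset_iff[OF assms(1) Q(1)] H(1) Q(3) assms(3) by auto
  show "inj_mat P" unfolding inj_mat_def
  proof (intro ballI impI)
    fix x assume x: "x \<in> carrier_vec (dim_col P)" "P *\<^sub>v x = 0\<^sub>v (dim_row P)"
    then have xm: "x \<in> carrier_vec m" using assms(1) by simp
    have "Q *\<^sub>v (H *\<^sub>v x) = 0\<^sub>v n" using x xm P Q(1) H(1) assms(1) by simp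
    then have "H *\<^sub>v x = 0\<^sub>v m" using Q H(1) xm unfolding inj_mat_def by auto
    then have "G *\<^sub>v (H *\<^sub>v x) = 0\<^sub>v m" using G(1) by (auto intro!: eq_vecI)
    moreover have "G *\<^sub>v (H *\<^sub>v x) = (G * H) *\<^sub>v x" using G(1) H(1) xm by simp
    ultimately show "x = 0\<^sub>v (dim_col P)" using H(2) xm assms(1) by simp
  qed
qed

lemma lspan_unit_vecs_zero:
  assumes "x \<in> lspan m (map (unit_vec m) js)" "i < m" "i \<notin> set js"
  shows "x $ i = 0"
  using assms
proof (induction js arbitrary: x)
  case (Cons j js)
  then obtain c y where x: "x = c \<cdot>\<^sub>v unit_vec m j + y" "y \<in> lspan m (map (unit_vec m) js)" by auto
  moreover have "y \<in> carrier_vec m" by (rule lspan_carrier[OF _ x(2)]) auto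
  ultimately show ?case using Cons.IH[OF x(2)] Cons.prems(2,3) by (simp add: unit_vec_def)
qed auto

lemma indep_unit_vecs:
  "distinct js \<Longrightarrow> set js \<subseteq> {..<m} \<Longrightarrow> indep m (map (unit_vec m) js)"
proof (induction js)
  case (Cons j js)
  then show ?case using lspan_unit_vecs_zero[of "unit_vec m j" m js j] by auto
qed simp

text \<open>Only the zero vector is annihilated by all unit vectors, so the double annihilator
  argument yields everything.\<close>

lemma lspan_unit_vecs: "lspan m (map (unit_vec m) [0..<m]) = (carrier_vec m :: 'a::field vec set)"
proof (intro equalityI subsetI)
  fix b :: "'a vec" assume b: "b \<in> carrier_vec m"
  show "b \<in> lspan m (map (unit_vec m) [0..<m])"
  proof (rule mem_lspan_if_annihilated[OF _ b])
    fix y :: "'a vec" assume y: "y \<in> carrier_vec m" "\<forall>w\<in>set (map (unit_vec m) [0..<m]). w \<bullet> y = 0"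
    then have "y $ i = 0" if "i < m" for i using that by auto
    then have "y = 0\<^sub>v m" using y by auto
    then show "b \<bullet> y = 0" using b by simp
  qed auto
next
  fix x :: "'a vec" assume "x \<in> lspan m (map (unit_vec m) [0..<m])"
  then show "x \<in> carrier_vec m" by (rule lspan_carrier[rotated]) auto
qed

section \<open>Kernels and intersections of images\<close>

definition kernel_list :: "'a::field mat \<Rightarrow> 'a vec list" where
  "kernel_list A = kern (rows A) (map (unit_vec (dim_col A)) [0..<dim_col A])"

lemma kernel_list:
  fixes A :: "'a::field mat"
  assumes "A \<in> carrier_mat n m"
  shows "set (kernel_list A) \<subseteq> carrier_vec m" "indep m (kernel_list A)"
    "lspan m (kernel_list A) = {x \<in> carrier_vec m. A *\<^sub>v x = 0\<^sub>v n}"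
proof -
  have rows: "set (rows A) \<subseteq> carrier_vec m" using assms rows_carrier[of A] by auto
  have "(\<forall>a\<in>set (rows A). a \<bullet> x = 0) \<longleftrightarrow> A *\<^sub>v x = 0\<^sub>v n" for x
    using assms by (auto simp: rows_def vec_eq_iff)
  moreover have "set (map (unit_vec m) [0..<m]) \<subseteq> (carrier_vec m :: 'a vec set)" by auto
  moreover have "indep m (map (unit_vec m :: nat \<Rightarrow> 'a vec) [0..<m])"
    by (rule indep_unit_vecs) auto
  moreover have "kernel_list A = kern (rows A) (map (unit_vec m) [0..<m])"
    using assms by (simp add: kernel_list_def)
  ultimately show "set (kernel_list A) \<subseteq> carrier_vec m" "indep m (kernel_list A)"
    "lspan m (kernel_list A) = {x \<in> carrier_vec m. A *\<^sub>v x = 0\<^sub>v n}"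
    using kern_spec[of "map (unit_vec m) [0..<m]" m "rows A"] rows
    by (simp_all add: lspan_unit_vecs)
qed

definition kernel_mat :: "'a::field mat \<Rightarrow> 'a mat" where
  "kernel_mat A = mat_of_cols (dim_col A) (kernel_list A)"

lemma kernel_mat:
  assumes "A \<in> carrier_mat n m"
  shows "kernel_mat A \<in> carrier_mat m (length (kernel_list A))" "inj_mat (kernel_mat A)"
    "mat_image (kernel_mat A) = {x \<in> carrier_vec m. A *\<^sub>v x = 0\<^sub>v n}"
proof -
  have K: "kernel_mat A = mat_of_cols m (kernel_list A)" using assms by (simp add: kernel_mat_def)
  show "kernel_mat A \<in> carrier_mat m (length (kernel_list A))" unfolding K by simp
  show "inj_mat (kernel_mat A)"
    unfolding K by (rule inj_mat_mat_of_cols[OF kernel_list(1,2)[OF assms]])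
  show "mat_image (kernel_mat A) = {x \<in> carrier_vec m. A *\<^sub>v x = 0\<^sub>v n}"
    unfolding K lspan_eq_mat_image[OF kernel_list(1)[OF assms], symmetric] kernel_list(3)[OF assms] ..
qed

lemma transpose_mult_eq_0:
  assumes "X \<in> carrier_mat n k" "x \<in> carrier_vec n"
  shows "transpose_mat X *\<^sub>v x = 0\<^sub>v k \<longleftrightarrow> (\<forall>j<k. col X j \<bullet> x = 0)"
  using assms by (auto simp: vec_eq_iff)

text \<open>The columns of \<open>L\<close> form a basis of the left kernel of \<open>M\<close>. One
  direction moves \<open>M\<close> across the scalar product; for the other, every vector
  annihilated by the columns of \<open>M\<close> has the form L u, so
  \<open>mem_lspan_if_annihilated\<close> applies.\<close>

lemma mem_mat_image_iff:
  fixes M :: "'a::field mat"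
  assumes M: "M \<in> carrier_mat n a"
  defines "L \<equiv> kernel_mat (transpose_mat M)"
  shows "x \<in> mat_image M \<longleftrightarrow> x \<in> carrier_vec n \<and> (\<forall>j<dim_col L. col L j \<bullet> x = 0)"
proof -
  have MT: "transpose_mat M \<in> carrier_mat a n" using M by simp
  note kL = kernel_mat[OF MT, folded L_def]
  let ?l = "length (kernel_list (transpose_mat M))"
  have adj: "y \<bullet> (X *\<^sub>v z) = (transpose_mat X *\<^sub>v y) \<bullet> z"
    if "X \<in> carrier_mat n k" "y \<in> carrier_vec n" "z \<in> carrier_vec k" for X :: "'a mat" and y z k
    using that transpose_vec_mult_scalar[of X n k z y] by auto
  show ?thesis
  proof
    assume "x \<in> mat_image M"
    then obtain z where z: "z \<in> carrier_vec a" "x = M *\<^sub>v z" using M unfolding mat_image_eq by auto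
    have "col L j \<bullet> x = 0" if "j < dim_col L" for j
    proof -
      have c: "col L j \<in> carrier_vec n" using kL(1) by auto
      have "col L j = L *\<^sub>v unit_vec ?l j" using that kL(1) by (intro eq_vecI) auto
      then have "col L j \<in> mat_image L"
        using kL(1) unfolding mat_image_eq mem_Collect_eq by (metis carrier_matD(2) unit_vec_carrier)
      then have "transpose_mat M *\<^sub>v col L j = 0\<^sub>v a" using kL(3) by blast
      then show ?thesis using adj[OF M c z(1)] z by simp
    qed
    then show "x \<in> carrier_vec n \<and> (\<forall>j<dim_col L. col L j \<bullet> x = 0)" using z M by simp
  next
    assume x: "x \<in> carrier_vec n \<and> (\<forall>j<dim_col L. col L j \<bullet> x = 0)"
    have cM: "set (cols M) \<subseteq> carrier_vec n" using M cols_dim[of M] by auto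
    have "x \<in> lspan n (cols M)"
    proof (rule mem_lspan_if_annihilated[OF cM])
      show "x \<in> carrier_vec n" using x ..
      fix y assume y: "y \<in> carrier_vec n" "\<forall>w\<in>set (cols M). w \<bullet> y = 0"
      then have "transpose_mat M *\<^sub>v y = 0\<^sub>v a"
        unfolding transpose_mult_eq_0[OF M y(1)] using M by (auto simp: cols_def)
      then have "y \<in> mat_image L" using y(1) kL(3) by blast
      then obtain u where u: "u \<in> carrier_vec ?l" "y = L *\<^sub>v u" using kL(1) unfolding mat_image_eq by auto
      have "transpose_mat L *\<^sub>v x = 0\<^sub>v ?l"
        using x kL(1) transpose_mult_eq_0[OF kL(1), of x] by auto
      then show "x \<bullet> y = 0" using adj[OF kL(1) _ u(1), of x] x u by simp
    qed
    then show "x \<in> mat_image M" using lspan_cols[OF M] by simp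
  qed
qed

definition image_inter_mat :: "'a::field mat \<Rightarrow> 'a mat \<Rightarrow> 'a mat" where
  "image_inter_mat M N = kernel_mat (transpose_mat
     (hcat (kernel_mat (transpose_mat M)) (kernel_mat (transpose_mat N))))"

lemma image_inter_mat:
  assumes M: "M \<in> carrier_mat n a" and N: "N \<in> carrier_mat n b"
  shows "image_inter_mat M N \<in> carrier_mat n (dim_col (image_inter_mat M N))"
    "inj_mat (image_inter_mat M N)" "mat_image (image_inter_mat M N) = mat_image M \<inter> mat_image N"
proof -
  let ?L = "kernel_mat (transpose_mat M)" and ?L' = "kernel_mat (transpose_mat N)"
  obtain l where L: "?L \<in> carrier_mat n l" using kernel_mat(1)[of "transpose_mat M" a n] M by auto
  obtain l' where L': "?L' \<in> carrier_mat n l'" using kernel_mat(1)[of "transpose_mat N" b n] N by auto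
  note h = hcat_carrier[OF L L']
  then have hT: "transpose_mat (hcat ?L ?L') \<in> carrier_mat (l + l') n" by simp
  note K = kernel_mat[OF hT, folded image_inter_mat_def]
  show "image_inter_mat M N \<in> carrier_mat n (dim_col (image_inter_mat M N))" using K(1) by auto
  show "inj_mat (image_inter_mat M N)" by (fact K(2))
  have split: "(\<forall>j<l + l'. P j) \<longleftrightarrow> (\<forall>j<l. P j) \<and> (\<forall>j<l'. P (l + j))" for P
    by (metis add_less_cancel_left le_add_diff_inverse not_less trans_less_add1)
  have "transpose_mat (hcat ?L ?L') *\<^sub>v x = 0\<^sub>v (l + l') \<longleftrightarrow>
      (\<forall>j<l. col ?L j \<bullet> x = 0) \<and> (\<forall>j<l'. col ?L' j \<bullet> x = 0)" if "x \<in> carrier_vec n" for x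
    unfolding transpose_mult_eq_0[OF h that] split using col_hcat[OF L L'] by simp
  then show "mat_image (image_inter_mat M N) = mat_image M \<inter> mat_image N"
    unfolding K(3) using mem_mat_image_iff[OF M] mem_mat_image_iff[OF N] L L' by auto
qed

section \<open>Unique solutions of linear systems\<close>

lemma unique_solution_eq_Some: "unique_solution P = Some x \<longleftrightarrow> P x \<and> (\<forall>y. P y \<longrightarrow> y = x)"
proof
  assume "unique_solution P = Some x"
  then have "\<exists>!x. P x" "x = (THE x. P x)" by (auto simp: unique_solution_def split: if_splits)
  then show "P x \<and> (\<forall>y. P y \<longrightarrow> y = x)" by (metis theI_unique)
next
  assume x: "P x \<and> (\<forall>y. P y \<longrightarrow> y = x)"
  then have "(THE x. P x) = x" by (intro the_equality) blast+
  moreover have "\<exists>!x. P x" using x by blast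
  ultimately show "unique_solution P = Some x" by (simp add: unique_solution_def)
qed

lemma unique_solution_SomeI: "P x \<Longrightarrow> (\<And>y. P y \<Longrightarrow> y = x) \<Longrightarrow> unique_solution P = Some x"
  unfolding unique_solution_eq_Some by blast

lemma unique_solution_eq_None: "unique_solution P = None \<longleftrightarrow> \<not> (\<exists>!x. P x)"
  by (simp add: unique_solution_def)

text \<open>The assumptions make \<open>f\<close> a bijection between the two solution sets, so
  exactly one solution on one side means exactly one on the other; failure is transferred
  too.\<close>

lemma unique_solution_transfer:
  assumes "\<And>x. P x \<Longrightarrow> Q (f x)" "\<And>y. Q y \<Longrightarrow> \<exists>x. P x \<and> f x = y"
    and "\<And>x x'. P x \<Longrightarrow> P x' \<Longrightarrow> f x = f x' \<Longrightarrow> x = x'"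
  shows "unique_solution Q = map_option f (unique_solution P)"
proof (cases "unique_solution P")
  case None
  have "\<not> (\<exists>!y. Q y)"
  proof
    assume "\<exists>!y. Q y"
    then obtain y where y: "Q y" "\<And>z. Q z \<Longrightarrow> z = y" by blast
    then obtain x where x: "P x" "f x = y" using assms(2) by blast
    have "z = x" if "P z" for z using y(2)[OF assms(1)[OF that]] x assms(3) that by blast
    then show False using x None unfolding unique_solution_eq_None by blast
  qed
  then show ?thesis using None by (simp add: unique_solution_eq_None[symmetric])
next
  case (Some x)
  then have x: "P x" "\<And>y. P y \<Longrightarrow> y = x" by (auto simp: unique_solution_eq_Some)
  then have "unique_solution Q = Some (f x)"
    using assms(1)[OF x(1)] assms(2) by (intro unique_solution_SomeI) blast+
  then show ?thesis using Some by simp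
qed

text \<open>The vectors have length \<open>a + 1\<close>, so \<open>v $ a\<close> is the last
  coordinate, the coefficient of the right-hand side. The form \<open>0 - v $ i / v $ a\<close>
  repeats the two operations of the program.\<close>

definition solution_of_kernel :: "nat \<Rightarrow> 'a::field vec list \<Rightarrow> 'a vec option" where
  "solution_of_kernel a vs =
     (case vs of [v] \<Rightarrow> if v $ a = 0 then None else Some (vec a (\<lambda>i. 0 - v $ i / v $ a)) | _ \<Rightarrow> None)"

text \<open>A vector (y, t) is in the kernel of (A | b) iff A y = - t b, and solutions x correspond
  to kernel vectors (x, -1). If \<open>v\<close> alone spans the kernel and its last coordinate is
  nonzero, scaling it to -1 gives the only solution. Conversely a unique solution x forces the
  kernel to be the line through (x, -1).\<close>

lemma solution_of_kernel:
  fixes A :: "'a::field mat"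
  assumes A: "A \<in> carrier_mat n a" and b: "b \<in> carrier_vec n"
  shows "solution_of_kernel a (kernel_list (hcat A (mat_of_cols n [b]))) =
    unique_solution (\<lambda>x. x \<in> carrier_vec a \<and> A *\<^sub>v x = b)"
proof -
  define vs where "vs = kernel_list (hcat A (mat_of_cols n [b]))"
  let ?ext = "\<lambda>y t. y @\<^sub>v vec 1 (\<lambda>_. t)"
  have B: "mat_of_cols n [b] \<in> carrier_mat n 1" by (simp add: mat_of_cols_def)
  note k = kernel_list[OF hcat_carrier[OF A B], folded vs_def]
  have mult: "hcat A (mat_of_cols n [b]) *\<^sub>v ?ext y t = A *\<^sub>v y + t \<cdot>\<^sub>v b" if "y \<in> carrier_vec a" for y t
  proof -
    have "mat_of_cols n [b] *\<^sub>v vec 1 (\<lambda>_. t) = t \<cdot>\<^sub>v b"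
      using b by (intro eq_vecI) (auto simp: scalar_prod_def mat_of_cols_def)
    then show ?thesis using hcat_mult_vec[OF A B that, of "vec 1 (\<lambda>_. t)"] by simp
  qed
  have ext: "?ext y t \<in> carrier_vec (a + 1)" if "y \<in> carrier_vec a" for y :: "'a vec" and t
    using that by (intro append_carrier_vec) auto
  have dec: "v = ?ext (vec_first v a) (v $ a)" if "v \<in> carrier_vec (a + 1)" for v :: "'a vec"
  proof (rule eq_vecI)
    fix i assume "i < dim_vec (?ext (vec_first v a) (v $ a))"
    then have "i < a \<or> i = a" by auto
    then show "v $ i = ?ext (vec_first v a) (v $ a) $ i" by (auto simp: vec_first_def)
  qed (use that in simp)
  have ker: "v \<in> lspan (a + 1) vs \<longleftrightarrow> v \<in> carrier_vec (a + 1) \<and> A *\<^sub>v vec_first v a + (v $ a) \<cdot>\<^sub>v b = 0\<^sub>v n"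
    for v
    unfolding k(3) using mult[of "vec_first v a" "v $ a"] dec[of v] by auto
  have b0: "b + (- 1) \<cdot>\<^sub>v b = 0\<^sub>v n" using b by (intro eq_vecI) auto
  have neg: "A *\<^sub>v y + t \<cdot>\<^sub>v b = 0\<^sub>v n \<longleftrightarrow> (\<forall>i<n. row A i \<bullet> y = - (t * b $ i))" for y t
    using A b by (auto simp: vec_eq_iff eq_neg_iff_add_eq_0)
  show ?thesis unfolding vs_def[symmetric]
  proof (cases "\<exists>v. vs = [v] \<and> v $ a \<noteq> 0")
    case True
    then obtain v where v: "vs = [v]" "v $ a \<noteq> 0" by blast
    have vc: "v \<in> carrier_vec (a + 1)" using k(1) v by auto
    let ?x = "vec a (\<lambda>i. 0 - v $ i / v $ a)"
    have "unique_solution (\<lambda>x. x \<in> carrier_vec a \<and> A *\<^sub>v x = b) = Some ?x"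
    proof (rule unique_solution_SomeI)
      have "v \<in> lspan (a + 1) vs" using lspan_mem[OF k(1)] v by simp
      then have i: "row A i \<bullet> vec_first v a = - (v $ a * b $ i)" if "i < n" for i
        using ker neg that by blast
      have x: "?x = (- (1 / v $ a)) \<cdot>\<^sub>v vec_first v a"
        by (intro eq_vecI) (auto simp: vec_first_def)
      have "A *\<^sub>v ?x = b" unfolding x
        using A b i v by (intro eq_vecI) auto
      then show "?x \<in> carrier_vec a \<and> A *\<^sub>v ?x = b" by simp
    next
      fix x assume x: "x \<in> carrier_vec a \<and> A *\<^sub>v x = b"
      have "A *\<^sub>v x + (- 1) \<cdot>\<^sub>v b = 0\<^sub>v n" using b0 x by metis
      then have "?ext x (- 1) \<in> lspan (a + 1) vs"
        unfolding k(3) mem_Collect_eq using mult[of x "-1"] ext[of x "-1"] x by presburger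
      then obtain c where c: "?ext x (- 1) = c \<cdot>\<^sub>v v" using v vc by auto
      have "c * v $ a = ?ext x (- 1) $ a" unfolding c using vc by simp
      also have "\<dots> = - 1" using x by auto
      finally have c1: "c = - 1 / v $ a" using v(2) by (simp add: field_simps)
      have "x $ i = - (v $ i / v $ a)" if "i < a" for i
      proof -
        have "x $ i = ?ext x (- 1) $ i" using that x by auto
        also have "\<dots> = c * v $ i" unfolding c using vc that by simp
        finally show ?thesis using c1 by simp
      qed
      then show "x = ?x" using x by (intro eq_vecI) auto
    qed
    then show "solution_of_kernel a vs = unique_solution (\<lambda>x. x \<in> carrier_vec a \<and> A *\<^sub>v x = b)"
      using v by (simp add: solution_of_kernel_def)
  next
    case False
    have "\<not> (\<exists>!x. x \<in> carrier_vec a \<and> A *\<^sub>v x = b)"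
    proof
      assume "\<exists>!x. x \<in> carrier_vec a \<and> A *\<^sub>v x = b"
      then obtain x where x: "x \<in> carrier_vec a" "A *\<^sub>v x = b"
        "\<And>y. y \<in> carrier_vec a \<Longrightarrow> A *\<^sub>v y = b \<Longrightarrow> y = x" by blast
      define e where "e = ?ext x (- 1)"
      have ec: "e \<in> carrier_vec (a + 1)" unfolding e_def using ext x(1) by blast
      have ea: "e $ a = - 1" "\<And>i. i < a \<Longrightarrow> e $ i = x $ i" unfolding e_def using x(1) by auto
      have "A *\<^sub>v x + (- 1) \<cdot>\<^sub>v b = 0\<^sub>v n" using b0 x by metis
      then have e: "e \<in> lspan (a + 1) vs"
        unfolding k(3) e_def mem_Collect_eq using mult[of x "-1"] ext[of x "-1"] x(1,2) by presburger
      have line: "v = (- (v $ a)) \<cdot>\<^sub>v e" if v: "v \<in> lspan (a + 1) vs" for v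
      proof -
        \<comment> \<open>A kernel vector (y, t) yields the further solution x + (y + t x);
          uniqueness gives y = - t x, so (y, t) is a multiple of (x, -1).\<close>
        let ?y = "x + (vec_first v a + (v $ a) \<cdot>\<^sub>v x)"
        have vk: "v \<in> carrier_vec (a + 1)" "\<forall>i<n. row A i \<bullet> vec_first v a = - (v $ a * b $ i)"
          using v ker neg by blast+
        have ax: "row A i \<bullet> x = b $ i" if "i < n" for i
          using arg_cong[OF x(2), of "\<lambda>z. z $ i"] that A by simp
        have "row A i \<bullet> ?y = b $ i" if "i < n" for i
          using that A x(1) vk(2) ax
          by (simp add: scalar_prod_add_distrib[of _ a])
        then have "A *\<^sub>v ?y = b" using A b by (intro eq_vecI) auto
        then have "?y = x" using x(1) by (intro x(3)) auto
        then have yx: "?y $ i = x $ i" for i by simp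
        have "v $ i = - (v $ a) * x $ i" if "i < a" for i
        proof -
          have "?y $ i = x $ i + (v $ i + v $ a * x $ i)"
            using that x(1) by (simp add: vec_first_def)
          then show ?thesis using yx[of i] by (simp add: eq_neg_iff_add_eq_0)
        qed
        then show ?thesis using vk(1) ec ea by (intro eq_vecI) (auto simp: less_Suc_eq)
      qed
      have ne: "e \<noteq> 0\<^sub>v (a + 1)" using ea(1) by auto
      have single: "set [e] \<subseteq> carrier_vec (a + 1)" "indep (a + 1) [e]" using ec ne by auto
      have "lspan (a + 1) vs = lspan (a + 1) [e]"
      proof (intro equalityI subsetI)
        fix v assume "v \<in> lspan (a + 1) vs"
        then have "v = (- (v $ a)) \<cdot>\<^sub>v e" by (rule line)
        moreover have "(- (v $ a)) \<cdot>\<^sub>v e \<in> lspan (a + 1) [e]"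
          by (rule lspan_smult[OF single(1) lspan_mem[OF single(1)]]) simp
        ultimately show "v \<in> lspan (a + 1) [e]" by metis
      next
        fix v assume "v \<in> lspan (a + 1) [e]"
        then show "v \<in> lspan (a + 1) vs" using lspan_smult[OF k(1) e] ec by auto
      qed
      then have "length vs = length [e]"
        unfolding lspan_eq_mat_image[OF single(1)]
        by (rule indep_length[OF k(1,2) _ mat_of_cols_carrier(1) inj_mat_mat_of_cols[OF single]])
      then obtain v where v: "vs = [v]" by (auto simp: length_Suc_conv)
      then have "v $ a = 0" using False by auto
      then have "v = 0\<^sub>v (a + 1)" using line[OF lspan_mem[OF k(1)], of v] v ec by auto
      then show False using k(2) v by simp
    qed
    then show "solution_of_kernel a vs = unique_solution (\<lambda>x. x \<in> carrier_vec a \<and> A *\<^sub>v x = b)"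
      using False by (auto simp: solution_of_kernel_def unique_solution_eq_None[symmetric] split: list.splits)
  qed
qed

lemma mult_mat_eq_iff:
  assumes "A \<in> carrier_mat n a" "B \<in> carrier_mat n k" "X \<in> carrier_mat a k"
  shows "A * X = B \<longleftrightarrow> (\<forall>j<k. A *\<^sub>v col X j = col B j)"
proof
  assume "A * X = B"
  then show "\<forall>j<k. A *\<^sub>v col X j = col B j" using col_mult2[OF assms(1,3)] by metis
next
  assume h: "\<forall>j<k. A *\<^sub>v col X j = col B j"
  show "A * X = B"
  proof (rule mat_col_eqI)
    fix j assume "j < dim_col B"
    then show "col (A * X) j = col B j" using h col_mult2[OF assms(1,3)] assms(2) by simp
  qed (use assms in auto)
qed

text \<open>The columns of the unknown matrix are independent of each other. An unsolvable column
  makes the whole system unsolvable, and a second solution in one column gives a second solution of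
  the whole.\<close>

lemma unique_solution_columns:
  assumes A: "A \<in> carrier_mat n a" and B: "B \<in> carrier_mat n k"
  shows "unique_solution (\<lambda>X. X \<in> carrier_mat a k \<and> A * X = B) =
    map_option (mat_of_cols a) (map_opt
      (\<lambda>j. unique_solution (\<lambda>x. x \<in> carrier_vec a \<and> A *\<^sub>v x = col B j)) [0..<k])"
    (is "_ = map_option _ (map_opt ?g _)")
proof (cases "\<forall>j<k. ?g j \<noteq> None")
  case True
  define x where "x j = the (?g j)" for j
  have "?g j = Some (x j)" if "j < k" for j using True that by (simp add: x_def)
  then have x: "x j \<in> carrier_vec a" "A *\<^sub>v x j = col B j"
    "\<And>y. y \<in> carrier_vec a \<Longrightarrow> A *\<^sub>v y = col B j \<Longrightarrow> y = x j" if "j < k" for j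
    using that unfolding unique_solution_eq_Some by blast+
  define X where "X = mat_of_cols a (map x [0..<k])"
  have X: "X \<in> carrier_mat a k"
    using mat_of_cols_carrier(1)[of a "map x [0..<k]"] by (simp add: X_def)
  have colX: "col X j = x j" if "j < k" for j
    unfolding X_def using x(1)[OF that] that by (subst col_mat_of_cols) auto
  have "unique_solution (\<lambda>X. X \<in> carrier_mat a k \<and> A * X = B) = Some X"
  proof (rule unique_solution_SomeI)
    show "X \<in> carrier_mat a k \<and> A * X = B"
      unfolding mult_mat_eq_iff[OF A B X] using X x(2) colX by simp
    fix Y assume Y: "Y \<in> carrier_mat a k \<and> A * Y = B"
    then have "\<forall>j<k. A *\<^sub>v col Y j = col B j" using mult_mat_eq_iff[OF A B] by blast
    then have "col Y j = col X j" if "j < k" for j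
      using x(3)[OF that, of "col Y j"] that Y colX by auto
    then show "Y = X" using X Y by (intro mat_col_eqI) auto
  qed
  moreover have "map_opt ?g [0..<k] = Some (map x [0..<k])"
    using True unfolding map_opt_eq by (auto simp: x_def)
  ultimately show ?thesis by (simp add: X_def)
next
  case False
  then obtain j where j: "j < k" "?g j = None" by blast
  have "\<not> (\<exists>!X. X \<in> carrier_mat a k \<and> A * X = B)"
  proof
    assume "\<exists>!X. X \<in> carrier_mat a k \<and> A * X = B"
    then obtain X where X: "X \<in> carrier_mat a k" "A * X = B"
      "\<And>Y. Y \<in> carrier_mat a k \<Longrightarrow> A * Y = B \<Longrightarrow> Y = X" by blast
    have cols: "\<forall>l<k. A *\<^sub>v col X l = col B l" using X mult_mat_eq_iff[OF A B X(1)] by blast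
    have "col X j \<in> carrier_vec a" using X(1) by auto
    then obtain y where y: "y \<in> carrier_vec a" "A *\<^sub>v y = col B j" "y \<noteq> col X j"
      using j cols unfolding unique_solution_eq_None by blast
    \<comment> \<open>\<open>X\<close> with column \<open>j\<close> exchanged for the other solution
      \<open>y\<close>.\<close>
    define Y where "Y = mat a k (\<lambda>(i, l). if l = j then y $ i else X $$ (i, l))"
    have Y: "Y \<in> carrier_mat a k" by (simp add: Y_def)
    have colY: "col Y l = (if l = j then y else col X l)" if "l < k" for l
      using that y X(1) by (intro eq_vecI) (auto simp: Y_def)
    have "A * Y = B" unfolding mult_mat_eq_iff[OF A B Y] using cols y colY by simp
    then have "Y = X" using X(3) Y by blast
    then show False using colY[OF j(1)] y(3) by simp
  qed
  moreover have "map_opt ?g [0..<k] = None"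
    using j unfolding map_opt_eq by auto
  ultimately show ?thesis by (simp add: unique_solution_eq_None[symmetric])
qed

section \<open>Correctness of the linear algebra programs\<close>

definition pval :: "'k list \<Rightarrow> reg list \<times> reg \<Rightarrow> 'k vec \<times> 'k \<Rightarrow> bool" where
  "pval mem p q \<longleftrightarrow> vval mem (fst p) (fst q) \<and> val mem (snd p) (snd q)"

lemma persistent_pval: "persistent pval"
  by (auto simp: persistent_def pval_def intro: vval_prefix val_prefix)

lemma persistent_conj: "persistent R \<Longrightarrow> persistent (\<lambda>m x y. R m x y \<and> P x y)"
  by (auto simp: persistent_def)

lemma implements_sub_multiple:
  assumes "val mem c k" "vval mem w u" "vval mem v z" "dim_vec u = dim_vec z"
  shows "implements vval (sub_multiple_prog c w v) mem
    (Some (u - k \<cdot>\<^sub>v z))"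
proof -
  define Q :: "'a list \<Rightarrow> reg \<times> reg \<Rightarrow> 'a \<times> 'a \<Rightarrow> bool"
    where "Q = (\<lambda>m p q. val m (fst p) (fst q) \<and> val m (snd p) (snd q))"
  have Q: "persistent Q" by (auto simp: persistent_def Q_def intro: val_prefix)
  have zip: "list_all2 (Q mem) (zip w v) (zip (list_of_vec u) (list_of_vec z))"
    using assms(2-4) unfolding vval_def Q_def by (auto simp: list_all2_conv_all_nth)
  have "implements (\<lambda>m. list_all2 (val m))
      (sub_multiple_prog c w v) mem
      (Some (map (\<lambda>(x, y). x - k * y) (zip (list_of_vec u) (list_of_vec z))))"
  proof (rule implements_map_prog_total[OF zip Q persistent_val])
    fix p q m assume m: "prefix mem m" "Q m p q"
    obtain x y x' y' where p: "p = (x, y)" "q = (x', y')" by force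
    have "implements val (prog_bind (arith Times c y) (arith Minus x)) m (Some (x' - k * y'))"
    proof (rule implements_bind_Some[OF implements_arith])
      show "val m c k" using val_prefix[OF assms(1) m(1)] .
      show "val m y y'" using m p by (simp add: Q_def)
      fix t m' assume m': "prefix m m'" "val m' t (arith_op Times k y')"
      have "val m' x x'" using m m' p val_prefix by (auto simp: Q_def)
      from implements_arith[OF this m'(2), of Minus]
      show "implements val (arith Minus x t) m' (Some (x' - k * y'))" by simp
    qed
    then show "implements val (case p of (x, y) \<Rightarrow> prog_bind (arith Times c y) (arith Minus x)) m
        (Some (case q of (x, y) \<Rightarrow> x - k * y))" using p by simp
  qed
  moreover have "map (\<lambda>(x, y). x - k * y) (zip (list_of_vec u) (list_of_vec z)) = list_of_vec (u - k \<cdot>\<^sub>v z)"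
    using assms(4) by (intro nth_equalityI) (auto simp: list_of_vec_index)
  ultimately show ?thesis unfolding implements_def vval_def by (auto split: option.splits)
qed

text \<open>The common dimension ensures that \<open>zip w v\<close> in the update of
  \<open>w\<close> loses no coordinate.\<close>

lemma implements_eliminate:
  assumes "consts_loaded mem" "list_all2 (pval mem) ps qs" "\<forall>q\<in>set qs. dim_vec (fst q) = m"
  shows "implements (\<lambda>m. list_all2 (vval m)) (eliminate ps) mem (Some (elim qs))"
  using assms
proof (induction ps arbitrary: qs mem)
  case Nil
  then show ?case by (auto intro: implements_Return)
next
  case (Cons p ps)
  obtain v s where p: "p = (v, s)" by force
  obtain v' s' qs' where qs: "qs = (v', s') # qs'" and pv: "pval mem p (v', s')"
    and rest: "list_all2 (pval mem) ps qs'"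
    using Cons.prems(2) by (auto simp: list_all2_Cons1)
  then have vs: "vval mem v v'" "val mem s s'" using p by (auto simp: pval_def)
  show ?case unfolding p eliminate.simps
  proof (rule implements_bind_Some[OF implements_test_eq[OF vs(2)]])
    show "val mem zero_reg 0" using Cons.prems(1) by (simp add: consts_loaded_def)
    fix z m1 assume m1: "prefix mem m1" "z = (s' = 0)"
    have rest1: "list_all2 (pval m1) ps qs'"
      using persistentD[OF persistent_list_all2[OF persistent_pval] rest m1(1)] .
    have c1: "consts_loaded m1" using consts_loaded_prefix Cons.prems(1) m1(1) .
    show "implements (\<lambda>m. list_all2 (vval m))
        (if z then prog_bind (eliminate ps) (\<lambda>vs. Return (v # vs))
         else map_prog (reduce_prog s v) ps) m1 (Some (elim qs))"
    proof (cases "s' = 0")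
      case True
      have "implements (\<lambda>m. list_all2 (vval m)) (prog_bind (eliminate ps) (\<lambda>vs. Return (v # vs))) m1
          (Some (v' # elim qs'))"
      proof (rule implements_bind_Some[OF Cons.IH[OF c1 rest1]])
        show "\<forall>q\<in>set qs'. dim_vec (fst q) = m" using Cons.prems(3) qs by simp
        fix ws m2 assume "prefix m1 m2" "list_all2 (vval m2) ws (elim qs')"
        then show "implements (\<lambda>m. list_all2 (vval m)) (Return (v # ws)) m2 (Some (v' # elim qs'))"
          using vval_prefix[OF vval_prefix[OF vs(1) m1(1)]] by (intro implements_Return) auto
      qed
      then show ?thesis using True m1 qs by simp
    next
      case False
      \<comment> \<open>Membership in \<open>qs'\<close> is carried along so that the dimension of
        each vector is known inside the map.\<close>
      have rest2: "list_all2 (\<lambda>p q. pval m1 p q \<and> q \<in> set qs') ps qs'"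
        using rest1 by (auto simp: list_all2_conv_all_nth)
      have "implements (\<lambda>m. list_all2 (vval m))
        (map_prog (reduce_prog s v) ps) m1
        (Some (map (\<lambda>(w, t). w - (t / s') \<cdot>\<^sub>v v') qs'))"
      proof (rule implements_map_prog_total[OF rest2 persistent_conj[OF persistent_pval] persistent_vval])
        fix a b m2 assume m2: "prefix m1 m2" "pval m2 a b \<and> b \<in> set qs'"
        obtain w t w' t' where ab: "a = (w, t)" "b = (w', t')" by force
        have w: "vval m2 w w'" "val m2 t t'" "dim_vec w' = dim_vec v'"
          using m2 ab Cons.prems(3) qs by (auto simp: pval_def)
        have "prefix mem m2" using m1 m2 by auto
        then have v: "vval m2 v v'" "val m2 s s'" using vval_prefix[OF vs(1)] val_prefix[OF vs(2)] by simp_all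
        have "implements vval (prog_bind (arith Divide t s) (\<lambda>c.
           sub_multiple_prog c w v)) m2
           (Some (w' - (t' / s') \<cdot>\<^sub>v v'))"
        proof (rule implements_bind_Some[OF implements_arith[OF w(2) v(2)]])
          fix c m3 assume "prefix m2 m3" "val m3 c (arith_op Divide t' s')"
          then show "implements vval (sub_multiple_prog c w v)
            m3 (Some (w' - (t' / s') \<cdot>\<^sub>v v'))"
            using w(3) vval_prefix[OF w(1)] vval_prefix[OF v(1)] by (intro implements_sub_multiple) auto
        qed
        then show "implements vval (reduce_prog s v a) m2
           (Some (case b of (w, t) \<Rightarrow> w - (t / s') \<cdot>\<^sub>v v'))" using ab by simp
      qed
      then show ?thesis using False m1 qs by simp
    qed
  qed
qed

lemma dim_vec_elim:
  "\<forall>q\<in>set qs. dim_vec (fst q) = m \<Longrightarrow> w \<in> set (elim qs) \<Longrightarrow> dim_vec w = m"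
  by (induction qs rule: elim.induct) (auto split: if_splits)

lemma implements_kernel_rows:
  assumes "consts_loaded mem" "list_all2 (vval mem) as bs" "list_all2 (vval mem) vs ws"
    "\<forall>b\<in>set bs. dim_vec b = m" "\<forall>w\<in>set ws. dim_vec w = m"
  shows "implements (\<lambda>m. list_all2 (vval m)) (kernel_rows as vs) mem (Some (kern bs ws))"
  using assms
proof (induction as arbitrary: bs vs ws mem)
  case Nil
  then show ?case by (auto intro: implements_Return)
next
  case (Cons a as)
  obtain b bs' where bs: "bs = b # bs'" and ab: "vval mem a b" "list_all2 (vval mem) as bs'"
    using Cons.prems(2) by (auto simp: list_all2_Cons1)
  have ws2: "list_all2 (\<lambda>v w. vval mem v w \<and> dim_vec w = m) vs ws"
    using Cons.prems(3,5) by (auto simp: list_all2_conv_all_nth)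
  show ?case unfolding kernel_rows.simps bs
  proof (rule implements_bind_Some)
    show "implements (\<lambda>m. list_all2 (val m)) (map_prog (dot_prog a) vs) mem (Some (map (\<lambda>w. b \<bullet> w) ws))"
    proof (rule implements_map_prog_total[OF ws2 persistent_conj[OF persistent_vval] persistent_val])
      fix v w m1 assume m1: "prefix mem m1" "vval m1 v w \<and> dim_vec w = m"
      show "implements val (dot_prog a v) m1 (Some (b \<bullet> w))"
        using m1 consts_loaded_prefix[OF Cons.prems(1) m1(1)] vval_prefix[OF ab(1) m1(1)] Cons.prems(4) bs
        by (intro implements_scalar_prod) auto
    qed
    fix ss m1 assume m1: "prefix mem m1" "list_all2 (val m1) ss (map (\<lambda>w. b \<bullet> w) ws)"
    have c1: "consts_loaded m1" using consts_loaded_prefix Cons.prems(1) m1(1) .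
    have vs1: "list_all2 (vval m1) vs ws"
      using persistentD[OF persistent_list_all2[OF persistent_vval] Cons.prems(3) m1(1)] .
    let ?qs = "map (\<lambda>w. (w, b \<bullet> w)) ws"
    have d: "\<forall>q\<in>set ?qs. dim_vec (fst q) = m" using Cons.prems(5) by auto
    have "list_all2 (pval m1) (zip vs ss) ?qs"
      using vs1 m1(2) by (auto simp: list_all2_conv_all_nth pval_def)
    from implements_eliminate[OF c1 this d]
    show "implements (\<lambda>m. list_all2 (vval m)) (prog_bind (eliminate (zip vs ss)) (kernel_rows as)) m1
        (Some (kern (b # bs') ws))"
    proof (rule implements_bind_Some)
      fix vs' m2 assume m2: "prefix m1 m2" "list_all2 (vval m2) vs' (elim ?qs)"
      have "prefix mem m2" using m1 m2 by auto
      then have "list_all2 (vval m2) as bs'"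
        using persistentD[OF persistent_list_all2[OF persistent_vval] ab(2)] by blast
      then show "implements (\<lambda>m. list_all2 (vval m)) (kernel_rows as vs') m2 (Some (kern (b # bs') ws))"
        unfolding kern.simps
        using m2 consts_loaded_prefix[OF c1 m2(1)] Cons.prems(4) bs dim_vec_elim[OF d]
        by (intro Cons.IH) auto
    qed
  qed
qed

lemma implements_kernel:
  assumes "consts_loaded mem" "mval mem M A"
  shows "implements (\<lambda>m. list_all2 (vval m)) (kernel_prog M) mem (Some (kernel_list A))"
  unfolding kernel_prog_def kernel_list_def
proof (rule implements_kernel_rows[OF assms(1)])
  have d: "dim_row M = dim_row A" "dim_col M = dim_col A" using assms(2) by (auto simp: mval_def)
  show "list_all2 (vval mem) (map list_of_vec (rows M)) (rows A)"
    using vval_row[OF assms(2)] d by (auto simp: list_all2_conv_all_nth)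
  have c: "val mem zero_reg 0" "val mem one_reg 1" using assms(1) by (auto simp: consts_loaded_def)
  show "list_all2 (vval mem) (map (\<lambda>i. map (\<lambda>j. if i = j then one_reg else zero_reg) [0..<dim_col M])
      [0..<dim_col M]) (map (unit_vec (dim_col A)) [0..<dim_col A])"
    unfolding d using c by (auto simp: list_all2_conv_all_nth vval_def list_of_vec_index)
  show "\<forall>b\<in>set (rows A). dim_vec b = dim_col A" by (auto simp: rows_def)
qed auto

lemma mval_mat_of_cols_list:
  assumes "list_all2 (vval mem) ls vs" "set vs \<subseteq> carrier_vec m"
  shows "mval mem (mat_of_cols_list m ls) (mat_of_cols m vs)"
proof -
  have len: "length ls = length vs" using assms(1) by (rule list_all2_lengthD)
  have "val mem (ls ! j ! i) (vs ! j $ i)" if "j < length vs" "i < m" for i j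
  proof -
    have "vval mem (ls ! j) (vs ! j)" using assms(1) that by (auto simp: list_all2_conv_all_nth)
    moreover have "dim_vec (vs ! j) = m" using assms(2) that by (metis carrier_vecD nth_mem subsetD)
    ultimately show ?thesis using that by (auto simp: vval_def list_all2_conv_all_nth list_of_vec_index)
  qed
  then show ?thesis by (auto simp: mval_def mat_of_cols_list_def mat_of_cols_def len)
qed

lemma implements_kernel_mat:
  assumes "consts_loaded mem" "mval mem M A"
  shows "implements mval (kernel_mat_prog M) mem (Some (kernel_mat A))"
  unfolding kernel_mat_prog_def
proof (rule implements_bind_Some[OF implements_kernel[OF assms]])
  fix vs m1 assume "list_all2 (vval m1) vs (kernel_list A)"
  then show "implements mval (Return (mat_of_cols_list (dim_col M) vs)) m1 (Some (kernel_mat A))"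
    using mval_mat_of_cols_list[of m1 vs "kernel_list A" "dim_col A"] kernel_list(1)[of A "dim_row A" "dim_col A"] assms(2)
    by (intro implements_Return) (auto simp: kernel_mat_def mval_def)
qed

lemma implements_image_inter:
  assumes "consts_loaded mem" "mval mem M A" "mval mem N B" "A \<in> carrier_mat n a" "B \<in> carrier_mat n b"
  shows "implements mval (image_inter_prog M N) mem (Some (image_inter_mat A B))"
  unfolding image_inter_prog_def image_inter_mat_def using assms
  by - (rule implements_bind_Some implements_kernel_mat mval_transpose mval_hcat
      | assumption | (rule mval_prefix[rotated] consts_loaded_prefix[rotated], assumption)
      | simp add: kernel_mat_def)+

text \<open>The continuation may assume that the abstract value solves \<open>P\<close>; this
  supplies the carrier and equation facts that the later steps rely on.\<close>

lemma implements_bind_unique: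
  assumes "implements R p mem (unique_solution P)"
    and "\<And>x y mem'. prefix mem mem' \<Longrightarrow> P y \<Longrightarrow> R mem' x y \<Longrightarrow> implements S (f x) mem' (g y)"
  shows "implements S (prog_bind p f) mem (Option.bind (unique_solution P) g)"
proof -
  have "implements (\<lambda>m x y. R m x y \<and> P y) p mem (unique_solution P)"
    using assms(1) unique_solution_eq_Some[of P] by (auto simp: implements_def split: option.splits)
  then show ?thesis by (rule implements_bind) (use assms(2) in blast)
qed

lemma implements_map:
  assumes "implements R p mem r" and "\<And>m x y. R m x y \<Longrightarrow> S m (f x) (g y)"
  shows "implements S (prog_bind p (\<lambda>x. Return (f x))) mem (map_option g r)"
proof -
  have "map_option g r = Option.bind r (\<lambda>y. Some (g y))" by (cases r) auto
  then show ?thesis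
    using implements_bind[OF assms(1), of S "\<lambda>x. Return (f x)" "\<lambda>y. Some (g y)"] assms(2)
    by (simp add: implements_Return)
qed

lemma implements_solution_of_kernel:
  assumes "consts_loaded mem" "list_all2 (vval mem) vs ws" "set ws \<subseteq> carrier_vec (a + 1)"
  shows "implements vval (unique_kernel_prog vs) mem (solution_of_kernel a ws)"
proof (cases "\<exists>w. ws = [w]")
  case False
  then have "\<nexists>v. vs = [v]" using assms(2) by (auto simp: list_all2_Cons1)
  then show ?thesis using False
    by (auto simp: solution_of_kernel_def implements_Reject split: list.splits)
next
  case True
  then obtain w where w: "ws = [w]" by blast
  then obtain v where v: "vs = [v]" "vval mem v w" using assms(2) by (auto simp: list_all2_Cons2)
  have wc: "dim_vec w = a + 1" using assms(3) w by auto
  have len: "length v = a + 1" using v(2) wc by (auto simp: vval_def dest: list_all2_lengthD)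
  have vi: "val mem (v ! i) (w $ i)" if "i < a + 1" for i
    using v(2) that wc by (auto simp: vval_def list_all2_conv_all_nth list_of_vec_index)
  have last: "val mem (last v) (w $ a)"
    using vi[of a] len by (metis add_diff_cancel_right' last_conv_nth less_add_one list.size(3) not_less_zero)
  have but: "list_all2 (val mem) (butlast v) (map (($) w) [0..<a])"
    using vi len by (auto simp: list_all2_conv_all_nth nth_butlast)
  have "implements vval (normalize_test_prog v)
      mem (if w $ a = 0 then None else Some (vec a (\<lambda>i. 0 - w $ i / w $ a)))"
  proof (rule implements_bind_Some[OF implements_test_eq[OF last]])
    show "val mem zero_reg 0" using assms(1) by (simp add: consts_loaded_def)
    fix z m1 assume m1: "prefix mem m1" "z = (w $ a = 0)"
    have "implements (\<lambda>m. list_all2 (val m))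
        (normalize_prog v) m1
        (Some (map (\<lambda>y. 0 - y / w $ a) (map (($) w) [0..<a])))"
    proof (rule implements_map_prog_total[OF _ persistent_val persistent_val])
      show "list_all2 (val m1) (butlast v) (map (($) w) [0..<a])"
        using persistentD[OF persistent_list_all2[OF persistent_val] but m1(1)] .
      fix x y m2 assume m2: "prefix m1 m2" "val m2 x y"
      have p: "prefix mem m2" using m1 m2 by auto
      then have c: "val m2 (last v) (w $ a)" "val m2 zero_reg 0"
        using val_prefix[OF last] consts_loaded_prefix[OF assms(1)] by (auto simp: consts_loaded_def)
      have eq: "0 - y / w $ a = arith_op Minus 0 (arith_op Divide y (w $ a))" by simp
      show "implements val (prog_bind (arith Divide x (last v)) (arith Minus zero_reg)) m2
          (Some (0 - y / w $ a))"
        unfolding eq using m2 c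
        by - (rule implements_bind_Some implements_arith | assumption | (rule val_prefix[rotated], assumption))+
    qed
    moreover have "map (\<lambda>y. 0 - y / w $ a) (map (($) w) [0..<a]) = list_of_vec (vec a (\<lambda>i. 0 - w $ i / w $ a))"
      by (intro nth_equalityI) (auto simp: list_of_vec_index)
    ultimately have "implements vval
        (normalize_prog v) m1
        (Some (vec a (\<lambda>i. 0 - w $ i / w $ a)))"
      unfolding implements_def vval_def by (auto simp: o_def split: option.splits)
    then show "implements vval (if z then Reject
        else normalize_prog v) m1
        (if w $ a = 0 then None else Some (vec a (\<lambda>i. 0 - w $ i / w $ a)))"
      using m1 by (simp add: implements_Reject)
  qed
  then show ?thesis unfolding v w by (simp add: solution_of_kernel_def)
qed

lemma implements_solve:
  assumes "consts_loaded mem" "mval mem M A" "mval mem N B"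
    "A \<in> carrier_mat n a" "B \<in> carrier_mat n k"
  shows "implements mval (solve_prog M N) mem (unique_solution (\<lambda>X. X \<in> carrier_mat a k \<and> A * X = B))"
proof -
  have d: "dim_row M = n" "dim_col M = a" "dim_row N = n" "dim_col N = k"
    using assms by (auto simp: mval_def)
  let ?g = "\<lambda>j. unique_solution (\<lambda>x. x \<in> carrier_vec a \<and> A *\<^sub>v x = col B j)"
  \<comment> \<open>The relation also records the length of each solution, which is required for
    assembling the columns into a matrix.\<close>
  have P: "implements (\<lambda>m. list_all2 (\<lambda>l x. vval m l x \<and> x \<in> carrier_vec a)) (map_prog (\<lambda>j. prog_bind
      (kernel_prog (hcat M (mat_of_cols n [col N j]))) unique_kernel_prog) [0..<k]) mem (map_opt ?g [0..<k])"
  proof (rule implements_map_prog_upt[OF persistent_conj[OF persistent_vval]])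
    fix j m1 assume j: "j < k" and m1: "prefix mem m1"
    have c1: "consts_loaded m1" using consts_loaded_prefix assms(1) m1 .
    have b: "col B j \<in> carrier_vec n" using assms(5) by auto
    have "mval m1 (mat_of_cols n [col N j]) (mat_of_cols n [col B j])"
      using mval_prefix[OF assms(3) m1] j assms(5) by (auto simp: mval_def mat_of_cols_def)
    then have h: "mval m1 (hcat M (mat_of_cols n [col N j])) (hcat A (mat_of_cols n [col B j]))"
      using assms(4) by (intro mval_hcat[OF mval_prefix[OF assms(2) m1]]) auto
    have hc: "hcat A (mat_of_cols n [col B j]) \<in> carrier_mat n (a + 1)"
      by (rule hcat_carrier[OF assms(4)]) (simp add: mat_of_cols_def)
    have "implements vval (prog_bind
        (kernel_prog (hcat M (mat_of_cols n [col N j]))) unique_kernel_prog) m1 (?g j)"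
      unfolding solution_of_kernel[OF assms(4) b, symmetric]
      by (rule implements_bind_Some[OF implements_kernel[OF c1 h]], rule implements_solution_of_kernel)
        (use consts_loaded_prefix[OF c1] kernel_list(1)[OF hc] in auto)
    then show "implements (\<lambda>m l x. vval m l x \<and> x \<in> carrier_vec a) (prog_bind
        (kernel_prog (hcat M (mat_of_cols n [col N j]))) unique_kernel_prog) m1 (?g j)"
      using unique_solution_eq_Some[of "\<lambda>x. x \<in> carrier_vec a \<and> A *\<^sub>v x = col B j"]
      by (auto simp: implements_def split: option.splits)
  qed
  show ?thesis unfolding solve_prog_def d unique_solution_columns[OF assms(4,5)]
  proof (rule implements_map[OF P])
    fix m ls vs assume h: "list_all2 (\<lambda>l x. vval m l x \<and> x \<in> carrier_vec a) ls vs"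
    then have "list_all2 (vval m) ls vs" by (rule list_all2_mono) simp
    moreover have "set vs \<subseteq> carrier_vec a" using h by (auto simp: list_all2_conv_all_nth set_conv_nth)
    ultimately show "mval m (mat_of_cols_list a ls) (mat_of_cols a vs)" by (rule mval_mat_of_cols_list)
  qed
qed

section \<open>Left division, decompositions and paired systems\<close>

lemma unique_solution_transpose:
  fixes C :: "'a::field mat"
  assumes "C \<in> carrier_mat d k" "N \<in> carrier_mat n k"
  shows "unique_solution (\<lambda>B. B \<in> carrier_mat n d \<and> B * C = N) =
    map_option transpose_mat
      (unique_solution (\<lambda>X. X \<in> carrier_mat d n \<and> transpose_mat C * X = transpose_mat N))"
proof (rule unique_solution_transfer)
  fix X assume X: "X \<in> carrier_mat d n \<and> transpose_mat C * X = transpose_mat N"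
  then have "transpose_mat (transpose_mat C * X) = N" by simp
  then show "transpose_mat X \<in> carrier_mat n d \<and> transpose_mat X * C = N"
    using X assms transpose_mult[of "transpose_mat C" k d X n] by simp
next
  fix B assume "B \<in> carrier_mat n d \<and> B * C = N"
  then show "\<exists>X. (X \<in> carrier_mat d n \<and> transpose_mat C * X = transpose_mat N) \<and> transpose_mat X = B"
    using assms transpose_mult[of B n d C k] by (intro exI[of _ "transpose_mat B"]) auto
next
  fix X X' :: "'a mat" assume "transpose_mat X = transpose_mat X'"
  then show "X = X'" by (metis transpose_transpose)
qed

lemma implements_solve_left:
  assumes "consts_loaded mem" "mval mem M C" "mval mem L N" "C \<in> carrier_mat d k" "N \<in> carrier_mat n k"
  shows "implements mval (solve_left_prog M L) mem (unique_solution (\<lambda>B. B \<in> carrier_mat n d \<and> B * C = N))"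
  unfolding solve_left_prog_def unique_solution_transpose[OF assms(4,5)]
  by (rule implements_map[OF implements_solve[of _ _ _ _ _ k]])
    (use assms in \<open>auto intro: mval_transpose\<close>)

lemma upper_lower_rows_carrier:
  assumes "S \<in> carrier_mat (u + w) k"
  shows "upper_rows u S \<in> carrier_mat u k" "lower_rows u S \<in> carrier_mat w k"
  using assms by (auto simp: upper_rows_def lower_rows_def)

lemma upper_lower_rows_eqI:
  assumes "S \<in> carrier_mat (u + w) k" "S' \<in> carrier_mat (u + w) k"
    "upper_rows u S = upper_rows u S'" "lower_rows u S = lower_rows u S'"
  shows "S = S'"
proof (rule eq_matI)
  fix i j assume "i < dim_row S'" "j < dim_col S'"
  then have ij: "i < u + w" "j < k" using assms by auto
  show "S $$ (i, j) = S' $$ (i, j)"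
  proof (cases "i < u")
    case True
    then show ?thesis using arg_cong[OF assms(3), of "\<lambda>X. X $$ (i, j)"] assms(1,2) ij
      by (auto simp: upper_rows_def)
  next
    case False
    then show ?thesis using arg_cong[OF assms(4), of "\<lambda>X. X $$ (i - u, j)"] assms(1,2) ij
      by (auto simp: lower_rows_def)
  qed
qed (use assms in auto)

lemma exists_stacked_rows:
  assumes "G \<in> carrier_mat u k" "H \<in> carrier_mat w k"
  shows "\<exists>S\<in>carrier_mat (u + w) k. upper_rows u S = G \<and> lower_rows u S = H"
  using assms
  by (intro bexI[of _ "mat (u + w) k (\<lambda>(i, j). if i < u then G $$ (i, j) else H $$ (i - u, j))"])
    (auto simp: upper_rows_def lower_rows_def)

text \<open>\<open>S\<close> stacks the coordinates of \<open>P\<close> in the columns of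
  \<open>U\<close> over those of \<open>- Q\<close> in the columns of \<open>W\<close>. As
  \<open>U\<close> and \<open>W\<close> are injective, coordinates and pairs \<open>(P, Q)\<close>
  determine each other; uniqueness is transferred here, not asserted.\<close>

lemma unique_solution_decompose:
  assumes U: "U \<in> carrier_mat n u" "inj_mat U" and W: "W \<in> carrier_mat n w" "inj_mat W"
    and M: "M \<in> carrier_mat n k"
  shows "unique_solution (\<lambda>(P, Q). P \<in> carrier_mat n k \<and> Q \<in> carrier_mat n k \<and> M = P - Q \<and>
      mat_image P \<subseteq> mat_image U \<and> mat_image Q \<subseteq> mat_image W) =
    map_option (\<lambda>S. (U * upper_rows u S, - (W * lower_rows u S)))
      (unique_solution (\<lambda>S. S \<in> carrier_mat (u + w) k \<and> hcat U W * S = M))"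
proof (rule unique_solution_transfer)
  fix S assume S: "S \<in> carrier_mat (u + w) k \<and> hcat U W * S = M"
  then have S': "S \<in> carrier_mat (u + w) k" by blast
  note c = upper_lower_rows_carrier[OF S']
  have "M = U * upper_rows u S + W * lower_rows u S" using hcat_mult[OF U(1) W(1) S'] S by simp
  then have "M = U * upper_rows u S - - (W * lower_rows u S)" using U W c by (intro eq_matI) auto
  moreover have "mat_image (U * upper_rows u S) \<subseteq> mat_image U"
    using mat_image_subset_iff[of "U * upper_rows u S" n k U u] U(1) c(1) by auto
  moreover have neg: "- (W * lower_rows u S) = W * (- lower_rows u S)"
    using W c by simp
  have "\<exists>G\<in>carrier_mat w k. - (W * lower_rows u S) = W * G"
    by (rule bexI[of _ "- lower_rows u S"], rule neg) (use c(2) in simp)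
  then have "mat_image (- (W * lower_rows u S)) \<subseteq> mat_image W"
    using mat_image_subset_iff[of "- (W * lower_rows u S)" n k W w] W c(2) by simp
  ultimately show "case (U * upper_rows u S, - (W * lower_rows u S)) of
      (P, Q) \<Rightarrow> P \<in> carrier_mat n k \<and> Q \<in> carrier_mat n k \<and> M = P - Q \<and>
        mat_image P \<subseteq> mat_image U \<and> mat_image Q \<subseteq> mat_image W"
    using U W c by simp
next
  fix PQ assume "case PQ of (P, Q) \<Rightarrow> P \<in> carrier_mat n k \<and> Q \<in> carrier_mat n k \<and> M = P - Q \<and>
      mat_image P \<subseteq> mat_image U \<and> mat_image Q \<subseteq> mat_image W"
  then obtain P Q where PQ: "PQ = (P, Q)" "P \<in> carrier_mat n k" "Q \<in> carrier_mat n k" "M = P - Q"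
    "mat_image P \<subseteq> mat_image U" "mat_image Q \<subseteq> mat_image W" by auto
  obtain G where G: "G \<in> carrier_mat u k" "P = U * G" using mat_image_subset_iff[OF PQ(2) U(1)] PQ(5) by blast
  obtain H where H: "H \<in> carrier_mat w k" "Q = W * H" using mat_image_subset_iff[OF PQ(3) W(1)] PQ(6) by blast
  obtain S where S: "S \<in> carrier_mat (u + w) k" "upper_rows u S = G" "lower_rows u S = - H"
    using exists_stacked_rows[OF G(1), of "- H" w] H by auto
  have WH: "W * (- H) = - Q" using H W by simp
  have "hcat U W * S = P + - Q" using hcat_mult[OF U(1) W(1) S(1)] S G WH by simp
  also have "\<dots> = M" using PQ by (intro eq_matI) auto
  moreover have "- (- Q) = Q" by (intro eq_matI) auto
  ultimately show "\<exists>S. (S \<in> carrier_mat (u + w) k \<and> hcat U W * S = M) \<and>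
      (U * upper_rows u S, - (W * lower_rows u S)) = PQ"
    using S G WH PQ(1) by auto
next
  fix S S' assume S: "S \<in> carrier_mat (u + w) k \<and> hcat U W * S = M"
    and S': "S' \<in> carrier_mat (u + w) k \<and> hcat U W * S' = M"
    and eq: "(U * upper_rows u S, - (W * lower_rows u S)) = (U * upper_rows u S', - (W * lower_rows u S'))"
  have c: "upper_rows u S \<in> carrier_mat u k" "lower_rows u S \<in> carrier_mat w k"
    "upper_rows u S' \<in> carrier_mat u k" "lower_rows u S' \<in> carrier_mat w k"
    using upper_lower_rows_carrier S S' by blast+
  have "upper_rows u S = upper_rows u S'"
    using inj_mat_cancel[OF U(2,1) c(1,3)] eq by simp
  moreover have "W * lower_rows u S = W * lower_rows u S'"
    using eq by (metis Pair_inject uminus_uminus_mat)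
  then have "lower_rows u S = lower_rows u S'" using inj_mat_cancel[OF W(2,1) c(2,4)] by simp
  ultimately show "S = S'" using upper_lower_rows_eqI S S' by blast
qed

lemma implements_decompose:
  assumes "consts_loaded mem" "mval mem U' U" "mval mem W' W" "mval mem M' M"
    "U \<in> carrier_mat n u" "inj_mat U" "W \<in> carrier_mat n w" "inj_mat W" "M \<in> carrier_mat n k"
  shows "implements (\<lambda>m (P', Q') (P, Q). mval m P' P \<and> mval m Q' Q) (decompose_prog U' W' M') mem
    (unique_solution (\<lambda>(P, Q). P \<in> carrier_mat n k \<and> Q \<in> carrier_mat n k \<and> M = P - Q \<and>
      mat_image P \<subseteq> mat_image U \<and> mat_image Q \<subseteq> mat_image W))"
    (is "implements ?R _ _ _")
proof -
  have d: "dim_col U' = u" using assms(2,5) by (auto simp: mval_def)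
  have hc: "hcat U W \<in> carrier_mat n (u + w)" using hcat_carrier assms by blast
  have h: "mval mem (hcat U' W') (hcat U W)" using assms by (intro mval_hcat) auto
  let ?f = "\<lambda>S. (U * upper_rows u S, - (W * lower_rows u S))"
  have mo: "map_option ?f r = Option.bind r (\<lambda>S. Some (?f S))" for r by (cases r) auto
  show ?thesis unfolding decompose_prog_def unique_solution_decompose[OF assms(5-9)] mo d
  proof (rule implements_bind_unique[OF implements_solve[OF assms(1) h assms(4) hc assms(9)]])
    fix S' S m1 assume m1: "prefix mem m1" "mval m1 S' S" and "S \<in> carrier_mat (u + w) k \<and> hcat U W * S = M"
    then have S: "S \<in> carrier_mat (u + w) k" by blast
    note c1 = consts_loaded_prefix[OF assms(1) m1(1)]
    note c = upper_lower_rows_carrier[OF S]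
    show "implements ?R (prog_bind (mult_prog U' (upper_rows u S')) (\<lambda>P. prog_bind (mult_prog W' (lower_rows u S'))
        (\<lambda>T. prog_bind (neg_prog T) (\<lambda>Q. Return (P, Q))))) m1 (Some (?f S))"
      using m1 S c c1 assms
      by - (rule implements_bind_Some implements_mult implements_neg mval_upper_rows mval_lower_rows implements_Return
          | assumption | (rule mval_prefix[rotated] consts_loaded_prefix[rotated], assumption) | simp)+
  qed
qed

text \<open>With the second block negated, the pair is the unknown of one ordinary system, cut at
  row \<open>u\<close>.\<close>

lemma unique_solution_pair:
  fixes B :: "'a::field mat"
  assumes "B \<in> carrier_mat n u" "B' \<in> carrier_mat n w"
  shows "unique_solution (\<lambda>(X, Y). X \<in> carrier_mat u k \<and> Y \<in> carrier_mat w k \<and> B * X - B' * Y = R) =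
    map_option (\<lambda>S. (upper_rows u S, lower_rows u S))
      (unique_solution (\<lambda>S. S \<in> carrier_mat (u + w) k \<and> hcat B (- B') * S = R))"
proof -
  have mult: "hcat B (- B') * S = B * upper_rows u S - B' * lower_rows u S"
    if "S \<in> carrier_mat (u + w) k" for S
  proof -
    have "hcat B (- B') * S = B * upper_rows u S + - (B' * lower_rows u S)"
      using hcat_mult[OF assms(1) _ that, of "- B'"] assms upper_lower_rows_carrier[OF that] by simp
    also have "\<dots> = B * upper_rows u S - B' * lower_rows u S"
      using assms upper_lower_rows_carrier[OF that] by (intro eq_matI) auto
    finally show ?thesis .
  qed
  show ?thesis
  proof (rule unique_solution_transfer)
    fix S assume "S \<in> carrier_mat (u + w) k \<and> hcat B (- B') * S = R"
    then show "case (upper_rows u S, lower_rows u S) of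
        (X, Y) \<Rightarrow> X \<in> carrier_mat u k \<and> Y \<in> carrier_mat w k \<and> B * X - B' * Y = R"
      using mult upper_lower_rows_carrier by auto
  next
    fix XY assume "case XY of (X, Y) \<Rightarrow> X \<in> carrier_mat u k \<and> Y \<in> carrier_mat w k \<and> B * X - B' * Y = R"
    then obtain X Y where XY: "XY = (X, Y)" "X \<in> carrier_mat u k" "Y \<in> carrier_mat w k" "B * X - B' * Y = R"
      by auto
    obtain S where "S \<in> carrier_mat (u + w) k" "upper_rows u S = X" "lower_rows u S = Y"
      using exists_stacked_rows[OF XY(2,3)] by blast
    then show "\<exists>S. (S \<in> carrier_mat (u + w) k \<and> hcat B (- B') * S = R) \<and> (upper_rows u S, lower_rows u S) = XY"
      using mult XY by auto
  next
    fix S S' assume "S \<in> carrier_mat (u + w) k \<and> hcat B (- B') * S = R"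
      "S' \<in> carrier_mat (u + w) k \<and> hcat B (- B') * S' = R"
      "(upper_rows u S, lower_rows u S) = (upper_rows u S', lower_rows u S')"
    then show "S = S'" using upper_lower_rows_eqI by blast
  qed
qed

section \<open>Correctness of the program\<close>

lemma concat_nth_uniform:
  assumes "\<forall>xs\<in>set xss. length xs = n" "i < length xss" "j < n"
  shows "concat xss ! (i * n + j) = xss ! i ! j"
  using assms
proof (induction xss arbitrary: i)
  case (Cons xs xss)
  show ?case
  proof (cases i)
    case 0
    then show ?thesis using Cons.prems by (simp add: nth_append)
  next
    case (Suc l)
    then have "concat (xs # xss) ! (i * n + j) = concat xss ! (l * n + j)"
      using Cons.prems by (simp add: nth_append)
    then show ?thesis using Cons Suc by simp
  qed
qed simp

lemma length_mat_entries: "A \<in> carrier_mat n n \<Longrightarrow> length (mat_entries A) = n * n"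
  by (simp add: mat_entries_def length_concat rows_def o_def sum_list_triv)

lemma mat_entries_nth:
  assumes "A \<in> carrier_mat n n" "i < n" "j < n"
  shows "mat_entries A ! (i * n + j) = A $$ (i, j)"
  unfolding mat_entries_def
  by (subst concat_nth_uniform[of _ n]) (use assms in \<open>auto simp: rows_def list_of_vec_index\<close>)

lemma mval_input:
  assumes A: "A1 \<in> carrier_mat n n" "A2 \<in> carrier_mat n n" "A3 \<in> carrier_mat n n"
  shows "mval (commext_input A1 A2 A3) (input_reg_mat n 0) A1"
    "mval (commext_input A1 A2 A3) (input_reg_mat n 1) A2"
    "mval (commext_input A1 A2 A3) (input_reg_mat n 2) A3"
proof -
  note len = length_mat_entries[OF A(1)] length_mat_entries[OF A(2)] length_mat_entries[OF A(3)]
  \<comment> \<open>Row-major positions stay inside the block of their own matrix, so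
    \<open>nth_append\<close> selects the right one of the three inputs.\<close>
  have lt: "i * n + j < n * n" if "i < n" "j < n" for i j
  proof -
    have "i * n + j < i * n + n" using that by simp
    also have "\<dots> = Suc i * n" by simp
    also have "\<dots> \<le> n * n" using that by (intro mult_le_mono1) simp
    finally show ?thesis .
  qed
  have e: "mat_entries X ! (i * n + j) = X $$ (i, j)" if "i < n" "j < n" "X \<in> carrier_mat n n" for i j X
    using mat_entries_nth that by blast
  show "mval (commext_input A1 A2 A3) (input_reg_mat n 0) A1"
    "mval (commext_input A1 A2 A3) (input_reg_mat n 1) A2"
    "mval (commext_input A1 A2 A3) (input_reg_mat n 2) A3"
    using A lt e by (auto simp: mval_def input_reg_mat_def val_def commext_input_def len nth_append
        nth_Cons' add.assoc trans_less_add1)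
qed

lemma consts_loaded_input: "consts_loaded (commext_input A1 A2 A3)"
  by (simp add: consts_loaded_def val_def commext_input_def zero_reg_def one_reg_def)

lemma bind_map_option: "Option.bind (map_option f r) g = Option.bind r (\<lambda>x. g (f x))"
  by (cases r) auto

text \<open>Splits the final test of the algorithm into the three successive comparisons made by the
  program.\<close>

lemma if_conj_eq_bind:
  "(if a \<and> b \<and> c then Some z else None) =
   Option.bind (if a then Some () else None) (\<lambda>_. Option.bind (if b then Some () else None)
     (\<lambda>_. Option.bind (if c then Some () else None) (\<lambda>_. Some z)))"
  by simp

lemma commutator_carrier:
  "A \<in> carrier_mat n n \<Longrightarrow> B \<in> carrier_mat n n \<Longrightarrow> commutator A B \<in> carrier_mat n n"
  unfolding commutator_def by (intro minus_carrier_mat mult_carrier_mat)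

text \<open>The second form serves the steps that state their equation with the product on the
  right-hand side.\<close>

lemma implements_bind_solve:
  assumes "consts_loaded mem" "mval mem M A" "mval mem N B" "A \<in> carrier_mat n a" "B \<in> carrier_mat n k"
    and "\<And>x X m. prefix mem m \<Longrightarrow> X \<in> carrier_mat a k \<Longrightarrow> mval m x X \<Longrightarrow> implements S (f x) m (g X)"
  shows "implements S (prog_bind (solve_prog M N) f) mem
      (Option.bind (unique_solution (\<lambda>X. X \<in> carrier_mat a k \<and> A * X = B)) g)"
    and "implements S (prog_bind (solve_prog M N) f) mem
      (Option.bind (unique_solution (\<lambda>X. X \<in> carrier_mat a k \<and> B = A * X)) g)"
  using implements_bind_unique[OF implements_solve[OF assms(1-5)], of S f g] assms(6)
  by (simp_all add: eq_commute[of B])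

lemma implements_bind_solve_left:
  assumes "consts_loaded mem" "mval mem M C" "mval mem L N" "C \<in> carrier_mat d k" "N \<in> carrier_mat n k"
    and "\<And>x X m. prefix mem m \<Longrightarrow> X \<in> carrier_mat n d \<Longrightarrow> mval m x X \<Longrightarrow> implements S (f x) m (g X)"
  shows "implements S (prog_bind (solve_left_prog M L) f) mem
      (Option.bind (unique_solution (\<lambda>X. X \<in> carrier_mat n d \<and> X * C = N)) g)"
    and "implements S (prog_bind (solve_left_prog M L) f) mem
      (Option.bind (unique_solution (\<lambda>X. X \<in> carrier_mat n d \<and> N = X * C)) g)"
  using implements_bind_unique[OF implements_solve_left[OF assms(1-5)], of S f g] assms(6)
  by (simp_all add: eq_commute[of N])

lemma implements_bind_decompose:
  assumes "consts_loaded mem" "mval mem U' U" "mval mem W' W" "mval mem M' M"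
    "U \<in> carrier_mat n u" "inj_mat U" "W \<in> carrier_mat n w" "inj_mat W" "M \<in> carrier_mat n k"
    and "\<And>p q P Q m. prefix mem m \<Longrightarrow> P \<in> carrier_mat n k \<Longrightarrow> Q \<in> carrier_mat n k \<Longrightarrow>
      mval m p P \<Longrightarrow> mval m q Q \<Longrightarrow> implements S (f p q) m (g P Q)"
  shows "implements S (prog_bind (decompose_prog U' W' M') (\<lambda>(p, q). f p q)) mem
    (Option.bind (unique_solution (\<lambda>(P, Q). P \<in> carrier_mat n k \<and> Q \<in> carrier_mat n k \<and> M = P - Q \<and>
      mat_image P \<subseteq> mat_image U \<and> mat_image Q \<subseteq> mat_image W)) (\<lambda>(P, Q). g P Q))"
  by (rule implements_bind_unique[OF implements_decompose[OF assms(1-9)]]) (auto intro: assms(10))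

lemma implements_bind_solve_pair:
  assumes "consts_loaded mem" "mval mem M B" "mval mem M' (- B')" "mval mem N R"
    "B \<in> carrier_mat n u" "B' \<in> carrier_mat n w" "R \<in> carrier_mat n k"
    and "\<And>x X m. prefix mem m \<Longrightarrow> X \<in> carrier_mat (u + w) k \<Longrightarrow> mval m x X \<Longrightarrow>
      upper_rows u X \<in> carrier_mat u k \<Longrightarrow> lower_rows u X \<in> carrier_mat w k \<Longrightarrow>
      implements S (f x) m (g (upper_rows u X) (lower_rows u X))"
  shows "implements S (prog_bind (solve_prog (hcat M M') N) f) mem
    (Option.bind (unique_solution (\<lambda>(X, Y). X \<in> carrier_mat u k \<and> Y \<in> carrier_mat w k \<and>
      B * X - B' * Y = R)) (\<lambda>(X, Y). g X Y))"
  unfolding unique_solution_pair[OF assms(5,6)] bind_map_option prod.case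
proof (rule implements_bind_solve(1)[OF assms(1) _ assms(4) _ assms(7)])
  show "hcat B (- B') \<in> carrier_mat n (u + w)" using assms by (intro hcat_carrier) auto
  show "mval mem (hcat M M') (hcat B (- B'))" using assms by (intro mval_hcat) auto
qed (rule assms(8); (assumption | erule upper_lower_rows_carrier))

text \<open>For the system that determines \<open>D1\<close>: the program adds the known product
  \<open>Y\<close> to the right-hand side before it solves.\<close>

lemma implements_bind_solve_diff:
  assumes "consts_loaded mem" "mval mem M A" "mval mem N (R + Y)"
    "A \<in> carrier_mat n a" "Y \<in> carrier_mat n k" "R \<in> carrier_mat n k"
    and "\<And>x X m. prefix mem m \<Longrightarrow> X \<in> carrier_mat a k \<Longrightarrow> mval m x X \<Longrightarrow> implements S (f x) m (g X)"
  shows "implements S (prog_bind (solve_prog M N) f) mem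
      (Option.bind (unique_solution (\<lambda>X. X \<in> carrier_mat a k \<and> A * X - Y = R)) g)"
proof -
  have "Z - Y = R \<longleftrightarrow> Z = R + Y" if Z: "Z \<in> carrier_mat n k" for Z
  proof
    assume "Z - Y = R"
    then have "R + Y = Z - Y + Y" by simp
    also have "\<dots> = Z" using Z assms(5) by (intro eq_matI) auto
    finally show "Z = R + Y" ..
  next
    assume "Z = R + Y"
    then show "Z - Y = R" using assms(5,6) by (intro eq_matI) auto
  qed
  then have eq: "X \<in> carrier_mat a k \<and> A * X - Y = R \<longleftrightarrow> X \<in> carrier_mat a k \<and> A * X = R + Y" for X
    using mult_carrier_mat[OF assms(4)] by blast
  show ?thesis unfolding eq
    by (rule implements_bind_solve(1)[OF assms(1-4)]) (use assms(5,6,7) in auto)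
qed

lemma implements_bind_require_eq:
  assumes "mval mem M A" "mval mem N B" "A \<in> carrier_mat n k" "B \<in> carrier_mat n k"
    and "\<And>u m. prefix mem m \<Longrightarrow> implements S (f u) m r"
  shows "implements S (prog_bind (require_eq M N) f) mem
    (Option.bind (if A = B then Some () else None) (\<lambda>_. r))"
  by (rule implements_bind[OF implements_require_eq[OF assms(1-4)]]) (rule assms(5))

lemma mval_upper_lower_rows_dim:
  assumes "mval mem B b" "b \<in> carrier_mat n u" "mval mem S X" "X \<in> carrier_mat (u + w) k"
  shows "mval mem (upper_rows (dim_col B) S) (upper_rows u X)"
    "mval mem (lower_rows (dim_col B) S) (lower_rows u X)"
proof -
  have "dim_col B = u" using assms(1,2) by (simp add: mval_def)
  then show "mval mem (upper_rows (dim_col B) S) (upper_rows u X)"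
    "mval mem (lower_rows (dim_col B) S) (lower_rows u X)"
    using mval_upper_rows[OF assms(3), of u] mval_lower_rows[OF assms(3), of u] assms(4) by simp_all
qed

lemma implements_Return_triple:
  "mval mem X1 Z1 \<Longrightarrow> mval mem X2 Z2 \<Longrightarrow> mval mem X3 Z3 \<Longrightarrow>
    implements (\<lambda>m (X1, X2, X3) (Z1, Z2, Z3). mval m X1 Z1 \<and> mval m X2 Z2 \<and> mval m X3 Z3)
      (Return (X1, X2, X3)) mem (Some (Z1, Z2, Z3))"
  by (rule implements_Return) simp

text \<open>Program and specification are traversed in parallel, with the first basis being the one
  that the program computes. Steps made by the program alone, such as products or the bases of the
  other two intersections, always succeed and are absorbed by
  \<open>implements_bind_Some\<close>.\<close>

lemma implements_commext:
  assumes A: "A1 \<in> carrier_mat n n" "A2 \<in> carrier_mat n n" "A3 \<in> carrier_mat n n"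
  shows "implements (\<lambda>m (X1, X2, X3) (Z1, Z2, Z3). mval m X1 Z1 \<and> mval m X2 Z2 \<and> mval m X3 Z3)
    (commext_prog n) (commext_input A1 A2 A3)
    (commext_from_basis A1 A2 A3 (image_inter_mat (commutator A1 A2) (commutator A1 A3)))"
proof -
  note C = commutator_carrier[OF A(1,2)] commutator_carrier[OF A(1,3)] commutator_carrier[OF A(2,1)]
    commutator_carrier[OF A(2,3)] commutator_carrier[OF A(3,1)] commutator_carrier[OF A(3,2)]
  note b1 = image_inter_mat[OF C(1,2)] and v2 = image_inter_mat[OF C(3,4)] and v3 = image_inter_mat[OF C(5,6)]
  have dr: "dim_row A1 = n" using A by simp
  show ?thesis
    \<comment> \<open>The second and third intersection are rewritten as images of the computed
      basis matrices, the form expected by the rule for decompositions.\<close>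
    unfolding commext_prog_def commext_from_basis_def Let_def dr v2(3)[symmetric] v3(3)[symmetric] if_conj_eq_bind
    using A C b1(1,2) v2(1,2) v3(1,2) consts_loaded_input[of A1 A2 A3] mval_input[OF A]
    \<comment> \<open>The rules for the paired and the shifted system precede the general rule,
      because their programs are instances of \<open>solve_prog\<close> as well.\<close>
    by - (rule implements_bind_solve_pair implements_bind_solve_diff implements_bind_solve
        implements_bind_solve_left implements_bind_decompose implements_bind_require_eq
        implements_bind_Some implements_commutator implements_mult implements_sub implements_add
        implements_neg mval_four_block mval_upper_lower_rows_dim four_block_carrier_mat mult_carrier_mat
        minus_carrier_mat add_carrier_mat implements_image_inter implements_Return_triple
        | assumption | (rule mval_prefix[rotated] consts_loaded_prefix[rotated], assumption))+
qed

lemma commext_run_eq: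
  fixes A1 A2 A3 :: "'k::field mat"
  assumes "A1 \<in> carrier_mat n n" "A2 \<in> carrier_mat n n" "A3 \<in> carrier_mat n n"
  shows "commext_run n A1 A2 A3 =
    commext_from_basis A1 A2 A3 (image_inter_mat (commutator A1 A2) (commutator A1 A3))"
proof -
  have read: "map_mat ((!) mem) X = Z" if "mval mem X Z" for mem :: "'k list" and X Z
    using that by (intro eq_matI) (auto simp: mval_def val_def)
  show ?thesis
    using implements_commext[OF assms] read
    by (auto simp: commext_run_def implements_def split: option.splits)
qed

text \<open>The witness for the arbitrary first basis is the kernel basis that the program finds for
  the intersection.\<close>

lemma commext_result_run:
  assumes "A1 \<in> carrier_mat n n" "A2 \<in> carrier_mat n n" "A3 \<in> carrier_mat n n"
  shows "commext_result A1 A2 A3 (commext_run n A1 A2 A3)"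
proof -
  let ?B = "image_inter_mat (commutator A1 A2) (commutator A1 A3)"
  note B = image_inter_mat[OF commutator_carrier[OF assms(1,2)] commutator_carrier[OF assms(1,3)]]
  have "columns_basis_of ?B (mat_image ?B)"
    using columns_basis_of_iff[OF B(1) B(1)] B(2) by blast
  then show ?thesis unfolding commext_result_def B(3) commext_run_eq[OF assms]
    using B(1) assms(1) by (intro exI[of _ ?B]) simp
qed

section \<open>Soundness\<close>

lemma commuting_extension_iff:
  "commuting_extension n r [A1, A2, A3] [Z1, Z2, Z3] \<longleftrightarrow>
    Z1 * Z2 = Z2 * Z1 \<and> Z1 * Z3 = Z3 * Z1 \<and> Z2 * Z3 = Z3 * Z2 \<and>
    (\<forall>(A, Z)\<in>{(A1, Z1), (A2, Z2), (A3, Z3)}. \<exists>B\<in>carrier_mat n (r - n). \<exists>C\<in>carrier_mat (r - n) n.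
      \<exists>D\<in>carrier_mat (r - n) (r - n). Z = four_block_mat A B C D)"
proof -
  have all: "(\<forall>i<3. P i) \<longleftrightarrow> P 0 \<and> P 1 \<and> P 2" for P :: "nat \<Rightarrow> bool"
    by (auto simp: numeral_3_eq_3 numeral_2_eq_2 less_Suc_eq)
  have len: "length [A1, A2, A3] = 3" by simp
  have comm: "(\<forall>Z\<in>set [Z1, Z2, Z3]. \<forall>Z'\<in>set [Z1, Z2, Z3]. Z * Z' = Z' * Z) \<longleftrightarrow>
      Z1 * Z2 = Z2 * Z1 \<and> Z1 * Z3 = Z3 * Z1 \<and> Z2 * Z3 = Z3 * Z2"
    unfolding list.set ball_simps(5,7) by metis
  show ?thesis unfolding commuting_extension_def len all comm ball_simps(5,7) prod.case
    by (simp only: nth_Cons_0 nth_Cons_Suc One_nat_def numeral_2_eq_2) simp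
qed

lemma unique_bindE:
  assumes "Option.bind (unique_solution P) g = Some z"
  obtains x where "P x" "g x = Some z"
  using assms unique_solution_eq_Some[of P] by (cases "unique_solution P") auto

lemma unique_bind_pairE:
  assumes "Option.bind (unique_solution (\<lambda>(x, y). P x y)) (\<lambda>(x, y). g x y) = Some z"
  obtains x y where "P x y" "g x y = Some z"
  using assms by (elim unique_bindE) auto

text \<open>The final test certifies commutation; what has to be extracted from the preceding steps
  is the shape of the blocks. With \<open>r - n\<close> columns in \<open>B1\<close> these are the
  shapes of an extension of size \<open>r\<close>.\<close>

lemma commext_from_basis_sound:
  assumes A: "A1 \<in> carrier_mat n n" "A2 \<in> carrier_mat n n" "A3 \<in> carrier_mat n n"
    and B1: "B1 \<in> carrier_mat n (r - n)"
    and res: "commext_from_basis A1 A2 A3 B1 = Some (Z1, Z2, Z3)"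
  shows "commuting_extension n r [A1, A2, A3] [Z1, Z2, Z3]"
proof -
  let ?d = "r - n"
  have dims: "dim_row A1 = n" "dim_col B1 = ?d" using A B1 by auto
  obtain B2 B3 C1 C2 C3 D1 D2 D3 where
    blocks: "B2 \<in> carrier_mat n ?d" "B3 \<in> carrier_mat n ?d" "C1 \<in> carrier_mat ?d n"
      "C2 \<in> carrier_mat ?d n" "C3 \<in> carrier_mat ?d n" "D1 \<in> carrier_mat ?d ?d"
      "D2 \<in> carrier_mat ?d ?d" "D3 \<in> carrier_mat ?d ?d" and
    Z: "(let Z1 = four_block_mat A1 B1 C1 D1;
           Z2 = four_block_mat A2 B2 C2 D2;
           Z3 = four_block_mat A3 B3 C3 D3
       in if Z1 * Z2 = Z2 * Z1 \<and> Z1 * Z3 = Z3 * Z1 \<and> Z2 * Z3 = Z3 * Z2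
          then Some (Z1, Z2, Z3) else None) = Some (Z1, Z2, Z3)"
    using res unfolding commext_from_basis_def Let_def dims
    by (elim unique_bind_pairE unique_bindE conjE) blast
  have Zs: "Z1 = four_block_mat A1 B1 C1 D1" "Z2 = four_block_mat A2 B2 C2 D2"
    "Z3 = four_block_mat A3 B3 C3 D3" "Z1 * Z2 = Z2 * Z1" "Z1 * Z3 = Z3 * Z1" "Z2 * Z3 = Z3 * Z2"
    using Z by (auto simp: Let_def split: if_splits)
  then show ?thesis unfolding commuting_extension_iff using blocks B1 by blast
qed

section \<open>Completeness\<close>

lemma inj_mat_hcat_iff:
  assumes "A \<in> carrier_mat n a" "B \<in> carrier_mat n b"
  shows "inj_mat (hcat A B) \<longleftrightarrow> (\<forall>x\<in>carrier_vec a. \<forall>y\<in>carrier_vec b.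
    A *\<^sub>v x + B *\<^sub>v y = 0\<^sub>v n \<longrightarrow> x = 0\<^sub>v a \<and> y = 0\<^sub>v b)"
proof -
  note h = hcat_carrier[OF assms]
  have z: "0\<^sub>v (a + b) = 0\<^sub>v a @\<^sub>v (0\<^sub>v b :: 'a vec)" by auto
  have d: "dim_col (hcat A B) = a + b" "dim_row (hcat A B) = n" using h by auto
  show ?thesis unfolding inj_mat_def d all_vec_append z
    using hcat_mult_vec[OF assms] append_vec_eq[of _ a "0\<^sub>v a"] by auto
qed

text \<open>For the system that determines \<open>D2\<close> and \<open>D3\<close>, whose matrix is
  \<open>(B3 | - B2)\<close>.\<close>

lemma inj_mat_hcat_uminus:
  assumes "A \<in> carrier_mat n a" "B \<in> carrier_mat n b" "inj_mat (hcat A B)"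
  shows "inj_mat (hcat A (- B))"
proof -
  have mB: "- B \<in> carrier_mat n b" using assms by simp
  have "(- B) *\<^sub>v y = B *\<^sub>v (- y)" if "y \<in> carrier_vec b" for y
    using assms(2) that by (intro eq_vecI) auto
  moreover have "- y = 0\<^sub>v b \<longleftrightarrow> y = 0\<^sub>v b" if "y \<in> carrier_vec b" for y :: "'a vec"
    using that uminus_zero_vec_eq by blast
  ultimately show ?thesis
    using assms(3) unfolding inj_mat_hcat_iff[OF assms(1,2)] inj_mat_hcat_iff[OF assms(1) mB]
    by (metis uminus_carrier_vec)
qed

lemma unique_solution_cancel:
  assumes "inj_mat A" "A \<in> carrier_mat n a" "X \<in> carrier_mat a k"
  shows "unique_solution (\<lambda>Y. Y \<in> carrier_mat a k \<and> A * Y = A * X) = Some X"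
  by (rule unique_solution_SomeI) (use assms inj_mat_cancel in blast)+

lemma hcat_mult_diff:
  assumes "U \<in> carrier_mat n u" "W \<in> carrier_mat n w" "X \<in> carrier_mat u k" "Y \<in> carrier_mat w k"
  shows "\<exists>S\<in>carrier_mat (u + w) k. hcat U W * S = U * X - W * (Y :: 'a::field mat) \<and>
    upper_rows u S = X \<and> lower_rows u S = - Y"
proof -
  obtain S where S: "S \<in> carrier_mat (u + w) k" "upper_rows u S = X" "lower_rows u S = - Y"
    using exists_stacked_rows[OF assms(3), of "- Y" w] assms(4) by auto
  have "hcat U W * S = U * X + - (W * Y)"
    using hcat_mult[OF assms(1,2) S(1)] S assms(2,4) by simp
  also have "\<dots> = U * X - W * Y" using assms by (intro eq_matI) auto
  finally show ?thesis using S by blast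
qed

text \<open>Injectivity of \<open>(U | W)\<close> makes the stacked coordinates unique, and
  \<open>unique_solution_decompose\<close> carries this over to the pair of summands.\<close>

lemma unique_decomposition:
  assumes UW: "U \<in> carrier_mat n u" "W \<in> carrier_mat n w" "inj_mat (hcat U W)"
    and XY: "X \<in> carrier_mat u k" "Y \<in> carrier_mat w k" and M: "M = U * X - W * Y"
  shows "unique_solution (\<lambda>(P, Q). P \<in> carrier_mat n k \<and> Q \<in> carrier_mat n k \<and> M = P - Q \<and>
      mat_image P \<subseteq> mat_image U \<and> mat_image Q \<subseteq> mat_image W) = Some (U * X, W * Y)"
proof -
  obtain S where S: "S \<in> carrier_mat (u + w) k" "hcat U W * S = M" "upper_rows u S = X"
    "lower_rows u S = - Y"
    using hcat_mult_diff[OF UW(1,2) XY] M by auto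
  have "unique_solution (\<lambda>S'. S' \<in> carrier_mat (u + w) k \<and> hcat U W * S' = M) = Some S"
    unfolding S(2)[symmetric] by (rule unique_solution_cancel[OF UW(3) hcat_carrier[OF UW(1,2)] S(1)])
  moreover have "M \<in> carrier_mat n k" using M UW XY by auto
  moreover have "- (W * (- Y)) = W * Y" using UW XY by simp
  ultimately show ?thesis
    using unique_solution_decompose[OF UW(1) inj_mat_hcatD(1)[OF UW(3,1,2)] UW(2) inj_mat_hcatD(2)[OF UW(3,1,2)]]
      S(3,4) by simp
qed

section \<open>Sums and intersections of images\<close>

lemma mat_image_zero: "A \<in> carrier_mat n m \<Longrightarrow> 0\<^sub>v n \<in> mat_image A"
  unfolding mat_image_eq by (auto intro!: exI[of _ "0\<^sub>v m"] eq_vecI)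

lemma mat_image_add_minus:
  assumes "A \<in> carrier_mat n m" "x \<in> mat_image A" "y \<in> mat_image A"
  shows mat_image_add: "x + y \<in> mat_image A" and mat_image_minus: "x - y \<in> mat_image A"
proof -
  obtain u v where "u \<in> carrier_vec m" "x = A *\<^sub>v u" "v \<in> carrier_vec m" "y = A *\<^sub>v v"
    using assms unfolding mat_image_eq by auto
  then have "x + y = A *\<^sub>v (u + v)" "u + v \<in> carrier_vec m" "x - y = A *\<^sub>v (u - v)" "u - v \<in> carrier_vec m"
    using mult_add_distrib_mat_vec[OF assms(1)] mult_minus_distrib_mat_vec[OF assms(1)] by auto
  then show "x + y \<in> mat_image A" "x - y \<in> mat_image A" using assms(1) unfolding mat_image_eq by auto
qed

lemma mat_image_commutator_swap:
  assumes "A \<in> carrier_mat n n" "B \<in> carrier_mat n n"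
  shows "mat_image (commutator B A) = mat_image (commutator A B)"
proof -
  have sub: "mat_image (commutator Y X) \<subseteq> mat_image (commutator X Y)"
    if XY: "X \<in> carrier_mat n n" "Y \<in> carrier_mat n n" for X Y :: "'a mat"
  proof -
    have c: "commutator X Y \<in> carrier_mat n n" "commutator Y X \<in> carrier_mat n n"
      using commutator_carrier XY by auto
    have "commutator Y X = commutator X Y * (- 1\<^sub>m n)"
      using XY c(1) unfolding commutator_def by (simp, intro eq_matI) auto
    then show ?thesis unfolding mat_image_subset_iff[OF c(2,1)] by (intro bexI[of _ "- 1\<^sub>m n"]) auto
  qed
  show ?thesis using sub[OF assms] sub[OF assms(2,1)] by blast
qed

lemma inj_mat_hcat3D:
  assumes "P \<in> carrier_mat n a" "Q \<in> carrier_mat n b" "R \<in> carrier_mat n c"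
    and inj: "inj_mat (hcat (hcat P Q) R)"
    and x: "x \<in> mat_image P" "y \<in> mat_image Q" "z \<in> mat_image R" "x + y + z = 0\<^sub>v n"
  shows "x = 0\<^sub>v n \<and> y = 0\<^sub>v n \<and> z = 0\<^sub>v n"
proof -
  note h = hcat_carrier[OF assms(1,2)]
  obtain u v w where uvw: "u \<in> carrier_vec a" "x = P *\<^sub>v u" "v \<in> carrier_vec b" "y = Q *\<^sub>v v"
    "w \<in> carrier_vec c" "z = R *\<^sub>v w"
    using x assms(1-3) unfolding mat_image_eq by auto
  have "hcat P Q *\<^sub>v (u @\<^sub>v v) + R *\<^sub>v w = 0\<^sub>v n"
    using hcat_mult_vec[OF assms(1,2) uvw(1,3)] x(4) uvw by simp
  then have "u @\<^sub>v v = 0\<^sub>v (a + b)" "w = 0\<^sub>v c"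
    using inj uvw(1,3,5) unfolding inj_mat_hcat_iff[OF h assms(3)] by (auto dest!: bspec)
  moreover have "P *\<^sub>v u + Q *\<^sub>v v = 0\<^sub>v n"
  proof -
    have "hcat P Q *\<^sub>v 0\<^sub>v (a + b) = 0\<^sub>v n" using h by (auto intro!: eq_vecI)
    then show ?thesis using hcat_mult_vec[OF assms(1,2) uvw(1,3)] calculation(1) by simp
  qed
  ultimately have "u = 0\<^sub>v a \<and> v = 0\<^sub>v b \<and> w = 0\<^sub>v c"
    using inj_mat_hcatD(1)[OF inj h assms(3)] uvw(1,3) unfolding inj_mat_hcat_iff[OF assms(1,2)] by blast
  then show ?thesis using uvw assms(1-3) by (auto intro!: eq_vecI)
qed

text \<open>An element x + y = x' + z of both sums gives (x - x') + y + (0 - z) = 0, and directness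
  forces y = 0. It is applied with \<open>X\<close> the image of the block shared by two
  commutators.\<close>

lemma sum_inter_sum:
  assumes c: "X \<subseteq> carrier_vec n" "Y \<subseteq> carrier_vec n" "Z \<subseteq> (carrier_vec n :: 'a::field vec set)"
    and zero: "0\<^sub>v n \<in> Y" "0\<^sub>v n \<in> Z"
    and minus: "\<And>x x'. x \<in> X \<Longrightarrow> x' \<in> X \<Longrightarrow> x - x' \<in> X" "\<And>z. z \<in> Z \<Longrightarrow> 0\<^sub>v n - z \<in> Z"
    and indep: "\<And>x y z. x \<in> X \<Longrightarrow> y \<in> Y \<Longrightarrow> z \<in> Z \<Longrightarrow> x + y + z = 0\<^sub>v n \<Longrightarrow> y = 0\<^sub>v n"
  shows "{x + y | x y. x \<in> X \<and> y \<in> Y} \<inter> {x + z | x z. x \<in> X \<and> z \<in> Z} = X"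
proof (intro equalityI subsetI)
  fix w assume "w \<in> {x + y | x y. x \<in> X \<and> y \<in> Y} \<inter> {x + z | x z. x \<in> X \<and> z \<in> Z}"
  then obtain x y x' z where w: "w = x + y" "w = x' + z" "x \<in> X" "y \<in> Y" "x' \<in> X" "z \<in> Z" by blast
  have cs: "x \<in> carrier_vec n" "y \<in> carrier_vec n" "x' \<in> carrier_vec n" "z \<in> carrier_vec n"
    using w(3-6) c by auto
  have "(x + y) $ i = (x' + z) $ i" for i using w(1,2) by simp
  then have "x $ i + y $ i = x' $ i + z $ i" if "i < n" for i
    using cs that by (metis carrier_vecD index_add_vec(1))
  then have "(x - x') + y + (0\<^sub>v n - z) = 0\<^sub>v n"
    using cs by (intro eq_vecI) (auto simp: algebra_simps)
  then have "y = 0\<^sub>v n" using indep minus w by blast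
  then show "w \<in> X" using w cs by simp
next
  fix x assume x: "x \<in> X"
  then have "x = x + 0\<^sub>v n" using c(1) by auto
  then show "x \<in> {x + y | x y. x \<in> X \<and> y \<in> Y} \<inter> {x + z | x z. x \<in> X \<and> z \<in> Z}"
    using x zero by blast
qed

text \<open>Surjectivity of \<open>Y\<close>, in the form in which uniqueness of \<open>B2\<close>
  and \<open>B3\<close> uses it. As \<open>M\<close> has the full image, Q = M T for some
  \<open>T\<close>. Comparing coordinates in P (X T) - Q (Y T) = Q with respect to the independent
  columns of (P | Q) gives Y T = -1, so - T is a right inverse of \<open>Y\<close>.\<close>

lemma right_cancel_if_full_image:
  fixes M :: "'a::field mat"
  assumes P: "P \<in> carrier_mat n d" and Q: "Q \<in> carrier_mat n d"
    and X: "X \<in> carrier_mat d k" and Y: "Y \<in> carrier_mat d k"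
    and M: "M = P * X - Q * Y" "mat_image M = mat_image (hcat P Q)" and inj: "inj_mat (hcat P Q)"
    and G: "G \<in> carrier_mat l d" "H \<in> carrier_mat l d" "G * Y = H * Y"
  shows "G = H"
proof -
  note h = hcat_carrier[OF P Q]
  have Mc: "M \<in> carrier_mat n k" using M(1) P Q X Y by auto
  \<comment> \<open>\<open>J\<close>, zero stacked over the identity, holds the coordinates of
    \<open>Q\<close> in (P | Q).\<close>
  obtain J :: "'a mat" where J: "J \<in> carrier_mat (d + d) d" "upper_rows d J = 0\<^sub>m d d" "lower_rows d J = 1\<^sub>m d"
    using exists_stacked_rows[OF zero_carrier_mat[of d d] one_carrier_mat] by blast
  have QJ: "hcat P Q * J = Q" unfolding hcat_mult[OF P Q J(1)] J using P Q by simp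
  then have "mat_image Q \<subseteq> mat_image M"
    unfolding M(2) mat_image_subset_iff[OF Q h] using J(1) by (metis (no_types))
  then obtain T where T: "T \<in> carrier_mat k d" "Q = M * T" unfolding mat_image_subset_iff[OF Q Mc] by blast
  have XT: "X * T \<in> carrier_mat d d" and YT: "Y * T \<in> carrier_mat d d" using X Y T by auto
  obtain S where S: "S \<in> carrier_mat (d + d) d" "hcat P Q * S = P * (X * T) - Q * (Y * T)"
    "lower_rows d S = - (Y * T)"
    using hcat_mult_diff[OF P Q XT YT] by blast
  have "M * T = P * X * T - Q * Y * T"
    unfolding M(1) by (rule minus_mult_distrib_mat[of _ n k]) (use P Q X Y T in auto)
  also have "\<dots> = P * (X * T) - Q * (Y * T)"
    unfolding assoc_mult_mat[OF P X T(1)] assoc_mult_mat[OF Q Y T(1)] ..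
  finally have "hcat P Q * S = hcat P Q * J" using S(2) QJ T(2) by metis
  then have "S = J" by (rule inj_mat_cancel[OF inj h S(1) J(1)])
  then have neg: "- (Y * T) = 1\<^sub>m d" using S(3) J(3) by metis
  have inv: "F * Y * (- T) = F" if F: "F \<in> carrier_mat l d" for F
  proof -
    have "F * Y * (- T) = F * (Y * (- T))" using assoc_mult_mat[OF F Y, of "- T" d] T(1) by simp
    also have "Y * (- T) = 1\<^sub>m d" using neg Y T(1) by simp
    finally show ?thesis using F by simp
  qed
  have "G = G * Y * (- T)" using inv[OF G(1)] ..
  also have "\<dots> = H" unfolding G(3) by (rule inv[OF G(2)])
  finally show ?thesis .
qed

lemma set_sum_commute:
  assumes "X \<subseteq> carrier_vec n" "Y \<subseteq> carrier_vec n"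
  shows "{x + y | x y. x \<in> X \<and> y \<in> Y} = {y + x | x y. x \<in> X \<and> y \<in> (Y :: 'a::field vec set)}"
proof -
  have "x + y = y + x" if "x \<in> X" "y \<in> Y" for x y
    using that assms comm_add_vec[of x n y] by blast
  then show ?thesis by (intro Collect_cong) metis
qed

text \<open>\<open>M\<close> factors through (P | Q), which has \<open>e + e\<close> columns, and
  its image has that dimension.\<close>

lemma full_image_diff:
  assumes "P \<in> carrier_mat n e" "Q \<in> carrier_mat n e" "X \<in> carrier_mat e k" "Y \<in> carrier_mat e k"
    and M: "M = P * X - Q * Y" "subspace_dim n (mat_image M) = 2 * e"
  shows "inj_mat (hcat P Q)" "mat_image M = mat_image (hcat P Q)"
proof -
  have Mc: "M \<in> carrier_mat n k" using assms by auto
  note h = hcat_carrier[OF assms(1,2)]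
  have "mat_image M \<subseteq> mat_image (hcat P Q)"
    unfolding mat_image_subset_iff[OF Mc h] using hcat_mult_diff[OF assms(1-4)] M(1) by metis
  moreover have "subspace_dim n (mat_image M) = e + e" using M(2) by simp
  ultimately show "inj_mat (hcat P Q)" "mat_image M = mat_image (hcat P Q)"
    using full_dim_factor[OF h Mc] by blast+
qed

lemma four_block_mat_upper_eq:
  assumes "A \<in> carrier_mat n n" "A' \<in> carrier_mat n n" "B \<in> carrier_mat n d" "B' \<in> carrier_mat n d"
    "D \<in> carrier_mat d d" "D' \<in> carrier_mat d d"
    and eq: "four_block_mat A B C D = four_block_mat A' B' C' D'"
  shows "A = A'" "B = B'"
proof -
  have e: "four_block_mat A B C D $$ (i, j) = four_block_mat A' B' C' D' $$ (i, j)" for i j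
    using eq by simp
  have "A $$ (i, j) = A' $$ (i, j)" if "i < n" "j < n" for i j using e[of i j] assms(1-6) that by simp
  then show "A = A'" using assms(1,2) by (intro eq_matI) auto
  have "B $$ (i, j) = B' $$ (i, j)" if "i < n" "j < d" for i j
    using e[of i "n + j"] assms(1-6) that by simp
  then show "B = B'" using assms(3,4) by (intro eq_matI) auto
qed

lemma mat_rearrange:
  fixes X Y Z W :: "'a::field mat"
  assumes "X \<in> carrier_mat n m" "Y \<in> carrier_mat n m" "Z \<in> carrier_mat n m" "W \<in> carrier_mat n m"
    and eq: "X + Y = Z + W"
  shows "X - Z = W - Y"
proof (rule eq_matI)
  fix i j assume "i < dim_row (W - Y)" "j < dim_col (W - Y)"
  then have ij: "i < n" "j < m" using assms by auto
  have "(X + Y) $$ (i, j) = (Z + W) $$ (i, j)" using eq by simp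
  then show "(X - Z) $$ (i, j) = (W - Y) $$ (i, j)" using ij assms(1-4) by (simp add: algebra_simps)
qed (use assms in auto)

text \<open>Compares the two upper blocks of both products. The left one gives the commutator
  identity behind the decompositions, the right one the linear systems for the \<open>D\<close>
  blocks.\<close>

lemma commuting_blocks:
  fixes A :: "'a::field mat"
  assumes c: "A \<in> carrier_mat n n" "B \<in> carrier_mat n d" "C \<in> carrier_mat d n" "D \<in> carrier_mat d d"
    and c': "A' \<in> carrier_mat n n" "B' \<in> carrier_mat n d" "C' \<in> carrier_mat d n" "D' \<in> carrier_mat d d"
    and comm: "four_block_mat A B C D * four_block_mat A' B' C' D' =
      four_block_mat A' B' C' D' * four_block_mat A B C D"
  shows "commutator A A' = B' * C - B * C'" "B' * D - B * D' = A * B' - A' * B"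
proof -
  have "A * A' + B * C' = A' * A + B' * C" "A * B' + B * D' = A' * B + B' * D"
    using four_block_mat_upper_eq[of "A * A' + B * C'" n "A' * A + B' * C" "A * B' + B * D'" d
        "A' * B + B' * D" "C * B' + D * D'" "C' * B + D' * D"]
      comm mult_four_block_mat[OF c c'] mult_four_block_mat[OF c' c] c c' by auto
  then show "commutator A A' = B' * C - B * C'" "B' * D - B * D' = A * B' - A' * B"
    using mat_rearrange[of "A * A'" n n "B * C'" "A' * A" "B' * C"]
      mat_rearrange[of "A * B'" n d "B * D'" "A' * B" "B' * D"] c c' by (auto simp: commutator_def)
qed

text \<open>\<open>e\<close> stands for \<open>r - n\<close>, the number of rows and columns that an
  extension adds.\<close>

locale dim_hypotheses =
  fixes n e :: nat and A1 A2 A3 :: "'a::field mat"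
  assumes A: "A1 \<in> carrier_mat n n" "A2 \<in> carrier_mat n n" "A3 \<in> carrier_mat n n"
    and dims: "subspace_dim n (mat_image (commutator A1 A2)) = 2 * e"
      "subspace_dim n (mat_image (commutator A1 A3)) = 2 * e"
      "subspace_dim n (mat_image (commutator A2 A3)) = 2 * e"
      "subspace_dim n (subspace_sum n (mat_image (commutator A1 A2)) (mat_image (commutator A1 A3))) = 3 * e"

text \<open>The extension is given by its blocks so that the locale can be interpreted twice: for an
  arbitrary extension and for its conjugate adapted to the chosen basis.\<close>

locale block_extension = dim_hypotheses n e A1 A2 A3
  for n e :: nat and A1 A2 A3 :: "'a::field mat" +
  fixes B1 B2 B3 C1 C2 C3 D1 D2 D3 :: "'a mat"
  assumes B: "B1 \<in> carrier_mat n e" "B2 \<in> carrier_mat n e" "B3 \<in> carrier_mat n e"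
    and C: "C1 \<in> carrier_mat e n" "C2 \<in> carrier_mat e n" "C3 \<in> carrier_mat e n"
    and D: "D1 \<in> carrier_mat e e" "D2 \<in> carrier_mat e e" "D3 \<in> carrier_mat e e"
    and comm: "four_block_mat A1 B1 C1 D1 * four_block_mat A2 B2 C2 D2 =
        four_block_mat A2 B2 C2 D2 * four_block_mat A1 B1 C1 D1"
      "four_block_mat A1 B1 C1 D1 * four_block_mat A3 B3 C3 D3 =
        four_block_mat A3 B3 C3 D3 * four_block_mat A1 B1 C1 D1"
      "four_block_mat A2 B2 C2 D2 * four_block_mat A3 B3 C3 D3 =
        four_block_mat A3 B3 C3 D3 * four_block_mat A2 B2 C2 D2"
begin

lemmas eq12 = commuting_blocks[OF A(1) B(1) C(1) D(1) A(2) B(2) C(2) D(2) comm(1)]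
lemmas eq13 = commuting_blocks[OF A(1) B(1) C(1) D(1) A(3) B(3) C(3) D(3) comm(2)]
lemmas eq23 = commuting_blocks[OF A(2) B(2) C(2) D(2) A(3) B(3) C(3) D(3) comm(3)]

text \<open>The blocks appear in the order of \<open>[A1, A2] = B2 * C1 - B1 * C2\<close>, positive
  term first; the other two pairs follow the same pattern.\<close>

lemmas im12 = full_image_diff[OF B(2,1) C(1,2) eq12(1) dims(1)]
lemmas im13 = full_image_diff[OF B(3,1) C(1,3) eq13(1) dims(2)]
lemmas im23 = full_image_diff[OF B(3,2) C(2,3) eq23(1) dims(3)]

text \<open>Each of the two commutator images contributes a component in the image of
  \<open>B1\<close>; merging these two puts the sum, of dimension \<open>3 * e\<close>, into the
  image of a matrix with \<open>3 * e\<close> columns.\<close>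

lemma inj_B123: "inj_mat (hcat (hcat B1 B2) B3)"
proof -
  note h = hcat_carrier[OF hcat_carrier[OF B(1,2)] B(3)]
  have c: "commutator A1 A2 \<in> carrier_mat n n" "commutator A1 A3 \<in> carrier_mat n n"
    using commutator_carrier A by blast+
  have "mat_image (hcat (commutator A1 A2) (commutator A1 A3)) \<subseteq> mat_image (hcat (hcat B1 B2) B3)"
  proof
    fix v assume "v \<in> mat_image (hcat (commutator A1 A2) (commutator A1 A3))"
    then obtain x y where v: "v = x + y" "x \<in> mat_image (hcat B2 B1)" "y \<in> mat_image (hcat B3 B1)"
      unfolding mat_image_hcat[OF c] im12(2) im13(2) by blast
    obtain b2 b1 where x: "x = b2 + b1" "b2 \<in> mat_image B2" "b1 \<in> mat_image B1"
      using v(2) unfolding mat_image_hcat[OF B(2,1)] by blast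
    obtain b3 b1' where y: "y = b3 + b1'" "b3 \<in> mat_image B3" "b1' \<in> mat_image B1"
      using v(3) unfolding mat_image_hcat[OF B(3,1)] by blast
    have cs: "b1 \<in> carrier_vec n" "b1' \<in> carrier_vec n" "b2 \<in> carrier_vec n" "b3 \<in> carrier_vec n"
      using mat_image_carrier B x y by blast+
    have "v = ((b1 + b1') + b2) + b3" unfolding v x y using cs by (intro eq_vecI) auto
    moreover have "b1 + b1' \<in> mat_image B1" using mat_image_add[OF B(1)] x y by blast
    ultimately show "v \<in> mat_image (hcat (hcat B1 B2) B3)"
      unfolding mat_image_hcat[OF hcat_carrier[OF B(1,2)] B(3)] mat_image_hcat[OF B(1,2)] using x y by blast
  qed
  moreover have "subspace_dim n (mat_image (hcat (commutator A1 A2) (commutator A1 A3))) = e + e + e"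
    using dims(4) unfolding subspace_sum_mat_image[OF c] by simp
  ultimately show ?thesis using full_dim_factor(1)[OF h hcat_carrier[OF c]] by blast
qed

text \<open>Each commutator image is the sum of the images of its two \<open>B\<close> blocks, and
  the sum of all three is direct, so two commutators share just the image of the block with the
  common index.\<close>

lemma inter_images:
  "mat_image (commutator A1 A2) \<inter> mat_image (commutator A1 A3) = mat_image B1"
  "mat_image (commutator A2 A1) \<inter> mat_image (commutator A2 A3) = mat_image B2"
  "mat_image (commutator A3 A1) \<inter> mat_image (commutator A3 A2) = mat_image B3"
proof -
  have c: "mat_image B1 \<subseteq> carrier_vec n" "mat_image B2 \<subseteq> carrier_vec n" "mat_image B3 \<subseteq> carrier_vec n"
    using mat_image_carrier B by blast+
  note z = mat_image_zero[OF B(1)] mat_image_zero[OF B(2)] mat_image_zero[OF B(3)]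
  note m = mat_image_minus[OF B(1)] mat_image_minus[OF B(2)] mat_image_minus[OF B(3)]
  have ind: "x = 0\<^sub>v n \<and> y = 0\<^sub>v n \<and> z = 0\<^sub>v n"
    if "x \<in> mat_image B1" "y \<in> mat_image B2" "z \<in> mat_image B3" "x + y + z = 0\<^sub>v n" for x y z
    using inj_mat_hcat3D[OF B inj_B123 that] .
  \<comment> \<open>\<open>ind\<close> expects the summands in the order \<open>B1\<close>,
    \<open>B2\<close>, \<open>B3\<close>; the second and third intersection list them
    differently.\<close>
  have perm: "x + y + z = y + x + z" "x + y + z = y + z + x"
    if "x \<in> carrier_vec n" "y \<in> carrier_vec n" "z \<in> carrier_vec n" for x y z :: "'a vec"
    using that by (auto intro!: eq_vecI)
  have s12: "mat_image (commutator A1 A2) = {x + y | x y. x \<in> mat_image B1 \<and> y \<in> mat_image B2}"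
    "mat_image (commutator A1 A2) = {x + y | x y. x \<in> mat_image B2 \<and> y \<in> mat_image B1}"
    unfolding im12(2) mat_image_hcat[OF B(2,1)] using set_sum_commute[OF c(1,2)] by blast+
  have s13: "mat_image (commutator A1 A3) = {x + y | x y. x \<in> mat_image B1 \<and> y \<in> mat_image B3}"
    "mat_image (commutator A1 A3) = {x + y | x y. x \<in> mat_image B3 \<and> y \<in> mat_image B1}"
    unfolding im13(2) mat_image_hcat[OF B(3,1)] using set_sum_commute[OF c(1,3)] by blast+
  have s23: "mat_image (commutator A2 A3) = {x + y | x y. x \<in> mat_image B2 \<and> y \<in> mat_image B3}"
    "mat_image (commutator A2 A3) = {x + y | x y. x \<in> mat_image B3 \<and> y \<in> mat_image B2}"
    unfolding im23(2) mat_image_hcat[OF B(3,2)] using set_sum_commute[OF c(2,3)] by blast+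
  show "mat_image (commutator A1 A2) \<inter> mat_image (commutator A1 A3) = mat_image B1"
    unfolding s12(1) s13(1)
    by (rule sum_inter_sum[OF c(1,2,3) z(2,3) m(1) m(3)[OF z(3)]]) (use ind in blast)+
  show "mat_image (commutator A2 A1) \<inter> mat_image (commutator A2 A3) = mat_image B2"
    unfolding mat_image_commutator_swap[OF A(1,2)] s12(2) s23(1)
  proof (rule sum_inter_sum[OF c(2,1,3) z(1,3) m(2) m(3)[OF z(3)]])
    fix x y w assume h: "x \<in> mat_image B2" "y \<in> mat_image B1" "w \<in> mat_image B3" "x + y + w = 0\<^sub>v n"
    then have "x \<in> carrier_vec n" "y \<in> carrier_vec n" "w \<in> carrier_vec n" using c by blast+
    then have "y + x + w = 0\<^sub>v n" using perm(1)[of x y w] h(4) by metis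
    then show "y = 0\<^sub>v n" using ind h by blast
  qed
  show "mat_image (commutator A3 A1) \<inter> mat_image (commutator A3 A2) = mat_image B3"
    unfolding mat_image_commutator_swap[OF A(1,3)] mat_image_commutator_swap[OF A(2,3)] s13(2) s23(2)
  proof (rule sum_inter_sum[OF c(3,1,2) z(1,2) m(3) m(2)[OF z(2)]])
    fix x y w assume h: "x \<in> mat_image B3" "y \<in> mat_image B1" "w \<in> mat_image B2" "x + y + w = 0\<^sub>v n"
    then have "x \<in> carrier_vec n" "y \<in> carrier_vec n" "w \<in> carrier_vec n" using c by blast+
    then have "y + w + x = 0\<^sub>v n" using perm(2)[of x y w] h(4) by metis
    then show "y = 0\<^sub>v n" using ind h by blast
  qed
qed

lemma commext_from_basis_eq:
  "commext_from_basis A1 A2 A3 B1 = Some (four_block_mat A1 B1 C1 D1,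
    four_block_mat A2 B2 C2 D2, four_block_mat A3 B3 C3 D3)"
proof -
  have dims: "dim_row A1 = n" "dim_col B1 = e" using A B by auto
  note inj = im12(1) im23(1) im13(1) and V = inter_images(2,3) and K = eq12(1) eq23(1) eq13(1)
    and E = eq23(2) eq12(2)
    \<comment> \<open>\<open>C2\<close> is cancelled by means of
      \<open>[A1, A2] = B2 * C1 - B1 * C2\<close>, and \<open>C3\<close> by means of
      \<open>[A1, A3] = B3 * C1 - B1 * C3\<close>: each is the right factor of the subtracted term,
      the \<open>Y\<close> of the cancellation lemma.\<close>
    and cancel = right_cancel_if_full_image[OF B(2,1) C(1,2) eq12(1) im12(2,1), of _ n]
      right_cancel_if_full_image[OF B(3,1) C(1,3) eq13(1) im13(2,1), of _ n]
  note inj1 = inj_mat_hcatD(2)[OF inj(1) B(2,1)] and inj2 = inj_mat_hcatD(1)[OF inj(1) B(2,1)]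
    and inj3 = inj_mat_hcatD(1)[OF inj(2) B(3,2)]
  have C2: "unique_solution (\<lambda>X. X \<in> carrier_mat e n \<and> B1 * X = B1 * C2) = Some C2"
    by (rule unique_solution_cancel[OF inj1 B(1) C(2)])
  have B3: "unique_solution (\<lambda>X. X \<in> carrier_mat n e \<and> X * C2 = B3 * C2) = Some B3"
    by (rule unique_solution_SomeI) (use B(3) cancel(1) in blast)+
  have C1: "unique_solution (\<lambda>X. X \<in> carrier_mat e n \<and> B3 * C1 = B3 * X) = Some C1"
    unfolding eq_commute[of "B3 * C1"] by (rule unique_solution_cancel[OF inj3 B(3) C(1)])
  have C3: "unique_solution (\<lambda>X. X \<in> carrier_mat e n \<and> B1 * C3 = B1 * X) = Some C3"
    unfolding eq_commute[of "B1 * C3"] by (rule unique_solution_cancel[OF inj1 B(1) C(3)])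
  have B2: "unique_solution (\<lambda>X. X \<in> carrier_mat n e \<and> B2 * C3 = X * C3) = Some B2"
    by (rule unique_solution_SomeI) (use B(2) cancel(2) in metis)+
  have DD: "unique_solution (\<lambda>(X, Y). X \<in> carrier_mat e e \<and> Y \<in> carrier_mat e e \<and>
      B3 * X - B2 * Y = A2 * B3 - A3 * B2) = Some (D2, D3)"
  proof -
    have mB: "- B2 \<in> carrier_mat n e" using B by simp
    obtain S where S: "S \<in> carrier_mat (e + e) e" "upper_rows e S = D2" "lower_rows e S = D3"
      using exists_stacked_rows[OF D(2,3)] by blast
    have "hcat B3 (- B2) * S = B3 * D2 + - (B2 * D3)"
      using hcat_mult[OF B(3) mB S(1)] S B D by simp
    also have "\<dots> = B3 * D2 - B2 * D3" using B D by (intro eq_matI) auto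
    finally have "hcat B3 (- B2) * S = A2 * B3 - A3 * B2" using E(1) by simp
    then have "unique_solution (\<lambda>S. S \<in> carrier_mat (e + e) e \<and> hcat B3 (- B2) * S = A2 * B3 - A3 * B2) = Some S"
      using unique_solution_cancel[OF inj_mat_hcat_uminus[OF B(3,2) inj(2)] hcat_carrier[OF B(3) mB] S(1)] by simp
    then show ?thesis using unique_solution_pair[OF B(3,2)] S by simp
  qed
  have D1: "unique_solution (\<lambda>X. X \<in> carrier_mat e e \<and> B2 * X - B1 * D2 = A1 * B2 - A2 * B1) = Some D1"
  proof (rule unique_solution_SomeI)
    fix X assume X: "X \<in> carrier_mat e e \<and> B2 * X - B1 * D2 = A1 * B2 - A2 * B1"
    then have "X \<in> carrier_mat e e" ..
    \<comment> \<open>Adding \<open>B1 * D2\<close> back reduces the equation to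
      \<open>B2 * X = B2 * D1\<close>, where the injective \<open>B2\<close> cancels.\<close>
    then have "B2 * X = (B2 * X - B1 * D2) + B1 * D2" using B D by (intro eq_matI) auto
    also have "\<dots> = (B2 * D1 - B1 * D2) + B1 * D2" using X E(2) by simp
    also have "\<dots> = B2 * D1" using B D by (intro eq_matI) auto
    finally show "X = D1" using inj_mat_cancel[OF inj2 B(2)] X D(1) by blast
  qed (use D E in auto)
  show ?thesis
    unfolding commext_from_basis_def Let_def dims V unique_decomposition[OF B(2,1) inj(1) C(1,2) K(1)]
      unique_decomposition[OF B(3,2) inj(2) C(2,3) K(2)] unique_decomposition[OF B(3,1) inj(3) C(1,3) K(3)]
    by (simp only: Option.bind.bind_lunit prod.case C2 B3 C1 C3 B2 DD D1) (simp add: comm)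
qed

end

section \<open>Change of the first basis by conjugation\<close>

lemma conjugate_mult:
  fixes T :: "'a::field mat"
  assumes "T \<in> carrier_mat m m" "T' \<in> carrier_mat m m" "T * T' = 1\<^sub>m m"
    "Z \<in> carrier_mat m m" "Z' \<in> carrier_mat m m"
  shows "(T' * Z * T) * (T' * Z' * T) = T' * (Z * Z') * T"
proof -
  have c: "T' * Z \<in> carrier_mat m m" "Z' * T \<in> carrier_mat m m" "T' * Z' * T \<in> carrier_mat m m"
    using assms by auto
  have "T * (T' * Z' * T) = T * (T' * (Z' * T))"
    unfolding assoc_mult_mat[OF assms(2,5,1)] ..
  also have "\<dots> = (T * T') * (Z' * T)" by (rule assoc_mult_mat[OF assms(1,2) c(2), symmetric])
  also have "\<dots> = Z' * T" unfolding assms(3) by (rule left_mult_one_mat[OF c(2)])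
  finally have "(T' * Z * T) * (T' * Z' * T) = (T' * Z) * (Z' * T)"
    unfolding assoc_mult_mat[OF c(1) assms(1) c(3)] by simp
  also have "\<dots> = (T' * Z) * Z' * T" by (rule assoc_mult_mat[OF c(1) assms(5,1), symmetric])
  also have "(T' * Z) * Z' = T' * (Z * Z')" by (rule assoc_mult_mat[OF assms(2,4,5)])
  finally show ?thesis .
qed

text \<open>The upper left block is untouched, so the conjugate again extends \<open>A\<close>,
  while \<open>B\<close> is multiplied by an arbitrary change of basis \<open>G\<close>.\<close>

lemma conjugate_four_block:
  fixes A :: "'a::field mat"
  assumes "A \<in> carrier_mat n n" "B \<in> carrier_mat n d" "C \<in> carrier_mat d n" "D \<in> carrier_mat d d"
    "G \<in> carrier_mat d d" "H \<in> carrier_mat d d"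
  shows "four_block_mat (1\<^sub>m n) (0\<^sub>m n d) (0\<^sub>m d n) H * four_block_mat A B C D *
      four_block_mat (1\<^sub>m n) (0\<^sub>m n d) (0\<^sub>m d n) G = four_block_mat A (B * G) (H * C) (H * D * G)"
proof -
  have z: "1\<^sub>m n \<in> carrier_mat n n" "0\<^sub>m n d \<in> carrier_mat n d" "0\<^sub>m d n \<in> carrier_mat d n" by auto
  have "four_block_mat (1\<^sub>m n) (0\<^sub>m n d) (0\<^sub>m d n) H * four_block_mat A B C D =
      four_block_mat A B (H * C) (H * D)"
    unfolding mult_four_block_mat[OF z assms(6) assms(1-4)] using assms by simp
  moreover have HC: "H * C \<in> carrier_mat d n" "H * D \<in> carrier_mat d d" using assms by auto
  ultimately show ?thesis
    using mult_four_block_mat[OF assms(1,2) HC z assms(5)] assms HC by simp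
qed

text \<open>The chosen basis \<open>b\<close> and the block \<open>B1\<close> of the given extension
  have the same image, hence differ by an invertible \<open>G\<close>. The extension conjugated by
  diag(1, G) has \<open>b\<close> as its first block, and on such an extension the algorithm is
  known to succeed.\<close>

lemma (in dim_hypotheses) commext_from_basis_exists:
  assumes e: "e = r - n" and ext: "commuting_extension n r [A1, A2, A3] [Z1, Z2, Z3]"
    and b: "b \<in> carrier_mat n e" "inj_mat b"
      "mat_image b = mat_image (commutator A1 A2) \<inter> mat_image (commutator A1 A3)"
  shows "\<exists>Z1 Z2 Z3. commext_from_basis A1 A2 A3 b = Some (Z1, Z2, Z3)"
proof -
  obtain B1 B2 B3 C1 C2 C3 D1 D2 D3 where
    B: "B1 \<in> carrier_mat n e" "B2 \<in> carrier_mat n e" "B3 \<in> carrier_mat n e" and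
    C: "C1 \<in> carrier_mat e n" "C2 \<in> carrier_mat e n" "C3 \<in> carrier_mat e n" and
    D: "D1 \<in> carrier_mat e e" "D2 \<in> carrier_mat e e" "D3 \<in> carrier_mat e e" and
    Z: "Z1 = four_block_mat A1 B1 C1 D1" "Z2 = four_block_mat A2 B2 C2 D2"
      "Z3 = four_block_mat A3 B3 C3 D3"
    using ext unfolding commuting_extension_iff ball_simps(5,7) prod.case e[symmetric]
    by (elim conjE bexE) (rule that; assumption)
  have comm: "Z1 * Z2 = Z2 * Z1" "Z1 * Z3 = Z3 * Z1" "Z2 * Z3 = Z3 * Z2"
    using ext unfolding commuting_extension_iff by blast+
  interpret old: block_extension n e A1 A2 A3 B1 B2 B3 C1 C2 C3 D1 D2 D3
    by unfold_locales (use B C D comm Z in auto)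
  have im: "mat_image b = mat_image B1" using b(3) old.inter_images(1) by simp
  obtain G where G: "G \<in> carrier_mat e e" "b = B1 * G"
    using mat_image_subset_iff[OF b(1) B(1)] im by auto
  obtain H where H: "H \<in> carrier_mat e e" "B1 = b * H"
    using mat_image_subset_iff[OF B(1) b(1)] im by auto
  \<comment> \<open>B1 G H = b H = B1; cancelling the injective \<open>B1\<close> makes
    \<open>H\<close> a right inverse of \<open>G\<close>.\<close>
  have "B1 * (G * H) = B1"
    unfolding assoc_mult_mat[OF B(1) G(1) H(1), symmetric] G(2)[symmetric] H(2)[symmetric] ..
  also have "\<dots> = B1 * 1\<^sub>m e" using B(1) by simp
  finally have BGH: "B1 * (G * H) = B1 * 1\<^sub>m e" .
  have GH: "G * H = 1\<^sub>m e"
    by (rule inj_mat_cancel[OF inj_mat_hcatD(2)[OF old.im12(1) B(2,1)] B(1)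
          mult_carrier_mat[OF G(1) H(1)] one_carrier_mat BGH])
  let ?T = "four_block_mat (1\<^sub>m n) (0\<^sub>m n e) (0\<^sub>m e n) G"
  let ?T' = "four_block_mat (1\<^sub>m n) (0\<^sub>m n e) (0\<^sub>m e n) H"
  have z: "1\<^sub>m n \<in> carrier_mat n n" "0\<^sub>m n e \<in> carrier_mat n e" "0\<^sub>m e n \<in> carrier_mat e n" by auto
  have "?T * ?T' = four_block_mat (1\<^sub>m n) (0\<^sub>m n e) (0\<^sub>m e n) (1\<^sub>m e)"
    unfolding mult_four_block_mat[OF z G(1) z H(1)] using G(1) H(1) GH by simp
  then have TT: "?T * ?T' = 1\<^sub>m (n + e)" by simp
  have Tc: "?T \<in> carrier_mat (n + e) (n + e)" "?T' \<in> carrier_mat (n + e) (n + e)"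
    using G(1) H(1) by auto
  have Zc: "Z1 \<in> carrier_mat (n + e) (n + e)" "Z2 \<in> carrier_mat (n + e) (n + e)"
    "Z3 \<in> carrier_mat (n + e) (n + e)"
    unfolding Z using A D by auto
  have new: "?T' * Z1 * ?T = four_block_mat A1 b (H * C1) (H * D1 * G)"
    "?T' * Z2 * ?T = four_block_mat A2 (B2 * G) (H * C2) (H * D2 * G)"
    "?T' * Z3 * ?T = four_block_mat A3 (B3 * G) (H * C3) (H * D3 * G)"
    unfolding Z G(2)
    by (rule conjugate_four_block[OF A(1) B(1) C(1) D(1) G(1) H(1)]
        conjugate_four_block[OF A(2) B(2) C(2) D(2) G(1) H(1)]
        conjugate_four_block[OF A(3) B(3) C(3) D(3) G(1) H(1)])+
  have ncomm: "(?T' * X * ?T) * (?T' * Y * ?T) = (?T' * Y * ?T) * (?T' * X * ?T)"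
    if "X \<in> carrier_mat (n + e) (n + e)" "Y \<in> carrier_mat (n + e) (n + e)" "X * Y = Y * X" for X Y
    using conjugate_mult[OF Tc TT that(1,2)] conjugate_mult[OF Tc TT that(2,1)] that(3) by simp
  \<comment> \<open>The same facts are now available for the conjugate, whose first block is
    \<open>b\<close>.\<close>
  interpret new: block_extension n e A1 A2 A3 b "B2 * G" "B3 * G" "H * C1" "H * C2" "H * C3"
    "H * D1 * G" "H * D2 * G" "H * D3 * G"
    by unfold_locales
      (use B C D G(1) H(1) b(1) ncomm[OF Zc(1,2) comm(1), unfolded new] ncomm[OF Zc(1,3) comm(2), unfolded new]
        ncomm[OF Zc(2,3) comm(3), unfolded new] in auto)
  show ?thesis using new.commext_from_basis_eq by blast
qed

lemma dim_intersection:
  assumes M: "M \<in> carrier_mat n k" "N \<in> carrier_mat n l"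
    and dims: "subspace_dim n (mat_image M) = 2 * e" "subspace_dim n (mat_image N) = 2 * e"
      "subspace_dim n (subspace_sum n (mat_image M) (mat_image N)) = 3 * e"
    and b: "b \<in> carrier_mat n d" "inj_mat b" "mat_image b = mat_image M \<inter> mat_image N"
  shows "d = e"
proof -
  obtain P where P: "P \<in> carrier_mat n (2 * e)" "inj_mat P" "mat_image P = mat_image M"
    using exists_basis_mat[OF M(1)] dims(1) by auto
  obtain Q where Q: "Q \<in> carrier_mat n (2 * e)" "inj_mat Q" "mat_image Q = mat_image N"
    using exists_basis_mat[OF M(2)] dims(2) by auto
  have "subspace_dim n (mat_image (hcat P Q)) = 3 * e"
    using dims(3) unfolding subspace_sum_mat_image[OF P(1) Q(1), symmetric] P(3) Q(3) .
  then show ?thesis using dim_sum_inter[OF P(1,2) Q(1,2) b(1,2)] b(3) P(3) Q(3) by simp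
qed

text \<open>Whatever basis is chosen, it has \<open>e\<close> columns by
  \<open>dim_intersection\<close>. Then \<open>None\<close> is impossible in the presence of an
  extension, and \<open>Some\<close> exhibits one.\<close>

lemma (in dim_hypotheses) commext_result_correct:
  assumes e: "e = r - n" and res: "commext_result A1 A2 A3 res"
  shows "if \<exists>Z1 Z2 Z3. commuting_extension n r [A1, A2, A3] [Z1, Z2, Z3]
    then \<exists>Z1 Z2 Z3. res = Some (Z1, Z2, Z3) \<and> commuting_extension n r [A1, A2, A3] [Z1, Z2, Z3]
    else res = None"
proof -
  note c = commutator_carrier[OF A(1,2)] commutator_carrier[OF A(1,3)]
  note K = image_inter_mat[OF c]
  obtain b where b: "dim_row b = n"
    "columns_basis_of b (mat_image (commutator A1 A2) \<inter> mat_image (commutator A1 A3))"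
    "res = commext_from_basis A1 A2 A3 b"
    using res A(1) unfolding commext_result_def by auto
  have bc: "b \<in> carrier_mat n (dim_col b)" using b(1) by auto
  have bi: "inj_mat b" "mat_image b = mat_image (commutator A1 A2) \<inter> mat_image (commutator A1 A3)"
    using b(2) unfolding K(3)[symmetric] columns_basis_of_iff[OF bc K(1)] by auto
  have dcb: "dim_col b = e" using dim_intersection[OF c dims(1,2,4) bc bi] .
  have bc': "b \<in> carrier_mat n e" using bc unfolding dcb .
  show ?thesis
  proof (cases res)
    case None
    then show ?thesis using commext_from_basis_exists[OF e _ bc' bi] b(3) by auto
  next
    case (Some Z)
    obtain Z1 Z2 Z3 where Z: "Z = (Z1, Z2, Z3)" by (cases Z) auto
    have "commuting_extension n r [A1, A2, A3] [Z1, Z2, Z3]"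
      using commext_from_basis_sound[OF A bc'[unfolded e]] b(3) Some Z by simp
    then show ?thesis using Some Z by auto
  qed
qed

section \<open>Running time\<close>

text \<open>A budget \<open>c\<close> that suffices on every path, for all register numbers and test
  outcomes; part of it may be left over at \<open>Return\<close>. The postcondition \<open>Q\<close>
  thus holds whatever the memory contains, which is why it can only concern shapes.\<close>

primrec cost_bound :: "'a prog \<Rightarrow> ('a \<Rightarrow> bool) \<Rightarrow> nat \<Rightarrow> bool" where
  "cost_bound (Return x) Q c \<longleftrightarrow> Q x"
| "cost_bound Reject Q c \<longleftrightarrow> True"
| "cost_bound (Arith f i j k) Q c \<longleftrightarrow> (\<exists>c'. c = Suc c' \<and> (\<forall>h. cost_bound (k h) Q c'))"
| "cost_bound (Test i j k) Q c \<longleftrightarrow> (\<exists>c'. c = Suc c' \<and> (\<forall>b. cost_bound (k b) Q c'))"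

lemma max_ops_le_cost: "cost_bound p Q c \<Longrightarrow> max_ops p m \<le> c"
proof (induction p arbitrary: c m)
  case (Arith f i j k)
  then show ?case by fastforce
next
  case (Test i j k)
  then show ?case by fastforce
qed auto

lemma cost_bound_mono:
  "cost_bound p Q c \<Longrightarrow> c \<le> c' \<Longrightarrow> (\<And>x. Q x \<Longrightarrow> Q' x) \<Longrightarrow> cost_bound p Q' c'"
proof (induction p arbitrary: c c')
  case (Arith f i j k)
  then obtain d where d: "c = Suc d" "\<forall>h. cost_bound (k h) Q d" by auto
  then obtain d' where d': "c' = Suc d'" "d \<le> d'" using Arith.prems(2) Suc_le_D by blast
  then show ?case using Arith.IH[OF rangeI] d Arith.prems(3) by auto
next
  case (Test i j k)
  then obtain d where d: "c = Suc d" "\<forall>h. cost_bound (k h) Q d" by auto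
  then obtain d' where d': "c' = Suc d'" "d \<le> d'" using Test.prems(2) Suc_le_D by blast
  then show ?case using Test.IH[OF rangeI] d Test.prems(3) by auto
qed auto

lemma cost_bound_bind:
  "cost_bound p Q c \<Longrightarrow> (\<And>x. Q x \<Longrightarrow> cost_bound (f x) R c') \<Longrightarrow> cost_bound (prog_bind p f) R (c + c')"
proof (induction p arbitrary: c)
  case (Return x)
  then show ?case using cost_bound_mono[of "f x" R c' "c + c'" R] by simp
next
  case (Arith g i j k)
  then show ?case by auto
next
  case (Test i j k)
  then show ?case by auto
qed auto

lemma cost_bound_bind_le:
  "cost_bound p Q c \<Longrightarrow> (\<And>x. Q x \<Longrightarrow> cost_bound (f x) R c') \<Longrightarrow> c + c' \<le> C \<Longrightarrow>
    cost_bound (prog_bind p f) R C"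
  using cost_bound_mono[OF cost_bound_bind] by blast

lemma cost_arith: "cost_bound (arith f i j) (\<lambda>_. True) 1"
  by (simp add: arith_def)

lemma cost_test_eq: "cost_bound (test_eq i j) (\<lambda>_. True) 1"
  by (simp add: test_eq_def)

lemma cost_map_prog:
  "(\<And>x. x \<in> set xs \<Longrightarrow> cost_bound (f x) Q c) \<Longrightarrow>
    cost_bound (map_prog f xs) (\<lambda>ys. length ys = length xs \<and> (\<forall>y\<in>set ys. Q y)) (length xs * c)"
proof (induction xs)
  case (Cons x xs)
  have IH: "cost_bound (map_prog f xs) (\<lambda>ys. length ys = length xs \<and> (\<forall>y\<in>set ys. Q y)) (length xs * c)"
    using Cons by simp
  have "cost_bound (prog_bind (f x) (\<lambda>y. prog_bind (map_prog f xs) (\<lambda>ys. Return (y # ys))))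
      (\<lambda>ys. length ys = length (x # xs) \<and> (\<forall>y\<in>set ys. Q y)) (c + (length xs * c + 0))"
    by (rule cost_bound_bind[OF Cons.prems], simp, rule cost_bound_bind[OF IH]) auto
  then show ?case by simp
qed simp

text \<open>Inequalities, because the number of columns of a kernel or intersection basis depends on
  the outcomes of tests.\<close>

definition dims_le :: "nat \<Rightarrow> nat \<Rightarrow> 'a mat \<Rightarrow> bool" where
  "dims_le a b M \<longleftrightarrow> dim_row M \<le> a \<and> dim_col M \<le> b"

text \<open>The unit \<open>9 * N ^ 4\<close> is the estimate for one \<open>solve_prog\<close> on
  matrices with sides bounded by \<open>N\<close>. Cheaper routines are charged a full unit, so
  costs of compositions reduce to counting calls.\<close>

definition unit_bound :: "nat \<Rightarrow> 'a prog \<Rightarrow> ('a \<Rightarrow> bool) \<Rightarrow> nat \<Rightarrow> bool" where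
  "unit_bound N p Q k \<longleftrightarrow> cost_bound p Q (k * (9 * N ^ 4))"

lemma unit_bound_Return: "Q x \<Longrightarrow> unit_bound N (Return x) Q k"
  by (simp add: unit_bound_def)

text \<open>The continuation receives the remaining budget \<open>k - j\<close>; with numerals the
  side conditions are settled by evaluation while a program is traversed.\<close>

lemma unit_bound_bind:
  "unit_bound N p Q j \<Longrightarrow> j \<le> k \<Longrightarrow> (\<And>x. Q x \<Longrightarrow> unit_bound N (f x) R (k - j)) \<Longrightarrow>
    unit_bound N (prog_bind p f) R k"
  unfolding unit_bound_def by (erule cost_bound_bind_le) (auto simp flip: add_mult_distrib)

lemma unit_bound_bind_pair:
  "unit_bound N p (\<lambda>(a, b). Q a \<and> Q' b) j \<Longrightarrow> j \<le> k \<Longrightarrow>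
    (\<And>a b. Q a \<Longrightarrow> Q' b \<Longrightarrow> unit_bound N (f a b) R (k - j)) \<Longrightarrow>
    unit_bound N (prog_bind p (\<lambda>(a, b). f a b)) R k"
  by (erule (1) unit_bound_bind) auto

lemma unit_boundI:
  assumes "cost_bound p Q c" "\<And>x. Q x \<Longrightarrow> Q' x" "1 \<le> N" "c \<le> 9 * N ^ 3 \<or> c \<le> 9 * N ^ 2"
  shows "unit_bound N p Q' (Suc 0)"
proof -
  have "N ^ 3 \<le> N ^ 4" "N ^ 2 \<le> N ^ 4" using assms(3) by (auto intro!: power_increasing)
  then have "c \<le> Suc 0 * (9 * N ^ 4)" using assms(4) by linarith
  then show ?thesis unfolding unit_bound_def using cost_bound_mono[OF assms(1)] assms(2) by blast
qed

lemma mult_le_cube: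
  fixes a b c N :: nat
  assumes "a \<le> N" "b \<le> N" "c \<le> N"
  shows "a * (b * c) \<le> N ^ 3"
  using mult_le_mono[OF assms(1) mult_le_mono[OF assms(2,3)]] by (simp add: power3_eq_cube)

lemma mult_le_square:
  fixes a b N :: nat
  assumes "a \<le> N" "b \<le> N"
  shows "a * b \<le> N ^ 2"
  using mult_le_mono[OF assms] by (simp add: power2_eq_square)

section \<open>Costs of the linear algebra routines\<close>

lemma cost_build_mat:
  assumes "\<And>i j. i < nr \<Longrightarrow> j < nc \<Longrightarrow> cost_bound (f i j) (\<lambda>_. True) c"
  shows "cost_bound (build_mat nr nc f) (\<lambda>M. dim_row M = nr \<and> dim_col M = nc) (nr * (nc * c))"
proof -
  have row: "cost_bound (map_prog (\<lambda>j. f i j) [0..<nc]) (\<lambda>_. True) (nc * c)" if "i < nr" for i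
    using cost_bound_mono[OF cost_map_prog[of "[0..<nc]" "f i" "\<lambda>_. True" c]] assms that by auto
  show ?thesis unfolding build_mat_def
    by (rule cost_bound_bind_le[OF cost_map_prog[of "[0..<nr]" _ "\<lambda>_. True" "nc * c"], where c' = 0])
      (use row in \<open>auto simp: mat_of_rows_list_def\<close>)
qed

lemma cost_dot: "cost_bound (dot_prog xs ys) (\<lambda>_. True) (2 * length xs)"
proof (induction xs ys rule: dot_prog.induct)
  case (1 x xs y ys)
  have "cost_bound (dot_prog (x # xs) (y # ys)) (\<lambda>_. True) (1 + (2 * length xs + 1))"
    unfolding dot_prog.simps by (intro cost_bound_bind[OF cost_arith] cost_bound_bind[OF 1] cost_arith)
  then show ?case by simp
qed auto

lemma cost_mult:
  assumes "dims_le a b A" "dims_le a' b' B" "a \<le> N" "b \<le> N" "b' \<le> N" "1 \<le> N"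
  shows "unit_bound N (mult_prog A B) (dims_le a b') (Suc 0)"
proof (rule unit_boundI[OF _ _ assms(6)])
  have "cost_bound (dot_prog (list_of_vec (row A i)) (list_of_vec (col B j))) (\<lambda>_. True) (2 * dim_col A)" for i j
    using cost_dot[of "list_of_vec (row A i)" "list_of_vec (col B j)"] by simp
  then show "cost_bound (mult_prog A B) (\<lambda>M. dim_row M = dim_row A \<and> dim_col M = dim_col B)
      (dim_row A * (dim_col B * (2 * dim_col A)))"
    unfolding mult_prog_def by (intro cost_build_mat)
  have "dim_row A * (dim_col B * dim_col A) \<le> N ^ 3"
    using assms by (intro mult_le_cube) (auto simp: dims_le_def)
  then show "dim_row A * (dim_col B * (2 * dim_col A)) \<le> 9 * N ^ 3 \<or>
      dim_row A * (dim_col B * (2 * dim_col A)) \<le> 9 * N ^ 2" by (simp add: algebra_simps)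
qed (use assms in \<open>auto simp: dims_le_def\<close>)

lemma cost_build_arith:
  assumes "dims_le a b A" "a \<le> N" "b \<le> N" "1 \<le> N"
  shows "unit_bound N (build_mat (dim_row A) (dim_col A) (\<lambda>i j. arith f (p i j) (q i j))) (dims_le a b) (Suc 0)"
proof -
  have "dim_row A * (dim_col A * 1) \<le> 9 * N ^ 2"
    using mult_le_square[of "dim_row A" N "dim_col A"] assms by (auto simp: dims_le_def)
  then show ?thesis
    using assms by (intro unit_boundI[OF cost_build_mat[OF cost_arith]]) (auto simp: dims_le_def)
qed

lemma cost_entrywise:
  assumes "dims_le a b A" "a \<le> N" "b \<le> N" "1 \<le> N"
  shows "unit_bound N (add_prog A B) (dims_le a b) (Suc 0)" "unit_bound N (sub_prog A B) (dims_le a b) (Suc 0)"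
    "unit_bound N (neg_prog A) (dims_le a b) (Suc 0)"
  unfolding add_prog_def sub_prog_def neg_prog_def by (rule cost_build_arith[OF assms])+

lemma cost_require_eq:
  assumes "dims_le a b A" "a \<le> N" "b \<le> N" "1 \<le> N"
  shows "unit_bound N (require_eq A B) (\<lambda>_. True) (Suc 0)"
proof (rule unit_boundI[OF _ _ assms(4)])
  have entry: "cost_bound (require_entry_prog A B i j)
      (\<lambda>_. True) 1" for i j
    by (rule cost_bound_bind_le[OF cost_test_eq, where c' = 0]) auto
  show "cost_bound (require_eq A B) (\<lambda>_. True)
      (length [0..<dim_row A] * (length [0..<dim_col A] * 1) + 0)"
    unfolding require_eq_def
    by (rule cost_bound_bind[OF cost_map_prog[OF cost_map_prog[OF entry]]]) simp
  show "length [0..<dim_row A] * (length [0..<dim_col A] * 1) + 0 \<le> 9 * N ^ 3 \<or>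
      length [0..<dim_row A] * (length [0..<dim_col A] * 1) + 0 \<le> 9 * N ^ 2"
    using mult_le_square[of "dim_row A" N "dim_col A"] assms by (auto simp: dims_le_def)
qed simp

lemma cost_commutator:
  assumes "dims_le n n A" "dims_le n n B" "n \<le> N" "1 \<le> N"
  shows "unit_bound N (commutator_prog A B) (dims_le n n) 3"
  unfolding commutator_prog_def using assms
  by - (rule unit_bound_bind cost_mult cost_entrywise | assumption | simp)+

text \<open>A vector before the pivot costs one test. After the pivot no test follows, and each
  remaining vector costs one division and two operations per coordinate. Both fit into
  \<open>2 + 2 * l\<close> per vector.\<close>

lemma cost_eliminate:
  assumes "\<forall>p\<in>set ps. length (fst p) \<le> l"
  shows "cost_bound (eliminate ps) (\<lambda>vs. length vs \<le> length ps \<and> (\<forall>v\<in>set vs. length v \<le> l))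
    (length ps * (2 + 2 * l))"
  using assms
proof (induction ps)
  case (Cons p ps)
  obtain v s where p: "p = (v, s)" by force
  let ?Q = "\<lambda>k vs. length vs \<le> k \<and> (\<forall>v\<in>set vs. length v \<le> l)"
  have keep: "cost_bound (prog_bind (eliminate ps) (\<lambda>vs. Return (v # vs))) (?Q (length (p # ps)))
      (length ps * (2 + 2 * l))"
    by (rule cost_bound_bind_le[OF Cons.IH, where c' = 0]) (use Cons.prems p in auto)
  have vec: "cost_bound (prog_bind (arith Divide t s) (\<lambda>c. sub_multiple_prog c w v)) (\<lambda>u. length u \<le> l) (1 + 2 * l)" if "length w \<le> l" for w t
  proof (rule cost_bound_bind[OF cost_arith])
    fix c
    have "cost_bound (case xy of (x, y) \<Rightarrow> prog_bind (arith Times c y) (arith Minus x)) (\<lambda>_. True) 2" for xy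
      using cost_bound_bind[OF cost_arith cost_arith] by (cases xy) (simp add: numeral_2_eq_2)
    from cost_map_prog[OF this, where xs = "zip w v"]
    have "cost_bound (sub_multiple_prog c w v)
      (\<lambda>u. length u = length (zip w v) \<and> (\<forall>y\<in>set u. True)) (length (zip w v) * 2)" by simp
    then show "cost_bound (sub_multiple_prog c w v)
      (\<lambda>u. length u \<le> l) (2 * l)"
      by (rule cost_bound_mono) (use that in auto)
  qed
  have "cost_bound (map_prog (reduce_prog s v) ps)
      (\<lambda>vs. length vs = length ps \<and> (\<forall>v\<in>set vs. length v \<le> l)) (length ps * (1 + 2 * l))"
  proof (rule cost_map_prog)
    fix q assume q: "q \<in> set ps"
    obtain w t where wt: "q = (w, t)" by force
    have "length w \<le> l" using Cons.prems q wt by fastforce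
    then show "cost_bound (reduce_prog s v q) (\<lambda>u. length u \<le> l) (1 + 2 * l)"
      unfolding wt prod.case by (rule vec)
  qed
  then have pivot: "cost_bound (map_prog (reduce_prog s v) ps)
      (?Q (length (p # ps))) (length ps * (2 + 2 * l))"
    by (rule cost_bound_mono) auto
  show ?case unfolding p eliminate.simps
  proof (rule cost_bound_bind_le[OF cost_test_eq])
    fix z
    show "cost_bound (if z then prog_bind (eliminate ps) (\<lambda>vs. Return (v # vs))
       else map_prog (reduce_prog s v) ps)
      (?Q (length ((v, s) # ps))) (length ps * (2 + 2 * l))"
      using keep pivot by simp
  qed simp
qed simp

text \<open>One row costs at most \<open>2 * N ^ 2\<close> for its values on the current basis and
  \<open>4 * N ^ 2\<close> for the elimination; the basis never gets longer.\<close>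

lemma cost_kernel_rows:
  assumes "\<forall>a\<in>set as. length a \<le> N" "length vs \<le> k" "\<forall>v\<in>set vs. length v \<le> l" "k \<le> N" "l \<le> N" "1 \<le> N"
  shows "cost_bound (kernel_rows as vs) (\<lambda>vs. length vs \<le> k \<and> (\<forall>v\<in>set vs. length v \<le> l))
    (length as * (6 * N ^ 2))"
  using assms
proof (induction as arbitrary: vs)
  case (Cons a as)
  have sq: "length vs * length a \<le> N ^ 2" "length vs * l \<le> N ^ 2" "length vs * 1 \<le> N ^ 2"
    by (rule mult_le_square; use Cons.prems in simp)+
  have "cost_bound (dot_prog a v) (\<lambda>_. True) (2 * length a)" for v by (rule cost_dot)
  from cost_map_prog[OF this, where xs = vs]
  have dots: "cost_bound (map_prog (dot_prog a) vs) (\<lambda>ss. length ss = length vs) (length vs * (2 * length a))"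
    by (rule cost_bound_mono) auto
  have "cost_bound (kernel_rows (a # as) vs) (\<lambda>vs. length vs \<le> k \<and> (\<forall>v\<in>set vs. length v \<le> l))
      (length vs * (2 * length a) + (length vs * (2 + 2 * l) + length as * (6 * N ^ 2)))"
    unfolding kernel_rows.simps
  proof (rule cost_bound_bind[OF dots])
    fix ss :: "reg list" assume ss: "length ss = length vs"
    have "\<forall>p\<in>set (zip vs ss). length (fst p) \<le> l"
      using Cons.prems(3) by (auto dest: set_zip_leftD)
    from cost_eliminate[OF this] ss
    have el: "cost_bound (eliminate (zip vs ss)) (\<lambda>ws. length ws \<le> length vs \<and> (\<forall>v\<in>set ws. length v \<le> l))
      (length vs * (2 + 2 * l))" by simp
    show "cost_bound (prog_bind (eliminate (zip vs ss)) (kernel_rows as))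
       (\<lambda>vs. length vs \<le> k \<and> (\<forall>v\<in>set vs. length v \<le> l)) (length vs * (2 + 2 * l) + length as * (6 * N ^ 2))"
      by (rule cost_bound_bind[OF el], rule Cons.IH) (use Cons.prems in auto)
  qed
  then show ?case
    by (rule cost_bound_mono) (use sq in \<open>auto simp: algebra_simps\<close>)
qed auto

lemma cost_kernel:
  assumes "dims_le a b M" "a \<le> N" "b \<le> N" "1 \<le> N"
  shows "cost_bound (kernel_prog M) (\<lambda>vs. length vs \<le> dim_col M \<and> (\<forall>v\<in>set vs. length v \<le> dim_col M)) (6 * N ^ 3)"
proof -
  have "cost_bound (kernel_prog M) (\<lambda>vs. length vs \<le> dim_col M \<and> (\<forall>v\<in>set vs. length v \<le> dim_col M))
      (length (map list_of_vec (rows M)) * (6 * N ^ 2))"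
    unfolding kernel_prog_def by (rule cost_kernel_rows) (use assms in \<open>auto simp: dims_le_def rows_def\<close>)
  moreover have "dim_row M * (6 * N ^ 2) \<le> N * (6 * N ^ 2)"
    using assms by (intro mult_le_mono1) (auto simp: dims_le_def)
  ultimately show ?thesis
    by (elim cost_bound_mono) (auto simp: power3_eq_cube power2_eq_square)
qed

lemma cost_kernel_mat:
  assumes "dims_le a b M" "a \<le> N" "b \<le> N" "1 \<le> N"
  shows "unit_bound N (kernel_mat_prog M) (dims_le b b) (Suc 0)"
  unfolding kernel_mat_prog_def
  by (rule unit_boundI[OF cost_bound_bind[OF cost_kernel[OF assms], where c' = 0 and R = "dims_le b b"]])
    (use assms in \<open>auto simp: dims_le_def mat_of_cols_list_def\<close>)

lemma dims_le_transpose: "dims_le a b M \<Longrightarrow> dims_le b a (transpose_mat M)"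
  by (simp add: dims_le_def)

lemma dims_le_hcat: "dims_le a b M \<Longrightarrow> dims_le a' b' N \<Longrightarrow> dims_le a (b + b') (hcat M N)"
  by (auto simp: dims_le_def hcat_def)

lemma dims_le_four_block:
  "dims_le a b A \<Longrightarrow> dims_le c d D \<Longrightarrow> dims_le (a + c) (b + d) (four_block_mat A B C D)"
  by (auto simp: dims_le_def)

lemma dims_le_upper_rows:
  "dims_le a b S \<Longrightarrow> dims_le c d B \<Longrightarrow> dims_le d b (upper_rows (dim_col B) S)"
  by (auto simp: dims_le_def upper_rows_def)

text \<open>A crude bound: the rows cut off are not subtracted, since the cut \<open>k\<close> is
  known only from above.\<close>

lemma dims_le_lower_rows: "dims_le a b S \<Longrightarrow> dims_le a b (lower_rows k S)"
  by (auto simp: dims_le_def lower_rows_def)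

lemma cost_image_inter:
  assumes "dims_le n n A" "dims_le n n B" "2 * n \<le> N" "1 \<le> N"
  shows "unit_bound N (image_inter_prog A B) (dims_le n n) 3"
  unfolding image_inter_prog_def using assms
  by - (rule unit_bound_bind cost_kernel_mat dims_le_transpose dims_le_hcat | assumption | simp)+

text \<open>Up to \<open>N\<close> right-hand sides, each with one kernel at
  \<open>6 * N ^ 3\<close>, one test and a normalisation at \<open>2 * N\<close>. The premise
  \<open>a + 1 \<le> N\<close> accounts for the column appended to \<open>A\<close>.\<close>

lemma cost_solve:
  assumes "dims_le n a A" "dims_le n' b B" "n \<le> N" "a + 1 \<le> N" "b \<le> N"
  shows "unit_bound N (solve_prog A B) (dims_le a b) (Suc 0)"
proof -
  have N: "1 \<le> N" using assms(4) by simp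
  have col: "cost_bound (prog_bind (kernel_prog (hcat A (mat_of_cols (dim_row A) [col B j]))) unique_kernel_prog) (\<lambda>_. True) (6 * N ^ 3 + (1 + N * 2))" for j
  proof (rule cost_bound_bind)
    have "dims_le n (a + 1) (hcat A (mat_of_cols (dim_row A) [col B j]))"
      by (rule dims_le_hcat[OF assms(1), where a' = "dim_row A"]) (simp add: dims_le_def)
    then show "cost_bound (kernel_prog (hcat A (mat_of_cols (dim_row A) [col B j])))
        (\<lambda>vs. \<forall>v\<in>set vs. length v \<le> N) (6 * N ^ 3)"
      using assms N by (intro cost_bound_mono[OF cost_kernel]) (fastforce simp: dims_le_def)+
    fix vs :: "reg list list" assume vs: "\<forall>v\<in>set vs. length v \<le> N"
    have two: "cost_bound (prog_bind (arith Divide y t) (arith Minus zero_reg)) (\<lambda>_. True) 2" for y t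
      using cost_bound_bind[OF cost_arith cost_arith] by (simp add: numeral_2_eq_2)
    have v: "cost_bound (normalize_test_prog v)
        (\<lambda>_. True) (1 + N * 2)" if "length v \<le> N" for v
    proof (rule cost_bound_bind[OF cost_test_eq])
      fix z
      have "cost_bound (normalize_prog v)
          (\<lambda>_. True) (N * 2)"
        by (rule cost_bound_mono[OF cost_map_prog[OF two]]) (use that in auto)
      then show "cost_bound (if z then Reject
          else normalize_prog v)
          (\<lambda>_. True) (N * 2)" by simp
    qed
    show "cost_bound (unique_kernel_prog vs) (\<lambda>_. True) (1 + N * 2)"
      using v vs by (auto split: list.split)
  qed
  have "N \<le> N ^ 3" using N by (simp add: self_le_power)
  then have "6 * N ^ 3 + (1 + N * 2) \<le> 9 * N ^ 3" using N by linarith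
  then have "dim_col B * (6 * N ^ 3 + (1 + N * 2)) \<le> N * (9 * N ^ 3)"
    using assms(2,5) by (intro mult_le_mono) (auto simp: dims_le_def)
  also have "\<dots> = 9 * N ^ 4" by (simp add: power4_eq_xxxx power3_eq_cube)
  finally have le: "length [0..<dim_col B] * (6 * N ^ 3 + (1 + N * 2)) + 0 \<le> Suc 0 * (9 * N ^ 4)" by simp
  show ?thesis unfolding solve_prog_def unit_bound_def
    by (rule cost_bound_bind_le[OF cost_map_prog[OF col] _ le])
      (use assms in \<open>auto simp: dims_le_def mat_of_cols_list_def\<close>)
qed

lemma cost_solve_left:
  assumes "dims_le d k C" "dims_le n k' L" "k \<le> N" "d + 1 \<le> N" "n \<le> N"
  shows "unit_bound N (solve_left_prog C L) (dims_le n d) (Suc 0)"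
  unfolding solve_left_prog_def using assms
  by - (rule unit_bound_bind unit_bound_Return cost_solve dims_le_transpose | assumption | simp)+

lemma cost_decompose:
  assumes "dims_le n n U" "dims_le n n W" "dims_le n n M" "2 * n + 1 \<le> N"
  shows "unit_bound N (decompose_prog U W M) (\<lambda>(P, Q). dims_le n n P \<and> dims_le n n Q) 4"
  unfolding decompose_prog_def using assms
  by - (rule unit_bound_bind unit_bound_Return cost_solve cost_mult cost_entrywise dims_le_hcat
      dims_le_upper_rows dims_le_lower_rows | assumption | simp)+

lemma dims_le_input: "dims_le n n (input_reg_mat n k)"
  by (simp add: dims_le_def input_reg_mat_def)

text \<open>By \<open>dims_le_lower_rows\<close> the block \<open>D3\<close> is only known to have
  at most \<open>2 * n\<close> rows, hence \<open>Z3\<close> at most \<open>3 * n\<close>; the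
  summand 1 leaves room for the appended column and keeps the bound positive for
  \<open>n = 0\<close>. The calls add up to 64 units, rounded up to 70.\<close>

lemma cost_commext: "unit_bound (3 * n + 1) (commext_prog n) (\<lambda>_. True) 70"
  unfolding commext_prog_def Let_def
  by (rule unit_bound_bind_pair unit_bound_bind unit_bound_Return cost_commutator cost_image_inter
      cost_decompose cost_solve cost_solve_left cost_mult cost_entrywise cost_require_eq dims_le_input
      dims_le_hcat dims_le_upper_rows dims_le_lower_rows dims_le_four_block | assumption | simp)+

text \<open>\<open>2 + 3 * n * n\<close> counts the registers in use at the start: two constants and
  three input matrices. The factor 630 is \<open>70 * 9\<close>.\<close>

lemma max_ops_commext_polynomial:
  "\<exists>p :: nat poly. \<forall>n. max_ops (commext_prog n) (2 + 3 * n * n) \<le> poly p n"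
proof (intro exI allI)
  fix n
  have "max_ops (commext_prog n) (2 + 3 * n * n) \<le> 70 * (9 * (3 * n + 1) ^ 4)"
    by (rule max_ops_le_cost[OF cost_commext[unfolded unit_bound_def]])
  also have "\<dots> = poly (Polynomial.smult 630 ([:1, 3:] ^ 4)) n"
    by (simp add: poly_power algebra_simps)
  finally show "max_ops (commext_prog n) (2 + 3 * n * n) \<le> poly (Polynomial.smult 630 ([:1, 3:] ^ 4)) n" .
qed

theorem theorem4:
  shows "(\<exists>p :: nat poly. \<forall>n. max_ops (commext_prog n) (2 + 3 * n * n) \<le> poly p n) \<and>
    (\<forall>n r. \<forall>(A1 :: 'k::field mat) \<in> carrier_mat n n. \<forall>A2 \<in> carrier_mat n n.
      \<forall>A3 \<in> carrier_mat n n.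
      n \<le> r \<and>
      subspace_dim n (mat_image (commutator A1 A2)) = 2 * (r - n) \<and>
      subspace_dim n (mat_image (commutator A1 A3)) = 2 * (r - n) \<and>
      subspace_dim n (mat_image (commutator A2 A3)) = 2 * (r - n) \<and>
      subspace_dim n (subspace_sum n (mat_image (commutator A1 A2)) (mat_image (commutator A1 A3)))
        = 3 * (r - n) \<and>
      subspace_dim n (subspace_sum n (mat_image (commutator A2 A1)) (mat_image (commutator A2 A3)))
        = 3 * (r - n) \<and>
      subspace_dim n (subspace_sum n (mat_image (commutator A3 A1)) (mat_image (commutator A3 A2)))
        = 3 * (r - n) \<longrightarrow>
      commext_result A1 A2 A3 (commext_run n A1 A2 A3) \<and>
      (\<forall>res. commext_result A1 A2 A3 res \<longrightarrow>
        (if \<exists>Z1 Z2 Z3. commuting_extension n r [A1, A2, A3] [Z1, Z2, Z3]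
         then \<exists>Z1 Z2 Z3. res = Some (Z1, Z2, Z3) \<and>
                commuting_extension n r [A1, A2, A3] [Z1, Z2, Z3]
         else res = None)))"
proof (intro conjI allI ballI impI)
  show "\<exists>p :: nat poly. \<forall>n. max_ops (commext_prog n) (2 + 3 * n * n) \<le> poly p n"
    by (rule max_ops_commext_polynomial)
next
  fix n r :: nat and A1 A2 A3 :: "'k mat"
  assume "A1 \<in> carrier_mat n n" "A2 \<in> carrier_mat n n" "A3 \<in> carrier_mat n n"
  then show "commext_result A1 A2 A3 (commext_run n A1 A2 A3)" by (rule commext_result_run)
qed (elim conjE, rule dim_hypotheses.commext_result_correct[rotated, OF refl], assumption,
    rule dim_hypotheses.intro; assumption)

end
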